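(* Let $K$ be a field with a fixed algebraic closure $\overline{K}$, let $X$ be an indeterminate, and let $v$ be a valuation on $\overline{K}(X)$ such that the extension $(K(X)|K,v)$ is valuation transcendental. Let $(a,\gamma)$ be a minimal pair of definition for $v$ over $K$ and fix an extension of $v$ to $\overline{K(X)}$. Then $$[K(a)^h:IC(K(X)|K,v)]=j(a)\,d(K(a,X)^h|K(X)^h,v).$$ In particular, $$[K(a)^h:IC(K(X)|K,v)]=j(a)\quad\text{whenever }(K,v)\text{ is defectless}.$$
   Context: Valuations are Krull valuations (of arbitrary rank), written additively, with $v0=\infty$. For a valued field $(F,v)$, $vF$ denotes the value group and $Fv$ the residue field; restrictions of $v$ to subfields are again denoted by $v$. The extension $(K(X)|K,v)$ is called valuation transcendental if $\dim_{\mathbb{Q}}\big(\mathbb{Q}\otimes_{\mathbb{Z}}(vK(X)/vK)\big)+\mathrm{trdeg}[K(X)v:Kv]=1$ (in general the left side is at most $1$). A pair $(a,\gamma)\in\overline{K}\times v\overline{K}(X)$ is a minimal pair of definition for $v$ over $K$ if (MP1) $v(X-a)=\gamma=\max\{v(X-c)\mid c\in\overline{K}\}$, and (MP2) for all $b\in\overline{K}$, $v(a-b)\geq\gamma$ implies $[K(b):K]\geq[K(a):K]$. For such a pair, $j(a)=j(a,K,\gamma)$ denotes the number of conjugates $a_i$ of $a$ over $K$ with $v(a-a_i)\geq\gamma$, including $a$ itself and counting multiplicities (that is, the number, with multiplicity, of roots $a_i\in\overline{K}$ of the minimal polynomial of $a$ over $K$ satisfying $v(a-a_i)\geq\gamma$).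 $\overline{K(X)}$ is an algebraic closure of $K(X)$ containing $\overline{K}(X)$, and the fixed extension of $v$ to it is again denoted by $v$. For a subfield $F$ of $\overline{K(X)}$, with separable-algebraic closure $F^{\mathrm{sep}}$ and algebraic closure $\overline{F}$ in $\overline{K(X)}$, the henselization $F^h$ (with respect to the fixed $v$) is the absolute decomposition field, i.e. the fixed field in $F^{\mathrm{sep}}$ of $\{\sigma\in\mathrm{Gal}(\overline{F}|F)\mid v\circ\sigma=v\text{ on }F^{\mathrm{sep}}\}$, where $\mathrm{Gal}(\overline{F}|F)$ is the group of all automorphisms of $\overline{F}$ over $F$. The implicit constant field is $IC(K(X)|K,v):=\overline{K}\cap K(X)^h$. If $L|F$ is a finite extension of valued fields such that $v$ has a unique extension from $F$ to $L$, then by the Lemma of Ostrowski $[L:F]=(vL:vF)[Lv:Fv]\,p^n$ with an integer $n\geq0$, where $p=\mathrm{char}\,Fv$ if this is positive and $p=1$ otherwise; the defect is $d(L|F,v):=p^n$. A henselian field $(F,v)$ is defectless if $d(L|F,v)=1$ for every finite extension $(L|F,v)$; an arbitrary valued field is defectless if its henselization is. *)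

theory Defs
  imports
    "HOL-Algebra.Algebra"
    "HOL-Algebra.Algebraic_Closure"
    "HOL-Library.Extended"
    "HOL-Library.Extended_Nat"
begin

text \<open>
  Conventions. All fields are subfields (as sets) of one ambient field \<open>L\<close>, which will be an
  algebraic closure of \<open>K(T)\<close>. There is a single valuation \<open>v\<close>, defined on \<open>L\<close>, and all other
  valuations are its restrictions. Accordingly all value groups are subgroups of the type of
  values, and all residue fields are subfields of the residue field of \<open>L\<close>. The indeterminate is
  called \<open>T\<close>, as the library reserves the token \<open>X\<close>.
\<close>

abbreviation adjoin :: "('a, 'b) ring_scheme \<Rightarrow> 'a set \<Rightarrow> 'a set \<Rightarrow> 'a set" where
  "adjoin L F S \<equiv> generate_field L (F \<union> S)"


section \<open>Krull valuations\<close>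

text \<open>
  The values lie in an arbitrary totally ordered abelian group with \<open>\<infinity>\<close> added; since
  \<^typ>\<open>'g extended\<close> also has an element \<open>-\<infinity>\<close>, that value has to be excluded.
\<close>

definition krull_valuation ::
    "('a, 'b) ring_scheme \<Rightarrow> ('a \<Rightarrow> 'g::linordered_ab_group_add extended) \<Rightarrow> bool" where
  "krull_valuation L v \<longleftrightarrow>
     (\<forall>x\<in>carrier L. v x \<noteq> Minf) \<and>
     (\<forall>x\<in>carrier L. v x = Pinf \<longleftrightarrow> x = \<zero>\<^bsub>L\<^esub>) \<and>
     (\<forall>x\<in>carrier L. \<forall>y\<in>carrier L. v (x \<otimes>\<^bsub>L\<^esub> y) = v x + v y) \<and>
     (\<forall>x\<in>carrier L. \<forall>y\<in>carrier L. v (x \<oplus>\<^bsub>L\<^esub> y) \<ge> min (v x) (v y))"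

definition value_group :: "('a \<Rightarrow> 'g::linordered_ab_group_add extended) \<Rightarrow> 'a set \<Rightarrow> 'g monoid" where
  "value_group v F = \<lparr>carrier = {g. \<exists>x\<in>F. v x = Fin g}, monoid.mult = (+), monoid.one = 0\<rparr>"

definition value_quotient ::
    "('a \<Rightarrow> 'g::linordered_ab_group_add extended) \<Rightarrow> 'a set \<Rightarrow> 'a set \<Rightarrow> 'g set monoid" where
  "value_quotient v F E = value_group v E Mod carrier (value_group v F)"

definition maximal_ideal ::
    "('a, 'b) ring_scheme \<Rightarrow> ('a \<Rightarrow> 'g::linordered_ab_group_add extended) \<Rightarrow> 'a set" where
  "maximal_ideal L v = {x \<in> carrier L. v x > 0}"

definition residue_ring_of ::
    "('a, 'b) ring_scheme \<Rightarrow> ('a \<Rightarrow> 'g::linordered_ab_group_add extended) \<Rightarrow> 'a set ring" where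
  "residue_ring_of L v = (L\<lparr>carrier := {x \<in> carrier L. v x \<ge> 0}\<rparr>) Quot maximal_ideal L v"

text \<open>The residue field \<open>Fv\<close> of a subfield \<open>F\<close>, as a subfield of \<open>Lv\<close>.\<close>

definition residues ::
    "('a, 'b) ring_scheme \<Rightarrow> ('a \<Rightarrow> 'g::linordered_ab_group_add extended) \<Rightarrow> 'a set \<Rightarrow> 'a set set" where
  "residues L v F = (\<lambda>x. maximal_ideal L v +>\<^bsub>L\<^esub> x) ` {x \<in> F. v x \<ge> 0}"


section \<open>Valuation transcendental extensions\<close>

text \<open>
  \<open>\<rat> \<otimes>\<^sub>\<int> G\<close> for an abelian group \<open>G\<close> (written multiplicatively): the free abelian group on the
  symbols \<open>(q, g)\<close> modulo the biadditivity relations, with \<open>\<rat>\<close> acting on the left factor. The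
  multiplicative part of the record is irrelevant.
\<close>

definition tensor_relators ::
    "('x, 'm) monoid_scheme \<Rightarrow> (rat \<times> 'x \<Rightarrow>\<^sub>0 int) set" where
  "tensor_relators G =
     {frag_of (q + r, g) - frag_of (q, g) - frag_of (r, g) | q r g. g \<in> carrier G} \<union>
     {frag_of (q, g \<otimes>\<^bsub>G\<^esub> h) - frag_of (q, g) - frag_of (q, h) | q g h.
        g \<in> carrier G \<and> h \<in> carrier G}"

definition rat_tensor ::
    "('x, 'm) monoid_scheme \<Rightarrow> (rat, (rat \<times> 'x \<Rightarrow>\<^sub>0 int) set) module" where
  "rat_tensor G =
     (let A = free_Abelian_group (UNIV \<times> carrier G);
          N = generate A (tensor_relators G)
      in \<lparr>carrier = carrier (A Mod N), monoid.mult = undefined, monoid.one = undefined,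
          ring.zero = \<one>\<^bsub>A Mod N\<^esub>, ring.add = monoid.mult (A Mod N),
          smult = (\<lambda>q C. \<Union>c\<in>C. N #>\<^bsub>A\<^esub> frag_extend (\<lambda>(r, g). frag_of (q * r, g)) c)\<rparr>)"

definition finite_rat_basis :: "(rat, 'x) module \<Rightarrow> 'x set \<Rightarrow> bool" where
  "finite_rat_basis M B \<longleftrightarrow>
     finite B \<and> B \<subseteq> carrier M \<and>
     (\<forall>x\<in>carrier M. \<exists>!c. c \<in> B \<rightarrow>\<^sub>E UNIV \<and> x = (\<Oplus>\<^bsub>M\<^esub>b\<in>B. c b \<odot>\<^bsub>M\<^esub> b))"

text \<open>All bases have the same cardinality; the infimum is \<open>\<infinity>\<close> if there is no finite basis.\<close>

definition rat_dim :: "(rat, 'x) module \<Rightarrow> enat" where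
  "rat_dim M = (INF B\<in>{B. finite_rat_basis M B}. enat (card B))"

definition transcendence_basis ::
    "('a, 'b) ring_scheme \<Rightarrow> 'a set \<Rightarrow> 'a set \<Rightarrow> 'a set \<Rightarrow> bool" where
  "transcendence_basis R F E B \<longleftrightarrow>
     B \<subseteq> E \<and>
     (\<forall>b\<in>B. ring.transcendental R (adjoin R F (B - {b})) b) \<and>
     (\<forall>x\<in>E. \<not> ring.transcendental R (adjoin R F B) x)"

definition trdeg :: "('a, 'b) ring_scheme \<Rightarrow> 'a set \<Rightarrow> 'a set \<Rightarrow> enat" where
  "trdeg R F E = (INF B\<in>{B. finite B \<and> transcendence_basis R F E B}. enat (card B))"

definition valuation_transcendental ::
    "('a, 'b) ring_scheme \<Rightarrow> ('a \<Rightarrow> 'g::linordered_ab_group_add extended) \<Rightarrow> 'a set \<Rightarrow> 'a set \<Rightarrow> bool" where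
  "valuation_transcendental L v F E \<longleftrightarrow>
     rat_dim (rat_tensor (value_quotient v F E)) +
     trdeg (residue_ring_of L v) (residues L v F) (residues L v E) = 1"


section \<open>Algebraic and separable closure, henselization\<close>

definition rel_alg_closure :: "('a, 'b) ring_scheme \<Rightarrow> 'a set \<Rightarrow> 'a set" where
  "rel_alg_closure L F = {x \<in> carrier L. \<not> ring.transcendental L F x}"

text \<open>As \<open>L\<close> is algebraically closed, separability means that the minimal polynomial has only
  simple roots in \<open>L\<close>.\<close>

definition rel_sep_closure :: "('a, 'b) ring_scheme \<Rightarrow> 'a set \<Rightarrow> 'a set" where
  "rel_sep_closure L F =
     {x \<in> rel_alg_closure L F. \<forall>r\<in>carrier L. ring.alg_mult L (ring.Irr L F x) r \<le> 1}"

definition Gal_closure :: "('a, 'b) ring_scheme \<Rightarrow> 'a set \<Rightarrow> ('a \<Rightarrow> 'a) set" where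
  "Gal_closure L F =
     {\<sigma> \<in> ring_iso (L\<lparr>carrier := rel_alg_closure L F\<rparr>) (L\<lparr>carrier := rel_alg_closure L F\<rparr>).
        \<forall>x\<in>F. \<sigma> x = x}"

definition decomposition_group ::
    "('a, 'b) ring_scheme \<Rightarrow> ('a \<Rightarrow> 'g::linordered_ab_group_add extended) \<Rightarrow> 'a set \<Rightarrow> ('a \<Rightarrow> 'a) set" where
  "decomposition_group L v F =
     {\<sigma> \<in> Gal_closure L F. \<forall>x\<in>rel_sep_closure L F. v (\<sigma> x) = v x}"

definition henselization ::
    "('a, 'b) ring_scheme \<Rightarrow> ('a \<Rightarrow> 'g::linordered_ab_group_add extended) \<Rightarrow> 'a set \<Rightarrow> 'a set" where
  "henselization L v F = {x \<in> rel_sep_closure L F. \<forall>\<sigma>\<in>decomposition_group L v F. \<sigma> x = x}"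

definition implicit_constant_field ::
    "('a, 'b) ring_scheme \<Rightarrow> ('a \<Rightarrow> 'g::linordered_ab_group_add extended) \<Rightarrow> 'a set \<Rightarrow> 'a \<Rightarrow> 'a set" where
  "implicit_constant_field L v K T =
     rel_alg_closure L K \<inter> henselization L v (adjoin L K {T})"


section \<open>Defect\<close>

definition char_exponent :: "('a, 'b) ring_scheme \<Rightarrow> nat" where
  "char_exponent R =
     (if \<exists>n::nat. n > 0 \<and> [n] \<cdot>\<^bsub>R\<^esub> \<one>\<^bsub>R\<^esub> = \<zero>\<^bsub>R\<^esub>
      then LEAST n::nat. n > 0 \<and> [n] \<cdot>\<^bsub>R\<^esub> \<one>\<^bsub>R\<^esub> = \<zero>\<^bsub>R\<^esub> else 1)"

text \<open>Only meaningful for a finite extension \<open>E|F\<close> such that \<open>v\<close> extends uniquely from \<open>F\<close> to \<open>E\<close>;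
  then the number described exists by the Lemma of Ostrowski.\<close>

definition defect ::
    "('a, 'b) ring_scheme \<Rightarrow> ('a \<Rightarrow> 'g::linordered_ab_group_add extended) \<Rightarrow> 'a set \<Rightarrow> 'a set \<Rightarrow> nat" where
  "defect L v F E =
     (THE d. (\<exists>n::nat. d = char_exponent ((residue_ring_of L v)\<lparr>carrier := residues L v F\<rparr>) ^ n) \<and>
        ring.dim L F E =
          order (value_quotient v F E) *
          ring.dim (residue_ring_of L v) (residues L v F) (residues L v E) * d)"

text \<open>Up to isomorphism every finite extension of \<open>F\<^sup>h\<close> is a subfield of the algebraically closed
  field \<open>L\<close>, and its valuation is the restriction of \<open>v\<close>, the extension from \<open>F\<^sup>h\<close> being unique.\<close>

definition defectless ::
    "('a, 'b) ring_scheme \<Rightarrow> ('a \<Rightarrow> 'g::linordered_ab_group_add extended) \<Rightarrow> 'a set \<Rightarrow> bool" where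
  "defectless L v F \<longleftrightarrow>
     (\<forall>E. subfield E L \<and> henselization L v F \<subseteq> E \<and>
          ring.finite_dimension L (henselization L v F) E
        \<longrightarrow> defect L v (henselization L v F) E = 1)"


section \<open>Minimal pairs of definition\<close>

definition minimal_pair_of_definition ::
    "('a, 'b) ring_scheme \<Rightarrow> ('a \<Rightarrow> 'g::linordered_ab_group_add extended) \<Rightarrow> 'a set \<Rightarrow> 'a
       \<Rightarrow> 'a \<Rightarrow> 'g \<Rightarrow> bool" where
  "minimal_pair_of_definition L v K T a \<gamma> \<longleftrightarrow>
     a \<in> rel_alg_closure L K \<and>
     \<gamma> \<in> carrier (value_group v (adjoin L (rel_alg_closure L K) {T})) \<and>
     v (T \<ominus>\<^bsub>L\<^esub> a) = Fin \<gamma> \<and>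
     (\<forall>c\<in>rel_alg_closure L K. v (T \<ominus>\<^bsub>L\<^esub> c) \<le> Fin \<gamma>) \<and>
     (\<forall>b\<in>rel_alg_closure L K. v (a \<ominus>\<^bsub>L\<^esub> b) \<ge> Fin \<gamma> \<longrightarrow>
        ring.dim L K (adjoin L K {b}) \<ge> ring.dim L K (adjoin L K {a}))"

definition num_close_conjugates ::
    "('a, 'b) ring_scheme \<Rightarrow> ('a \<Rightarrow> 'g::linordered_ab_group_add extended) \<Rightarrow> 'a set
       \<Rightarrow> 'a \<Rightarrow> 'g \<Rightarrow> nat" where
  "num_close_conjugates L v K a \<gamma> =
     size {# b \<in># ring.roots L (ring.Irr L K a). v (a \<ominus>\<^bsub>L\<^esub> b) \<ge> Fin \<gamma> #}"

end

theory Submission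
  imports Defs
begin

text \<open>
  Write \<open>F = K(T)\<close>, let \<open>N\<close> be the algebraic closure of \<open>K\<close> in \<open>L\<close>, \<open>j = j(a)\<close>, and call \<open>r \<in> N\<close> close if
  \<open>v(a - r) \<ge> \<gamma>\<close>. By the maximality of \<open>\<gamma>\<close>, the value of \<open>T - r\<close> is \<open>min {\<gamma>, v(a - r)}\<close>, so \<open>v\<close> is on \<open>N(T)\<close> the
  Gauss valuation of the ball of radius \<open>\<gamma>\<close> around \<open>a\<close>. The proof bounds a degree from both sides by \<open>j\<close>.

  Upper bound. A value preserving automorphism \<open>\<tau>\<close> of \<open>N\<close> over \<open>K\<close> is induced by one over \<open>F\<close> if and only if
  it preserves the ball, that is, if \<open>\<tau> a\<close> is close (\<open>lift_automorphism\<close>, \<open>restrict_automorphism\<close>). So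
  the implicit constant field \<open>IC\<close> is the separable fixed field in \<open>N\<close> of such automorphisms, and all
  conjugates of \<open>a\<close> over \<open>IC\<close> are close to \<open>a\<close>: \<open>[IC(a) : IC] \<le> j\<close> (\<open>degree_over_IC\<close>). Moreover \<open>K(a)\<^sup>h = IC(a)\<close>, as
  \<open>K\<^sup>h \<subseteq> IC \<subseteq> K(a)\<^sup>h\<close> (\<open>hens_Ka\<close>).

  Lower bound. Let \<open>y = T - a\<close>. A nonzero polynomial over \<open>K\<close> of degree less than that of \<open>a\<close> has no
  close root, by the minimality of \<open>a\<close>, whereas the minimal polynomial of \<open>a\<close> has \<open>j\<close> of them. Expanding
  \<open>g \<in> K[T]\<close> in powers of the minimal polynomial, one finds that the last index at which \<open>g\<close>, written as a polynomial
  in \<open>y\<close>, attains its value is a multiple of \<open>j\<close> (\<open>top_dvd\<close>). Therefore the values of \<open>f\<^sub>i y\<^sup>i\<close>, \<open>i < j\<close>, \<open>f\<^sub>i \<in> F\<close>, cannot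
  cancel, and as \<open>F\<^sup>h\<close> is immediate over \<open>F\<close> the same holds with \<open>f\<^sub>i \<in> F\<^sup>h\<close> (\<open>independent_over_hens\<close>). In
  particular \<open>[F\<^sup>h(a) : F\<^sup>h] \<ge> j\<close>. Since \<open>IC \<subseteq> F\<^sup>h\<close>,
  \<open>j \<le> [F\<^sup>h(a) : F\<^sup>h] \<le> [IC(a) : IC] \<le> j\<close> (\<open>degrees\<close>).

  Defect. The powers of \<open>y\<close> below the \<open>j\<close>-th now form a basis of \<open>F\<^sup>h(a) = K(a, T)\<^sup>h\<close> over \<open>F\<^sup>h\<close> without
  cancellation between the terms of a linear combination. The existence of such a basis forces the degree to be
  the product of the ramification index and the residue degree (\<open>valuation_basis_defectless\<close>). So the defect
  is \<open>1\<close>, the degree of \<open>K(a)\<^sup>h\<close> over \<open>IC\<close> is \<open>j\<close>, and both formulas follow.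

  Two general facts on henselizations carry this: a value preserving embedding of a subfield
  extends to its algebraic closure with the same property (\<open>extend_to_closure\<close>), and henselizations are immediate
  (\<open>hens_immediate\<close>). Both are obtained by choosing one element at which finitely many other valuations
  differ from \<open>v\<close> (\<open>separating_element\<close>), and by reading off from the coefficients of its minimal polynomial, as in a Newton
  polygon, whether there are roots of a given value (\<open>no_root_of_value_dominant\<close>).
\<close>

section \<open>Embeddings of subfields and polynomials\<close>

context field
begin

lemma inv_simps:
  assumes "x \<in> carrier R" "x \<noteq> \<zero>"
  shows "inv x \<in> carrier R" "x \<otimes> inv x = \<one>" "inv x \<otimes> x = \<one>" "inv x \<noteq> \<zero>"
proof -
  have "x \<in> Units R" using assms by (simp add: field_Units)
  then show 1: "inv x \<in> carrier R" "x \<otimes> inv x = \<one>" "inv x \<otimes> x = \<one>" by auto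
  show "inv x \<noteq> \<zero>" using 1 assms by (metis one_not_zero r_null)
qed

lemma nonzero_mult:
  assumes "x \<in> carrier R" "y \<in> carrier R" "x \<noteq> \<zero>" "y \<noteq> \<zero>" shows "x \<otimes> y \<noteq> \<zero>"
  using assms integral by blast

lemma nonzero_pow:
  assumes "x \<in> carrier R" "x \<noteq> \<zero>" shows "x [^] (n::nat) \<noteq> \<zero>"
  using assms by (induct n) (auto dest: nonzero_mult simp: nonzero_mult)

lemma frac_eq_iff:
  assumes "a \<in> carrier R" "b \<in> carrier R" "c \<in> carrier R" "d \<in> carrier R" "b \<noteq> \<zero>" "d \<noteq> \<zero>"
  shows "a \<otimes> inv b = c \<otimes> inv d \<longleftrightarrow> a \<otimes> d = c \<otimes> b"
proof
  assume h: "a \<otimes> inv b = c \<otimes> inv d"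
  have "a \<otimes> d = (a \<otimes> inv b) \<otimes> (b \<otimes> d)"
    using assms inv_simps[of b] by (simp add: m_assoc) (metis m_assoc l_one inv_simps(1,3))
  also have "\<dots> = (c \<otimes> inv d) \<otimes> (d \<otimes> b)" using h assms m_comm by simp
  also have "\<dots> = c \<otimes> b"
    using assms inv_simps[of d] by (simp add: m_assoc) (metis m_assoc l_one inv_simps(1,3))
  finally show "a \<otimes> d = c \<otimes> b" .
next
  assume h: "a \<otimes> d = c \<otimes> b"
  have "a \<otimes> inv b = (a \<otimes> d) \<otimes> (inv b \<otimes> inv d)"
    using assms inv_simps[of d] inv_simps[of b] by (simp add: m_assoc) (metis m_comm m_closed m_lcomm r_one)
  also have "\<dots> = (c \<otimes> b) \<otimes> (inv b \<otimes> inv d)" using h by simp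
  also have "\<dots> = c \<otimes> inv d"
    using assms inv_simps[of b] inv_simps[of d] by (simp add: m_assoc) (metis l_one m_assoc)
  finally show "a \<otimes> inv b = c \<otimes> inv d" .
qed

lemma inv_mult':
  assumes "x \<in> carrier R" "x \<noteq> \<zero>" "y \<in> carrier R" "y \<noteq> \<zero>"
  shows "inv (x \<otimes> y) = inv x \<otimes> inv y"
  using assms inv_simps[of x] inv_simps[of y]
  by (intro comm_inv_char) (simp_all add: m_assoc m_lcomm[of y])

lemma frac_mult:
  assumes "a \<in> carrier R" "b \<in> carrier R" "c \<in> carrier R" "d \<in> carrier R" "b \<noteq> \<zero>" "d \<noteq> \<zero>"
  shows "(a \<otimes> inv b) \<otimes> (c \<otimes> inv d) = (a \<otimes> c) \<otimes> inv (b \<otimes> d)"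
  using assms inv_simps[of d] inv_simps[of b] inv_mult'[of b d] by (simp add: m_assoc m_lcomm)

lemma frac_add:
  assumes "a \<in> carrier R" "b \<in> carrier R" "c \<in> carrier R" "d \<in> carrier R" "b \<noteq> \<zero>" "d \<noteq> \<zero>"
  shows "(a \<otimes> inv b) \<oplus> (c \<otimes> inv d) = (a \<otimes> d \<oplus> c \<otimes> b) \<otimes> inv (b \<otimes> d)"
proof -
  note i = inv_simps[of d] inv_simps[of b] inv_mult'[of b d] nonzero_mult[of b d]
  have "a \<otimes> inv b = (a \<otimes> d) \<otimes> inv (b \<otimes> d)"
    using assms i by (subst frac_eq_iff) (auto simp: m_ac)
  moreover have "c \<otimes> inv d = (c \<otimes> b) \<otimes> inv (b \<otimes> d)"
    using assms i by (subst frac_eq_iff) (auto simp: m_ac)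
  ultimately show ?thesis using assms i by (simp add: l_distr)
qed

lemma frac_inv:
  assumes "a \<in> carrier R" "b \<in> carrier R" "a \<noteq> \<zero>" "b \<noteq> \<zero>"
  shows "inv (a \<otimes> inv b) = b \<otimes> inv a"
  using assms inv_simps[of a] inv_simps[of b] inv_mult'[of a "inv b"]
  by (metis inv_mult' m_comm inv_char)

text \<open>Automorphisms and isomorphisms between subfields all have the ambient field as codomain, so that
  extending them changes nothing but the domain.\<close>

definition embedding :: "'a set \<Rightarrow> ('a \<Rightarrow> 'a) \<Rightarrow> bool" where
  "embedding M \<tau> \<longleftrightarrow> subfield M R \<and> \<tau> \<in> ring_hom (R\<lparr>carrier := M\<rparr>) R"

lemma embeddingI:
  assumes "subfield M R" "\<And>x. x \<in> M \<Longrightarrow> \<tau> x \<in> carrier R" "\<tau> \<one> = \<one>"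
    "\<And>x y. x \<in> M \<Longrightarrow> y \<in> M \<Longrightarrow> \<tau> (x \<oplus> y) = \<tau> x \<oplus> \<tau> y"
    "\<And>x y. x \<in> M \<Longrightarrow> y \<in> M \<Longrightarrow> \<tau> (x \<otimes> y) = \<tau> x \<otimes> \<tau> y"
  shows "embedding M \<tau>"
  using assms unfolding embedding_def by (auto intro!: ring_hom_memI)

lemma embedding_subfield: "embedding M \<tau> \<Longrightarrow> subfield M R"
  by (simp add: embedding_def)

lemma embedding_hom_ring:
  assumes "embedding M \<tau>" shows "ring_hom_ring (R\<lparr>carrier := M\<rparr>) R \<tau>"
  using assms unfolding embedding_def
  by (metis ring_hom_ringI2 ring_axioms subfieldE(1) subring_is_ring)

lemma embedding_simps:
  assumes "embedding M \<tau>"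
  shows "x \<in> M \<Longrightarrow> \<tau> x \<in> carrier R"
    "x \<in> M \<Longrightarrow> y \<in> M \<Longrightarrow> \<tau> (x \<oplus> y) = \<tau> x \<oplus> \<tau> y"
    "x \<in> M \<Longrightarrow> y \<in> M \<Longrightarrow> \<tau> (x \<otimes> y) = \<tau> x \<otimes> \<tau> y"
    "\<tau> \<one> = \<one>" "\<tau> \<zero> = \<zero>"
    "x \<in> M \<Longrightarrow> \<tau> (\<ominus> x) = \<ominus> (\<tau> x)"
    "x \<in> M \<Longrightarrow> y \<in> M \<Longrightarrow> \<tau> (x \<ominus> y) = \<tau> x \<ominus> \<tau> y"
    "x \<in> M \<Longrightarrow> x \<noteq> \<zero> \<Longrightarrow> \<tau> x \<noteq> \<zero>"
    "x \<in> M \<Longrightarrow> x \<noteq> \<zero> \<Longrightarrow> \<tau> (inv x) = inv (\<tau> x)"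
    "x \<in> M \<Longrightarrow> \<tau> (x [^] (n::nat)) = \<tau> x [^] n"
    "x \<in> M \<Longrightarrow> y \<in> M \<Longrightarrow> \<tau> x = \<tau> y \<longleftrightarrow> x = y"
proof -
  interpret h: ring_hom_ring "R\<lparr>carrier := M\<rparr>" R \<tau> using embedding_hom_ring[OF assms] .
  have sf: "subfield M R" using assms by (simp add: embedding_def)
  have M: "M \<subseteq> carrier R" using subfieldE(3)[OF sf] .
  have sr: "subring M R" using subfieldE(1)[OF sf] .
  show c: "\<tau> x \<in> carrier R" if "x \<in> M" for x using h.hom_closed that by simp
  show add: "\<tau> (x \<oplus> y) = \<tau> x \<oplus> \<tau> y" if "x \<in> M" "y \<in> M" for x y using h.hom_add that by simp
  show mult: "\<tau> (x \<otimes> y) = \<tau> x \<otimes> \<tau> y" if "x \<in> M" "y \<in> M" for x y using h.hom_mult that by simp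
  show one: "\<tau> \<one> = \<one>" using h.hom_one by simp
  show zero: "\<tau> \<zero> = \<zero>" using h.hom_zero by simp
  show uminus: "\<tau> (\<ominus> x) = \<ominus> (\<tau> x)" if "x \<in> M" for x
  proof -
    have m: "\<ominus> x \<in> M" using subringE(5)[OF sr] that by auto
    have "\<tau> (\<ominus> x) \<oplus> \<tau> x = \<zero>"
      using add[OF m that] zero M that by (metis l_neg subsetD)
    then show ?thesis using c[OF m] c[OF that] by (metis minus_equality)
  qed
  show min: "\<tau> (x \<ominus> y) = \<tau> x \<ominus> \<tau> y" if "x \<in> M" "y \<in> M" for x y
    using uminus[OF that(2)] add[OF that(1), of "\<ominus> y"] subringE(5)[OF sr] that
    by (simp add: minus_eq)
  show inv: "\<tau> (inv x) = inv (\<tau> x)" "\<tau> x \<noteq> \<zero>" if "x \<in> M" "x \<noteq> \<zero>" for x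
  proof -
    have i: "inv x \<in> M" "x \<otimes> inv x = \<one>" using subfield_m_inv[OF sf] that by auto
    have e: "\<tau> x \<otimes> \<tau> (inv x) = \<one>" using mult[OF that(1) i(1)] i(2) one by simp
    then show nz: "\<tau> x \<noteq> \<zero>" using c[OF i(1)] by auto
    show "\<tau> (inv x) = inv (\<tau> x)" using e c[OF i(1)] c[OF that(1)] by (metis comm_inv_char)
  qed
  show "\<tau> (x [^] (n::nat)) = \<tau> x [^] n" if "x \<in> M" for x
  proof (induct n)
    case 0 show ?case using one by simp
  next
    case (Suc n)
    have "x [^] k \<in> M" for k::nat using subringE(3,6)[OF sr] that by (induct k) auto
    then show ?case using Suc mult that by simp
  qed
  show "\<tau> x = \<tau> y \<longleftrightarrow> x = y" if "x \<in> M" "y \<in> M" for x y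
  proof
    assume "\<tau> x = \<tau> y"
    then have "\<tau> (x \<ominus> y) = \<zero>" using min[OF that] c that by simp
    moreover have "x \<ominus> y \<in> M" using subringE(5,7)[OF sr] that by (simp add: minus_eq)
    ultimately have "x \<ominus> y = \<zero>" using inv by blast
    then show "x = y" using that M by (meson r_right_minus_eq subsetD)
  qed simp
qed

lemma subfield_polyE:
  assumes "subfield M R" "p \<in> carrier (M[X])"
  shows "set p \<subseteq> M" "set p \<subseteq> carrier R" "p \<in> carrier (poly_ring R)"
  using assms subfieldE(1,3)[OF assms(1)] polynomial_incl carrier_polynomial_shell
  by (auto simp: univ_poly_carrier[symmetric])

lemma embedding_poly:
  assumes "embedding M \<tau>" "p \<in> carrier (M[X])"
  shows "map \<tau> p \<in> carrier (poly_ring R)"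
    "x \<in> M \<Longrightarrow> \<tau> (eval p x) = eval (map \<tau> p) (\<tau> x)"
    "coeff (map \<tau> p) i = \<tau> (coeff p i)"
    "q \<in> carrier (M[X]) \<Longrightarrow> map \<tau> (p \<otimes>\<^bsub>M[X]\<^esub> q) = map \<tau> p \<otimes>\<^bsub>poly_ring R\<^esub> map \<tau> q"
    "q \<in> carrier (M[X]) \<Longrightarrow> map \<tau> (p \<oplus>\<^bsub>M[X]\<^esub> q) = map \<tau> p \<oplus>\<^bsub>poly_ring R\<^esub> map \<tau> q"
proof -
  interpret h: ring_hom_ring "R\<lparr>carrier := M\<rparr>" R \<tau> using embedding_hom_ring[OF assms(1)] .
  have sf: "subfield M R" using assms by (simp add: embedding_def)
  have sr: "subring M R" using subfieldE(1)[OF sf] .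
  have cons: "carrier (univ_poly (R\<lparr>carrier := M\<rparr>) M) = carrier (M[X])"
    using univ_poly_consistent[OF sr] by simp
  have P: "map \<tau> p \<in> carrier (poly_ring R)" if "p \<in> carrier (M[X])" for p
  proof -
    have "polynomial M p" using that univ_poly_carrier by blast
    then have "p = [] \<or> (set p \<subseteq> M \<and> lead_coeff p \<noteq> \<zero>)" by (simp add: polynomial_def)
    then have "polynomial (carrier R) (map \<tau> p)"
      using embedding_simps(1,8)[OF assms(1)] by (cases p) (auto simp: polynomial_def)
    then show ?thesis using univ_poly_carrier by blast
  qed
  show "map \<tau> p \<in> carrier (poly_ring R)" using P[OF assms(2)] .
  have pM: "set p \<subseteq> M" if "p \<in> carrier (M[X])" for p using subfield_polyE(1)[OF sf that] .
  show "\<tau> (eval p x) = eval (map \<tau> p) (\<tau> x)" if "x \<in> M"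
    using h.eval_hom'[of x p] that pM[OF assms(2)] eval_consistent[OF sr] by simp
  show "coeff (map \<tau> p) i = \<tau> (coeff p i)"
    using h.coeff_hom'[of p i] pM[OF assms(2)] coeff_consistent[OF sr] by simp
  have n: "normalize (map \<tau> p) = map \<tau> p" if "p \<in> carrier (M[X])" for p
    using P[OF that] normalize_polynomial univ_poly_carrier by blast
  {
    assume q: "q \<in> carrier (M[X])"
    interpret MX: ring "M[X]" using univ_poly_is_ring[OF sr] .
    show "map \<tau> (p \<otimes>\<^bsub>M[X]\<^esub> q) = map \<tau> p \<otimes>\<^bsub>poly_ring R\<^esub> map \<tau> q"
      using h.poly_mult_hom'[of p q] pM[OF assms(2)] pM[OF q] n[OF MX.m_closed[OF assms(2) q]]
        poly_mult_consistent[OF sr] by (simp add: univ_poly_mult)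
    show "map \<tau> (p \<oplus>\<^bsub>M[X]\<^esub> q) = map \<tau> p \<oplus>\<^bsub>poly_ring R\<^esub> map \<tau> q"
      using h.poly_add_hom'[of p q] pM[OF assms(2)] pM[OF q] n[OF MX.a_closed[OF assms(2) q]]
        poly_add_consistent[OF sr] by (simp add: univ_poly_add)
  }
qed

lemma poly_mult_shell: "p \<otimes>\<^bsub>M[X]\<^esub> q = p \<otimes>\<^bsub>poly_ring R\<^esub> q"
  and poly_add_shell: "p \<oplus>\<^bsub>M[X]\<^esub> q = p \<oplus>\<^bsub>poly_ring R\<^esub> q"
  by (simp_all add: univ_poly_mult univ_poly_add)

lemma eval_mult:
  assumes "p \<in> carrier (poly_ring R)" "q \<in> carrier (poly_ring R)" "x \<in> carrier R"
  shows "eval (p \<otimes>\<^bsub>poly_ring R\<^esub> q) x = eval p x \<otimes> eval q x"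
  using eval_poly_mult[of p q x] assms subfield_polyE(2)[OF carrier_is_subfield]
  by (simp add: univ_poly_mult)

lemma eval_add:
  assumes "p \<in> carrier (poly_ring R)" "q \<in> carrier (poly_ring R)" "x \<in> carrier R"
  shows "eval (p \<oplus>\<^bsub>poly_ring R\<^esub> q) x = eval p x \<oplus> eval q x"
  using eval_poly_add[of p q x] assms subfield_polyE(2)[OF carrier_is_subfield]
  by (simp add: univ_poly_add)

lemma eval_closed:
  assumes "p \<in> carrier (poly_ring R)" "x \<in> carrier R" shows "eval p x \<in> carrier R"
  using assms eval_in_carrier subfield_polyE(2)[OF carrier_is_subfield] by blast

lemma coeff_closed:
  assumes "p \<in> carrier (poly_ring R)" shows "coeff p i \<in> carrier R"
  using assms coeff_in_carrier subfield_polyE(2)[OF carrier_is_subfield] by blast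

lemma coeff_subfield:
  assumes "subfield M R" "p \<in> carrier (M[X])" shows "coeff p i \<in> M"
proof -
  have "coeff p i \<in> set p \<union> {\<zero>}" using coeff_img(3)[of p] by blast
  then show ?thesis using subfield_polyE(1)[OF assms] subringE(2)[OF subfieldE(1)[OF assms(1)]] by auto
qed

lemma eval_subfield:
  assumes "subfield M R" "p \<in> carrier (M[X])" "x \<in> M" shows "eval p x \<in> M"
proof -
  have "set q \<subseteq> M \<Longrightarrow> eval q x \<in> M" for q
  proof (induct q)
    case Nil then show ?case using subringE(2)[OF subfieldE(1)[OF assms(1)]] by simp
  next
    case (Cons c q)
    have "x [^] k \<in> M" for k::nat using subringE(3,6)[OF subfieldE(1)[OF assms(1)]] assms by (induct k) auto
    then show ?case using Cons subringE(6,7)[OF subfieldE(1)[OF assms(1)]] by simp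
  qed
  then show ?thesis using subfield_polyE(1)[OF assms(1,2)] by blast
qed

lemma eval_as_sum:
  assumes "set p \<subseteq> carrier R" "x \<in> carrier R" "length p \<le> n"
  shows "eval p x = (\<Oplus>i\<in>{..<n}. coeff p i \<otimes> x [^] i)"
  using assms
proof (induct p arbitrary: n)
  case Nil then show ?case by (simp add: finsum_zero)
next
  case (Cons c p)
  have IH: "eval p x = (\<Oplus>i\<in>{..<length p}. coeff p i \<otimes> x [^] i)" using Cons by simp
  have cl: "coeff (c # p) i \<in> carrier R" for i using Cons.prems(1) by (rule coeff_in_carrier)
  have cl': "coeff p i \<in> carrier R" for i using Cons.prems(1) by (simp add: coeff_in_carrier)
  have "(\<Oplus>i\<in>{..<n}. coeff (c # p) i \<otimes> x [^] i) = (\<Oplus>i\<in>{..<Suc (length p)}. coeff (c # p) i \<otimes> x [^] i)"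
    using Cons.prems cl by (intro add.finprod_mono_neutral_cong_right[of _ "{..<Suc (length p)}"]) (auto simp: coeff_length simp del: coeff.simps)
  also have "\<dots> = (\<Oplus>i\<in>{..<length p}. coeff (c # p) i \<otimes> x [^] i) \<oplus> c \<otimes> x [^] length p"
    using Cons.prems cl by (subst lessThan_Suc) (auto simp del: coeff.simps simp: a_comm finsum_insert coeff.simps(2)[of c p])
  also have "(\<Oplus>i\<in>{..<length p}. coeff (c # p) i \<otimes> x [^] i) = (\<Oplus>i\<in>{..<length p}. coeff p i \<otimes> x [^] i)"
    using Cons.prems cl' by (intro finsum_cong') auto
  finally show ?case using IH Cons.prems cl' by (simp add: a_comm finsum_closed Pi_def)
qed

lemma poly_from_coeffs:
  assumes "subfield M R" "\<And>i. i < n \<Longrightarrow> c i \<in> M"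
  obtains p where "p \<in> carrier (M[X])" "length p \<le> n" "\<And>i. coeff p i = (if i < n then c i else \<zero>)"
    "\<And>x. x \<in> carrier R \<Longrightarrow> eval p x = (\<Oplus>i\<in>{..<n}. c i \<otimes> x [^] i)"
proof
  let ?l = "map c (rev [0..<n])"
  let ?p = "normalize ?l"
  have s: "set ?l \<subseteq> M" using assms(2) by auto
  show p: "?p \<in> carrier (M[X])"
    using normalize_gives_polynomial[OF s] univ_poly_carrier by blast
  show l: "length ?p \<le> n" using normalize_length_le[of ?l] by simp
  show c: "coeff ?p i = (if i < n then c i else \<zero>)" for i
  proof -
    have "coeff ?p i = coeff ?l i" using normalize_coeff[of ?l] by simp
    also have "\<dots> = (if i < n then c i else \<zero>)"
      using coeff_nth[of i ?l] coeff_length[of ?l i] by (auto simp: rev_nth)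
    finally show ?thesis .
  qed
  show "eval ?p x = (\<Oplus>i\<in>{..<n}. c i \<otimes> x [^] i)" if "x \<in> carrier R" for x
  proof -
    have "eval ?p x = (\<Oplus>i\<in>{..<n}. coeff ?p i \<otimes> x [^] i)"
      using eval_as_sum[OF subfield_polyE(2)[OF assms(1) p] that l] .
    also have "\<dots> = (\<Oplus>i\<in>{..<n}. c i \<otimes> x [^] i)"
      using that subfieldE(3)[OF assms(1)] assms(2) c by (intro finsum_cong') auto
    finally show ?thesis .
  qed
qed

lemma poly_zero_iff:
  assumes "subfield M R" "p \<in> carrier (M[X])"
  shows "p = [] \<longleftrightarrow> (\<forall>i. coeff p i = \<zero>)"
  using coeff_iff_polynomial_cond[of M p "[]"] assms univ_poly_carrier zero_is_polynomial
  by (auto simp: fun_eq_iff)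

text \<open>The degree of an algebraic element is the least degree of a nontrivial relation between its
  powers.\<close>

lemma degree_Irr_le:
  assumes "subfield M R" "x \<in> carrier R" "p \<in> carrier (M[X])" "p \<noteq> []" "eval p x = \<zero>"
  shows "algebraic M x" "degree (Irr M x) \<le> degree p"
proof -
  show a: "algebraic M x" using algebraicI[OF assms(3,4,5)] by (simp add: over_def)
  then have a': "(algebraic over M) x" by (simp add: over_def)
  show "degree (Irr M x) \<le> degree p"
    using pdivides_imp_degree_le[OF subfieldE(1)[OF assms(1)] IrrE(1)[OF assms(1,2) a'] assms(3,4)
      Irr_minimal[OF assms(1,2) a' assms(3,5)]] .
qed

lemma degree_Irr_le_relation:
  assumes "subfield M R" "x \<in> carrier R" "\<And>i. i \<le> m \<Longrightarrow> c i \<in> M"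
    "(\<Oplus>i\<in>{..m}. c i \<otimes> x [^] i) = \<zero>" "\<exists>i\<le>m. c i \<noteq> \<zero>"
  shows "algebraic M x" "degree (Irr M x) \<le> m"
proof -
  obtain p where p: "p \<in> carrier (M[X])" "length p \<le> Suc m"
    "\<And>i. coeff p i = (if i < Suc m then c i else \<zero>)"
    "\<And>x. x \<in> carrier R \<Longrightarrow> eval p x = (\<Oplus>i\<in>{..<Suc m}. c i \<otimes> x [^] i)"
    using poly_from_coeffs[OF assms(1), of "Suc m" c] assms(3) by auto
  have "p \<noteq> []" using p(3) assms(5) by (metis coeff.simps(1) le_imp_less_Suc)
  moreover have "eval p x = \<zero>" using p(4)[OF assms(2)] assms(4) by (simp add: lessThan_Suc_atMost)
  ultimately show "algebraic M x" "degree (Irr M x) \<le> m"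
    using degree_Irr_le[OF assms(1,2) p(1)] p(2) by auto
qed

lemma Irr_props:
  assumes "subfield M R" "x \<in> carrier R" "algebraic M x"
  shows "Irr M x \<in> carrier (M[X])" "Irr M x \<in> carrier (poly_ring R)" "Irr M x \<noteq> []"
    "eval (Irr M x) x = \<zero>" "degree (Irr M x) \<ge> 1" "pirreducible M (Irr M x)" "lead_coeff (Irr M x) = \<one>"
    "p \<in> carrier (M[X]) \<Longrightarrow> eval p x = \<zero> \<Longrightarrow> \<exists>q\<in>carrier (M[X]). p = Irr M x \<otimes>\<^bsub>M[X]\<^esub> q"
proof -
  have a: "(algebraic over M) x" using assms(3) by (simp add: over_def)
  note I = IrrE[OF assms(1,2) a]
  show i: "Irr M x \<in> carrier (M[X])" "pirreducible M (Irr M x)" "eval (Irr M x) x = \<zero>" "lead_coeff (Irr M x) = \<one>"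
    using I by auto
  show "Irr M x \<in> carrier (poly_ring R)" using subfield_polyE(3)[OF assms(1) i(1)] .
  show "degree (Irr M x) \<ge> 1" using pirreducible_degree[OF assms(1) i(1,2)] .
  then show "Irr M x \<noteq> []" by auto
  show "\<exists>q\<in>carrier (M[X]). p = Irr M x \<otimes>\<^bsub>M[X]\<^esub> q" if "p \<in> carrier (M[X])" "eval p x = \<zero>"
    using Irr_minimal[OF assms(1,2) a that] pdivides_iff_shell[OF assms(1) i(1) that(1)]
    by (auto simp: factor_def)
qed

text \<open>An irreducible polynomial is, up to a unit, the minimal polynomial of each of its roots.\<close>

lemma Irr_eq_of_root:
  assumes "subfield M R" "x \<in> carrier R" "algebraic M x" "r \<in> carrier R" "eval (Irr M x) r = \<zero>"
  shows "algebraic M r" "Irr M r = Irr M x"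
proof -
  note I = Irr_props[OF assms(1-3)]
  show a: "algebraic M r" using degree_Irr_le(1)[OF assms(1,4) I(1,3) assms(5)] .
  have "\<exists>!p. p \<in> carrier (M[X]) \<and> pirreducible M p \<and> eval p r = \<zero> \<and> lead_coeff p = \<one>"
    using minimal_polynomial_is_unique[OF assms(1,4)] a by (auto simp: over_def)
  then show "Irr M r = Irr M x" unfolding Irr_def[of M r]
    using I(1,4,6,7) assms(5) by (intro the1_equality) auto
qed

lemma poly_const:
  assumes "subfield M R" "c \<in> M"
  obtains p where "p \<in> carrier (M[X])" "\<And>x. x \<in> carrier R \<Longrightarrow> eval p x = c" "set p \<subseteq> {c}" "c \<noteq> \<zero> \<Longrightarrow> p = [c]" "c = \<zero> \<Longrightarrow> p = []"
proof (rule that[of "if c = \<zero> then [] else [c]"])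
qed (use assms subsetD[OF subfieldE(3)[OF assms(1)] assms(2)] in \<open>auto simp: univ_poly_carrier[symmetric] polynomial_def\<close>)

lemma var_poly:
  assumes "subfield M R"
  shows "[\<one>, \<zero>] \<in> carrier (M[X])" "x \<in> carrier R \<Longrightarrow> eval [\<one>, \<zero>] x = x"
  using subringE(2,3)[OF subfieldE(1)[OF assms]] by (auto simp: univ_poly_carrier[symmetric] polynomial_def)

lemma MX_closed:
  assumes "subfield M R" "p \<in> carrier (M[X])" "q \<in> carrier (M[X])"
  shows "p \<otimes>\<^bsub>M[X]\<^esub> q \<in> carrier (M[X])" "p \<oplus>\<^bsub>M[X]\<^esub> q \<in> carrier (M[X])" "\<ominus>\<^bsub>M[X]\<^esub> p \<in> carrier (M[X])"
    "p \<noteq> [] \<Longrightarrow> q \<noteq> [] \<Longrightarrow> p \<otimes>\<^bsub>M[X]\<^esub> q \<noteq> []"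
proof -
  interpret MX: domain "M[X]" using univ_poly_is_domain[OF subfieldE(1)[OF assms(1)]] .
  show "p \<otimes>\<^bsub>M[X]\<^esub> q \<in> carrier (M[X])" "p \<oplus>\<^bsub>M[X]\<^esub> q \<in> carrier (M[X])" "\<ominus>\<^bsub>M[X]\<^esub> p \<in> carrier (M[X])"
    using assms by auto
  show "p \<noteq> [] \<Longrightarrow> q \<noteq> [] \<Longrightarrow> p \<otimes>\<^bsub>M[X]\<^esub> q \<noteq> []"
    using MX.integral[of p q] assms(2,3) by (auto simp: univ_poly_zero)
qed

lemma MX_eval:
  assumes "subfield M R" "p \<in> carrier (M[X])" "q \<in> carrier (M[X])" "x \<in> carrier R"
  shows "eval (p \<otimes>\<^bsub>M[X]\<^esub> q) x = eval p x \<otimes> eval q x" "eval (p \<oplus>\<^bsub>M[X]\<^esub> q) x = eval p x \<oplus> eval q x"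
    "eval (\<ominus>\<^bsub>M[X]\<^esub> p) x = \<ominus> (eval p x)" "eval p x \<in> carrier R"
proof -
  show 1: "eval (p \<otimes>\<^bsub>M[X]\<^esub> q) x = eval p x \<otimes> eval q x" "eval (p \<oplus>\<^bsub>M[X]\<^esub> q) x = eval p x \<oplus> eval q x"
    using assms eval_mult eval_add subfield_polyE(3) poly_mult_shell[where M=M] poly_add_shell[where M=M] by auto
  interpret h: ring_hom_ring "M[X]" R "\<lambda>p. eval p x" using eval_ring_hom[OF subfieldE(1)[OF assms(1)] assms(4)] .
  show "eval (\<ominus>\<^bsub>M[X]\<^esub> p) x = \<ominus> (eval p x)" using h.hom_a_inv assms(2) by simp
  show "eval p x \<in> carrier R" using h.hom_closed assms(2) by simp
qed

lemma poly_diff: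
  assumes "embedding M \<tau>" "p \<in> carrier (M[X])" "q \<in> carrier (M[X])"
  obtains d where "d \<in> carrier (M[X])" "\<And>x. x \<in> carrier R \<Longrightarrow> eval d x = eval p x \<ominus> eval q x"
    "\<And>x. x \<in> carrier R \<Longrightarrow> eval (map \<tau> d) x = eval (map \<tau> p) x \<ominus> eval (map \<tau> q) x"
proof
  have sf: "subfield M R" using embedding_subfield[OF assms(1)] .
  interpret MX: domain "M[X]" using univ_poly_is_domain[OF subfieldE(1)[OF sf]] .
  let ?d = "p \<oplus>\<^bsub>M[X]\<^esub> (\<ominus>\<^bsub>M[X]\<^esub> q)"
  show d: "?d \<in> carrier (M[X])" using assms(2,3) by simp
  show "eval ?d x = eval p x \<ominus> eval q x" if "x \<in> carrier R" for x
    using MX_eval[OF sf _ _ that] assms(2,3) by (simp add: minus_eq)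
  have qq: "q \<oplus>\<^bsub>M[X]\<^esub> ?d = p" using assms(2,3) by (simp add: MX.a_lcomm MX.r_neg)
  show "eval (map \<tau> ?d) x = eval (map \<tau> p) x \<ominus> eval (map \<tau> q) x" if "x \<in> carrier R" for x
  proof -
    have "map \<tau> p = map \<tau> q \<oplus>\<^bsub>poly_ring R\<^esub> map \<tau> ?d"
      using embedding_poly(5)[OF assms(1,3) d] qq by simp
    then have e: "eval (map \<tau> p) x = eval (map \<tau> q) x \<oplus> eval (map \<tau> ?d) x"
      using eval_add[OF embedding_poly(1)[OF assms(1,3)] embedding_poly(1)[OF assms(1) d] that] by simp
    have c: "eval (map \<tau> q) x \<in> carrier R" "eval (map \<tau> ?d) x \<in> carrier R"
      using eval_closed embedding_poly(1)[OF assms(1)] assms(3) d that by blast+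
    have "w = (u \<oplus> w) \<ominus> u" if "u \<in> carrier R" "w \<in> carrier R" for u w using that by algebra
    then show ?thesis unfolding e using c by blast
  qed
qed

lemma embedding_id: "subfield M R \<Longrightarrow> embedding M (\<lambda>x. x)"
  using subfieldE(3) by (auto intro!: embeddingI)

lemma adjoin_simps:
  assumes "M \<subseteq> carrier R" "S \<subseteq> carrier R"
  shows "subfield (adjoin R M S) R" "M \<subseteq> adjoin R M S" "S \<subseteq> adjoin R M S"
    "subfield E R \<Longrightarrow> M \<subseteq> E \<Longrightarrow> S \<subseteq> E \<Longrightarrow> adjoin R M S \<subseteq> E"
  using generate_field_is_subfield[of "M \<union> S"] generate_field_min_subfield1[of "M \<union> S" E] assms
    generate_field.incl[of _ "M \<union> S" R] by auto

lemma adjoin_fractions: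
  assumes sf: "subfield M R" and x: "x \<in> carrier R"
  shows "adjoin R M {x} =
    {eval p x \<otimes> inv (eval q x) | p q. p \<in> carrier (M[X]) \<and> q \<in> carrier (M[X]) \<and> eval q x \<noteq> \<zero>}" (is "_ = ?E")
proof -
  note C = MX_closed[OF sf] and Ev = MX_eval[OF sf _ _ x]
  have one: "[\<one>] \<in> carrier (M[X])" "eval [\<one>] x = \<one>"
    using subringE(3)[OF subfieldE(1)[OF sf]] x by (auto simp: univ_poly_carrier[symmetric] polynomial_def)
  have memI: "eval p x \<otimes> inv (eval q x) \<in> ?E" if "p \<in> carrier (M[X])" "q \<in> carrier (M[X])" "eval q x \<noteq> \<zero>" for p q
    using that by blast
  have memI1: "eval p x \<in> ?E" if "p \<in> carrier (M[X])" for p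
    using memI[OF that one(1)] one(2) Ev(4)[OF that that] by simp
  have sub: "?E \<subseteq> carrier R" using Ev(4) inv_simps(1) by auto
  have sr: "subring ?E R"
  proof (rule subringI[OF sub])
    show "\<one> \<in> ?E" using memI1[OF one(1)] one(2) by simp
    fix h assume "h \<in> ?E"
    then obtain p q where h: "h = eval p x \<otimes> inv (eval q x)" "p \<in> carrier (M[X])" "q \<in> carrier (M[X])" "eval q x \<noteq> \<zero>" by blast
    have "\<ominus> h = eval (\<ominus>\<^bsub>M[X]\<^esub> p) x \<otimes> inv (eval q x)"
      using Ev h inv_simps(1)[of "eval q x"] by (simp add: l_minus)
    then show "\<ominus> h \<in> ?E" using memI[OF C(3)[OF h(2) h(2)] h(3,4)] by simp
    fix k assume "k \<in> ?E"
    then obtain p' q' where k: "k = eval p' x \<otimes> inv (eval q' x)" "p' \<in> carrier (M[X])" "q' \<in> carrier (M[X])" "eval q' x \<noteq> \<zero>" by blast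
    have nz: "eval (q \<otimes>\<^bsub>M[X]\<^esub> q') x \<noteq> \<zero>" using Ev h k nonzero_mult by simp
    have "h \<otimes> k = eval (p \<otimes>\<^bsub>M[X]\<^esub> p') x \<otimes> inv (eval (q \<otimes>\<^bsub>M[X]\<^esub> q') x)"
      using Ev h k frac_mult by simp
    then show "h \<otimes> k \<in> ?E" using memI[OF C(1)[OF h(2) k(2)] C(1)[OF h(3) k(3)] nz] by simp
    have "h \<oplus> k = eval ((p \<otimes>\<^bsub>M[X]\<^esub> q') \<oplus>\<^bsub>M[X]\<^esub> (p' \<otimes>\<^bsub>M[X]\<^esub> q)) x \<otimes> inv (eval (q \<otimes>\<^bsub>M[X]\<^esub> q') x)"
      using Ev C h k frac_add by simp
    then show "h \<oplus> k \<in> ?E" using memI[OF C(2)[OF C(1)[OF h(2) k(3)] C(1)[OF k(2) h(3)]] C(1)[OF h(3) k(3)] nz] by simp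
  qed
  have "subfield ?E R"
  proof (rule subfieldI'[OF sr])
    fix k assume "k \<in> ?E - {\<zero>}"
    then obtain p q where k: "k = eval p x \<otimes> inv (eval q x)" "p \<in> carrier (M[X])" "q \<in> carrier (M[X])" "eval q x \<noteq> \<zero>" "k \<noteq> \<zero>" by blast
    have nz: "eval p x \<noteq> \<zero>" using k Ev(4) inv_simps(1) by fastforce
    have "inv k = eval q x \<otimes> inv (eval p x)" using frac_inv k nz Ev(4) by simp
    then show "inv k \<in> ?E" using memI k nz by simp
  qed
  moreover have "M \<union> {x} \<subseteq> ?E"
  proof
    fix z assume "z \<in> M \<union> {x}"
    then show "z \<in> ?E"
    proof
      assume "z \<in> M"
      then obtain p where "p \<in> carrier (M[X])" "eval p x = z" using poly_const[OF sf] x by metis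
      then show ?thesis using memI1[of p] by simp
    next
      assume "z \<in> {x}"
      then show ?thesis using memI1[OF var_poly(1)[OF sf]] var_poly(2)[OF sf x] by simp
    qed
  qed
  moreover have "?E \<subseteq> E" if E: "subfield E R" "M \<union> {x} \<subseteq> E" for E
  proof
    fix z assume "z \<in> ?E"
    then obtain p q where z: "z = eval p x \<otimes> inv (eval q x)" "p \<in> carrier (M[X])" "q \<in> carrier (M[X])" "eval q x \<noteq> \<zero>" by blast
    have pE: "eval p x \<in> E" if "p \<in> carrier (M[X])" for p
    proof -
      have "p \<in> carrier (E[X])" using that E(2) by (auto simp: univ_poly_carrier[symmetric] polynomial_def)
      then show ?thesis using eval_subfield[OF E(1)] E(2) by auto
    qed
    have "inv (eval q x) \<in> E" using subfield_m_inv(1)[OF E(1)] pE z by blast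
    then show "z \<in> E" using z pE subringE(6)[OF subfieldE(1)[OF E(1)]] by blast
  qed
  ultimately show ?thesis using generate_fieldI[of "M \<union> {x}" ?E] sf x subfieldE(3)[OF sf] by auto
qed

text \<open>An embedding of a subfield extends to a simple extension, transcendental or not, as soon as
  the intended image of the generator satisfies the transported relations.\<close>

lemma embedding_extend:
  assumes emb: "embedding M \<tau>" and x: "x \<in> carrier R" and y: "y \<in> carrier R"
    and rel: "\<And>p. p \<in> carrier (M[X]) \<Longrightarrow> eval p x = \<zero> \<longleftrightarrow> eval (map \<tau> p) y = \<zero>"
  obtains \<tau>' where "embedding (adjoin R M {x}) \<tau>'" "\<And>z. z \<in> M \<Longrightarrow> \<tau>' z = \<tau> z" "\<tau>' x = y"
    "\<And>p q. p \<in> carrier (M[X]) \<Longrightarrow> q \<in> carrier (M[X]) \<Longrightarrow> eval q x \<noteq> \<zero> \<Longrightarrow>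
       \<tau>' (eval p x \<otimes> inv (eval q x)) = eval (map \<tau> p) y \<otimes> inv (eval (map \<tau> q) y)"
    "\<And>p. p \<in> carrier (M[X]) \<Longrightarrow> \<tau>' (eval p x) = eval (map \<tau> p) y"
proof -
  have sf: "subfield M R" using embedding_subfield[OF emb] .
  note C = MX_closed[OF sf] and Ev = MX_eval[OF sf _ _ x]
  have EC: "eval (map \<tau> p) y \<in> carrier R" if "p \<in> carrier (M[X])" for p
    using eval_closed[OF embedding_poly(1)[OF emb that] y] .
  have EM: "eval (map \<tau> (p \<otimes>\<^bsub>M[X]\<^esub> q)) y = eval (map \<tau> p) y \<otimes> eval (map \<tau> q) y"
    "eval (map \<tau> (p \<oplus>\<^bsub>M[X]\<^esub> q)) y = eval (map \<tau> p) y \<oplus> eval (map \<tau> q) y"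
    if "p \<in> carrier (M[X])" "q \<in> carrier (M[X])" for p q
    using embedding_poly(4,5)[OF emb that] eval_mult eval_add embedding_poly(1)[OF emb] that y by simp_all
  \<comment> \<open>a value is computed from an arbitrarily chosen representation as a fraction; \<open>main\<close> shows independence of it\<close>
  define rep where "rep z = (SOME pq. fst pq \<in> carrier (M[X]) \<and> snd pq \<in> carrier (M[X]) \<and>
      eval (snd pq) x \<noteq> \<zero> \<and> z = eval (fst pq) x \<otimes> inv (eval (snd pq) x))" for z
  define \<tau>' where "\<tau>' z = eval (map \<tau> (fst (rep z))) y \<otimes> inv (eval (map \<tau> (snd (rep z))) y)" for z
  have main: "\<tau>' (eval p x \<otimes> inv (eval q x)) = eval (map \<tau> p) y \<otimes> inv (eval (map \<tau> q) y)"
    if pq: "p \<in> carrier (M[X])" "q \<in> carrier (M[X])" "eval q x \<noteq> \<zero>" for p q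
  proof -
    let ?z = "eval p x \<otimes> inv (eval q x)"
    have "\<exists>pq. fst pq \<in> carrier (M[X]) \<and> snd pq \<in> carrier (M[X]) \<and>
      eval (snd pq) x \<noteq> \<zero> \<and> ?z = eval (fst pq) x \<otimes> inv (eval (snd pq) x)"
      by (rule exI[of _ "(p, q)"]) (use pq in auto)
    from someI_ex[OF this]
    have rr: "fst (rep ?z) \<in> carrier (M[X])" "snd (rep ?z) \<in> carrier (M[X])"
      "eval (snd (rep ?z)) x \<noteq> \<zero>" "?z = eval (fst (rep ?z)) x \<otimes> inv (eval (snd (rep ?z)) x)"
      unfolding rep_def[symmetric] by blast+
    obtain p' q' where r1: "rep ?z = (p', q')" by fastforce
    have r: "rep ?z = (p', q')" "p' \<in> carrier (M[X])" "q' \<in> carrier (M[X])"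
      "eval q' x \<noteq> \<zero>" "?z = eval p' x \<otimes> inv (eval q' x)"
      using rr unfolding r1 fst_conv snd_conv by blast+
    have "eval p x \<otimes> eval q' x = eval p' x \<otimes> eval q x"
      using r(5) frac_eq_iff[of "eval p x" "eval q x" "eval p' x" "eval q' x"] Ev(4)[OF pq(1) pq(1)]
        Ev(4)[OF pq(2) pq(2)] Ev(4)[OF r(2) r(2)] Ev(4)[OF r(3) r(3)] pq(3) r(4) by simp
    then have e: "eval (p \<otimes>\<^bsub>M[X]\<^esub> q') x = eval (p' \<otimes>\<^bsub>M[X]\<^esub> q) x" using Ev(1) pq r by simp
    obtain d where d: "d \<in> carrier (M[X])" "\<And>x. x \<in> carrier R \<Longrightarrow> eval d x = eval (p \<otimes>\<^bsub>M[X]\<^esub> q') x \<ominus> eval (p' \<otimes>\<^bsub>M[X]\<^esub> q) x"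
      "\<And>x. x \<in> carrier R \<Longrightarrow> eval (map \<tau> d) x = eval (map \<tau> (p \<otimes>\<^bsub>M[X]\<^esub> q')) x \<ominus> eval (map \<tau> (p' \<otimes>\<^bsub>M[X]\<^esub> q)) x"
      using poly_diff[OF emb C(1)[OF pq(1) r(3)] C(1)[OF r(2) pq(2)]] by metis
    have "eval d x = \<zero>" using d(2)[OF x] e Ev(4) C(1) pq r by (metis r_right_minus_eq)
    then have "eval (map \<tau> d) y = \<zero>" using rel d(1) by simp
    then have "eval (map \<tau> p) y \<otimes> eval (map \<tau> q') y = eval (map \<tau> p') y \<otimes> eval (map \<tau> q) y"
      using d(3)[OF y] EM pq r EC by simp
    moreover have "eval (map \<tau> q) y \<noteq> \<zero>" "eval (map \<tau> q') y \<noteq> \<zero>" using rel pq r by auto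
    ultimately show ?thesis unfolding \<tau>'_def r(1) using frac_eq_iff EC pq r by simp
  qed
  have one: "[\<one>] \<in> carrier (M[X])" "eval [\<one>] x = \<one>" "eval (map \<tau> [\<one>]) y = \<one>"
    using subringE(3)[OF subfieldE(1)[OF sf]] x y embedding_simps(4)[OF emb]
    by (auto simp: univ_poly_carrier[symmetric] polynomial_def)
  have main1: "\<tau>' (eval p x) = eval (map \<tau> p) y" if "p \<in> carrier (M[X])" for p
    using main[OF that one(1)] one EC[OF that] Ev(4)[OF that that] by simp
  have ext: "\<tau>' z = \<tau> z" if z: "z \<in> M" for z
  proof -
    obtain p where p: "p \<in> carrier (M[X])" "\<And>x. x \<in> carrier R \<Longrightarrow> eval p x = z" "z \<noteq> \<zero> \<Longrightarrow> p = [z]" "z = \<zero> \<Longrightarrow> p = []"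
      using poly_const[OF sf z] by metis
    have "eval (map \<tau> p) y = \<tau> z" using p(3,4) y embedding_simps(1,5)[OF emb] z by (cases "z = \<zero>") auto
    then show ?thesis using main1[OF p(1)] p(2)[OF x] by simp
  qed
  have xy: "\<tau>' x = y"
    using main1[OF var_poly(1)[OF sf]] var_poly(2)[OF sf x] embedding_simps(4,5)[OF emb] y by simp
  have fr: "\<exists>p q. z = eval p x \<otimes> inv (eval q x) \<and> p \<in> carrier (M[X]) \<and> q \<in> carrier (M[X]) \<and> eval q x \<noteq> \<zero>"
    if "z \<in> adjoin R M {x}" for z using that unfolding adjoin_fractions[OF sf x] by blast
  have "embedding (adjoin R M {x}) \<tau>'"
  proof (rule embeddingI)
    show "subfield (adjoin R M {x}) R" using adjoin_simps(1)[of M "{x}"] subfieldE(3)[OF sf] x by simp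
    show "\<tau>' \<one> = \<one>" using ext subringE(3)[OF subfieldE(1)[OF sf]] embedding_simps(4)[OF emb] by simp
    fix h assume "h \<in> adjoin R M {x}"
    then obtain p q where h: "h = eval p x \<otimes> inv (eval q x)" "p \<in> carrier (M[X])" "q \<in> carrier (M[X])" "eval q x \<noteq> \<zero>" using fr by blast
    have hq: "eval (map \<tau> q) y \<noteq> \<zero>" using rel h by auto
    show "\<tau>' h \<in> carrier R" using main[OF h(2-4)] EC h inv_simps(1)[OF _ hq] by simp
    fix k assume "k \<in> adjoin R M {x}"
    then obtain p' q' where k: "k = eval p' x \<otimes> inv (eval q' x)" "p' \<in> carrier (M[X])" "q' \<in> carrier (M[X])" "eval q' x \<noteq> \<zero>" using fr by blast
    have kq: "eval (map \<tau> q') y \<noteq> \<zero>" using rel k by auto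
    have nz: "eval (q \<otimes>\<^bsub>M[X]\<^esub> q') x \<noteq> \<zero>" using Ev h k nonzero_mult by simp
    have "h \<otimes> k = eval (p \<otimes>\<^bsub>M[X]\<^esub> p') x \<otimes> inv (eval (q \<otimes>\<^bsub>M[X]\<^esub> q') x)"
      using Ev h k frac_mult by simp
    then show "\<tau>' (h \<otimes> k) = \<tau>' h \<otimes> \<tau>' k"
      using main[OF C(1)[OF h(2) k(2)] C(1)[OF h(3) k(3)] nz] main[OF h(2-4)] main[OF k(2-4)] h k hq kq EM EC
      by (simp add: frac_mult)
    have "h \<oplus> k = eval ((p \<otimes>\<^bsub>M[X]\<^esub> q') \<oplus>\<^bsub>M[X]\<^esub> (p' \<otimes>\<^bsub>M[X]\<^esub> q)) x \<otimes> inv (eval (q \<otimes>\<^bsub>M[X]\<^esub> q') x)"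
      using Ev C h k frac_add by simp
    then show "\<tau>' (h \<oplus> k) = \<tau>' h \<oplus> \<tau>' k"
      using main[OF C(2)[OF C(1)[OF h(2) k(3)] C(1)[OF k(2) h(3)]] C(1)[OF h(3) k(3)] nz] main[OF h(2-4)] main[OF k(2-4)] h k hq kq EM EC C
      by (simp add: frac_add)
  qed
  then show thesis using that ext xy main main1 by blast
qed

lemma adjoin_algebraic:
  assumes "subfield M R" "x \<in> carrier R" "algebraic M x"
  shows "adjoin R M {x} = simple_extension M x"
    "adjoin R M {x} = (\<lambda>p. eval p x) ` {p \<in> carrier (M[X]). length p \<le> degree (Irr M x)}"
    "dimension (degree (Irr M x)) M (adjoin R M {x})"
    "dim M (adjoin R M {x}) = degree (Irr M x)"
    "\<And>z. z \<in> adjoin R M {x} \<Longrightarrow> algebraic M z"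
proof -
  have a: "(algebraic over M) x" using assms(3) by (simp add: over_def)
  have sub: "subfield (simple_extension M x) R" using simple_extension_is_subfield[OF assms(1,2)] a by simp
  show e: "adjoin R M {x} = simple_extension M x"
    using generate_fieldI[of "M \<union> {x}" "simple_extension M x"] sub simple_extension_incl[of M x]
      simple_extension_mem[OF subfieldE(1)[OF assms(1)] assms(2)] subfieldE(3)[OF assms(1)] assms(2)
      simple_extension_subring_incl[OF subfieldE(1)] by auto
  show "adjoin R M {x} = (\<lambda>p. eval p x) ` {p \<in> carrier (M[X]). length p \<le> degree (Irr M x)}"
    using Span_exp_base[OF assms(1,2) a] Span_eq_eval_img[OF assms(1,2)] e by simp
  show d: "dimension (degree (Irr M x)) M (adjoin R M {x})" using dimension_simple_extension[OF assms(1,2) a] e by simp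
  show "dim M (adjoin R M {x}) = degree (Irr M x)" using dimI[OF assms(1) d] by (simp add: over_def)
  show "algebraic M z" if "z \<in> adjoin R M {x}" for z
    using finite_dimension_imp_algebraic[OF assms(1) subfieldE(1)[OF sub] finite_dimensionI] d e that by (auto simp: over_def)
qed

end

context algebraically_closed
begin

text \<open>Over an algebraically closed field, a polynomial is obtained from a constant by multiplying with linear factors.\<close>

lemma linear_factor_induct [consumes 2, case_names const linear]:
  assumes "p \<in> carrier (poly_ring L)" "p \<noteq> []"
    and "\<And>c. c \<in> carrier L \<Longrightarrow> c \<noteq> \<zero> \<Longrightarrow> P [c]"
    and "\<And>r q. r \<in> carrier L \<Longrightarrow> q \<in> carrier (poly_ring L) \<Longrightarrow> q \<noteq> [] \<Longrightarrow> P q \<Longrightarrow> P ([\<one>, \<ominus> r] \<otimes>\<^bsub>poly_ring L\<^esub> q)"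
  shows "P p"
  using assms(1,2)
proof (induction "degree p" arbitrary: p rule: less_induct)
  case less
  show ?case
  proof (cases "degree p = 0")
    case True
    then obtain c where "p = [c]" using less.prems(2) by (cases p) auto
    then show ?thesis using assms(3) less.prems by (auto simp: univ_poly_carrier[symmetric] polynomial_def)
  next
    case False
    then have "roots p \<noteq> {#}" using roots_over_carrier[OF less.prems(1)] unfolding splitted_def by auto
    then obtain r where r: "r \<in> carrier L" "[\<one>, \<ominus> r] \<in> carrier (poly_ring L)" "[\<one>, \<ominus> r] pdivides p"
      using not_empty_rootsE[OF less.prems(1)] by metis
    then obtain q where q: "q \<in> carrier (poly_ring L)" "p = [\<one>, \<ominus> r] \<otimes>\<^bsub>poly_ring L\<^esub> q"
      unfolding pdivides_def factor_def by blast
    interpret PX: domain "poly_ring L" using univ_poly_is_domain[OF carrier_is_subring] .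
    have nz: "q \<noteq> []" using q(2) less.prems(2) PX.r_null[OF r(2)] by (auto simp: univ_poly_zero)
    have "degree p = 1 + degree q"
      using poly_mult_degree_eq[OF carrier_is_subring, of "[\<one>, \<ominus> r]" q] nz q r(2)
      by (simp add: univ_poly_mult univ_poly_carrier)
    then have "P q" using less.hyps[of q] q nz by simp
    then show ?thesis using assms(4)[OF r(1) q(1) nz] q(2) by simp
  qed
qed

lemma root_exists:
  assumes "p \<in> carrier (poly_ring L)" "degree p \<ge> 1"
  obtains r where "r \<in> carrier L" "eval p r = \<zero>"
proof -
  have "roots p \<noteq> {#}" using roots_over_carrier[OF assms(1)] assms(2) unfolding splitted_def by auto
  then obtain r where "r \<in># roots p" by blast
  then show ?thesis using that roots_mem_iff_is_root[OF assms(1)] unfolding is_root_def by auto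
qed

lemma linear_poly: "r \<in> carrier L \<Longrightarrow> [\<one>, \<ominus> r] \<in> carrier (poly_ring L)"
  by (auto simp: univ_poly_carrier[symmetric] polynomial_def)

lemma eval_linear: "r \<in> carrier L \<Longrightarrow> x \<in> carrier L \<Longrightarrow> eval [\<one>, \<ominus> r] x = x \<ominus> r"
  by (simp add: minus_eq)

lemma coeff_linear_mult:
  assumes "r \<in> carrier L" "q \<in> carrier (poly_ring L)"
  shows "coeff ([\<one>, \<ominus> r] \<otimes>\<^bsub>poly_ring L\<^esub> q) i = (if i = 0 then \<zero> else coeff q (i - 1)) \<ominus> r \<otimes> coeff q i"
proof -
  have s: "set [\<one>, \<ominus> r] \<subseteq> carrier L" "set q \<subseteq> carrier L"
    using assms subfield_polyE(2)[OF carrier_is_subfield] by auto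
  note cq = coeff_closed[OF assms(2)]
  have "coeff ([\<one>, \<ominus> r] \<otimes>\<^bsub>poly_ring L\<^esub> q) i = (\<Oplus>k\<in>{..i}. coeff [\<one>, \<ominus> r] k \<otimes> coeff q (i - k))"
    using poly_mult_coeff[OF s] by (simp add: univ_poly_mult)
  also have "\<dots> = (\<Oplus>k\<in>{..i} \<inter> {0,1}. coeff [\<one>, \<ominus> r] k \<otimes> coeff q (i - k))"
    using cq assms(1) by (intro add.finprod_mono_neutral_cong_right) auto
  also have "\<dots> = (if i = 0 then \<zero> else coeff q (i - 1)) \<ominus> r \<otimes> coeff q i"
  proof (cases "i = 0")
    case True then show ?thesis using cq assms(1) by (auto simp: minus_eq l_minus)
  next
    case False
    then have "{..i} \<inter> {0,1} = {0,1}" by auto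
    then show ?thesis using cq assms(1) False by (auto simp: minus_eq l_minus a_comm)
  qed
  finally show ?thesis .
qed

text \<open>A nonzero value \<open>p(x)\<close> has an inverse \<open>q(x)\<close>, and the relation \<open>p(x) q(x) = 1\<close> survives the transport to \<open>y\<close>.\<close>

lemma root_of_Irr_relations:
  assumes emb: "embedding M \<tau>" and x: "x \<in> carrier L" "algebraic M x"
    and y: "y \<in> carrier L" "eval (map \<tau> (Irr M x)) y = \<zero>" and p: "p \<in> carrier (M[X])"
  shows "eval p x = \<zero> \<longleftrightarrow> eval (map \<tau> p) y = \<zero>"
proof -
  have M: "subfield M L" using embedding_subfield[OF emb] .
  note I = Irr_props[OF M x]
  have fwd: "eval (map \<tau> p) y = \<zero>" if p: "p \<in> carrier (M[X])" "eval p x = \<zero>" for p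
  proof -
    obtain q where q: "q \<in> carrier (M[X])" "p = Irr M x \<otimes>\<^bsub>M[X]\<^esub> q" using I(8)[OF p] by blast
    show ?thesis
      using embedding_poly(4)[OF emb I(1) q(1)] q(2) eval_mult[OF embedding_poly(1)[OF emb I(1)] embedding_poly(1)[OF emb q(1)] y(1)]
        y(2) eval_closed[OF embedding_poly(1)[OF emb q(1)] y(1)] by simp
  qed
  have "eval p x = \<zero>" if e: "eval (map \<tau> p) y = \<zero>"
  proof (rule ccontr)
    assume nz: "eval p x \<noteq> \<zero>"
    let ?E = "adjoin L M {x}"
    have E: "subfield ?E L" using adjoin_simps(1)[of M "{x}"] subfieldE(3)[OF M] x by simp
    have c: "eval p x \<in> carrier L" using MX_eval(4)[OF M p p x(1)] .
    have "eval p x \<in> ?E"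
      unfolding adjoin_algebraic(1)[OF M x] simple_extension_as_eval_img[OF subfieldE(3)[OF M] x(1)] using p by blast
    then have "inv (eval p x) \<in> ?E" using subfield_m_inv(1)[OF E] nz by blast
    then obtain q where q: "q \<in> carrier (M[X])" "inv (eval p x) = eval q x"
      unfolding adjoin_algebraic(1)[OF M x] simple_extension_as_eval_img[OF subfieldE(3)[OF M] x(1)] by blast
    have one: "[\<one>] \<in> carrier (M[X])"
      using subringE(3)[OF subfieldE(1)[OF M]] by (auto simp: univ_poly_carrier[symmetric] polynomial_def)
    obtain d where d: "d \<in> carrier (M[X])" "\<And>x. x \<in> carrier L \<Longrightarrow> eval d x = eval (p \<otimes>\<^bsub>M[X]\<^esub> q) x \<ominus> eval [\<one>] x"
      "\<And>x. x \<in> carrier L \<Longrightarrow> eval (map \<tau> d) x = eval (map \<tau> (p \<otimes>\<^bsub>M[X]\<^esub> q)) x \<ominus> eval (map \<tau> [\<one>]) x"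
      using poly_diff[OF emb MX_closed(1)[OF M p q(1)] one] by metis
    have "eval (p \<otimes>\<^bsub>M[X]\<^esub> q) x = \<one>" using MX_eval(1)[OF M p q(1) x(1)] q(2) inv_simps(2)[OF c nz] by simp
    then have "eval d x = \<zero>" using d(2)[OF x(1)] x by (simp add: r_right_minus_eq)
    then have "eval (map \<tau> d) y = \<zero>" using fwd[OF d(1)] by simp
    moreover have "eval (map \<tau> (p \<otimes>\<^bsub>M[X]\<^esub> q)) y = \<zero>"
      using embedding_poly(4)[OF emb p q(1)] eval_mult[OF embedding_poly(1)[OF emb p] embedding_poly(1)[OF emb q(1)] y(1)]
        e eval_closed[OF embedding_poly(1)[OF emb q(1)] y(1)] by simp
    ultimately show False using d(3)[OF y(1)] y(1) embedding_simps(4)[OF emb] by (simp add: minus_eq)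
  qed
  then show ?thesis using fwd[OF p] by blast
qed

end

section \<open>Separable elements\<close>

context field
begin

abbreviation nat_elt :: "nat \<Rightarrow> 'a" where "nat_elt k \<equiv> [k] \<cdot> \<one>"

lemma nat_elt_simps:
  "nat_elt k \<in> carrier R" "nat_elt 0 = \<zero>" "nat_elt 1 = \<one>" "nat_elt (Suc k) = nat_elt k \<oplus> \<one>"
  "nat_elt (k + m) = nat_elt k \<oplus> nat_elt m" "nat_elt (k * m) = nat_elt k \<otimes> nat_elt m"
proof -
  show c: "nat_elt k \<in> carrier R" for k by simp
  show s: "nat_elt (Suc k) = nat_elt k \<oplus> \<one>" for k by simp
  show "nat_elt 0 = \<zero>" "nat_elt 1 = \<one>" by simp_all
  show add: "nat_elt (k + m) = nat_elt k \<oplus> nat_elt m" for k m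
    by (simp add: add.nat_pow_mult)
  show "nat_elt (k * m) = nat_elt k \<otimes> nat_elt m"
  proof (induct k)
    case 0 then show ?case by simp
  next
    case (Suc k)
    then show ?case using add[of m "k * m"] s[of k] c by (simp add: l_distr a_comm del: add.nat_pow_Suc)
  qed
qed

lemma binomial_expansion:
  assumes x: "x \<in> carrier R" and y: "y \<in> carrier R"
  shows "(x \<oplus> y) [^] (n::nat) = (\<Oplus>k\<in>{..n}. nat_elt (n choose k) \<otimes> (x [^] k \<otimes> y [^] (n - k)))"
proof (induct n)
  case 0 then show ?case by simp
next
  case (Suc n)
  note c = nat_elt_simps(1)
  let ?t = "\<lambda>(n::nat) (k::nat). x [^] k \<otimes> y [^] (n - k)"
  have tc: "?t n k \<in> carrier R" for n k using x y by simp
  have "(x \<oplus> y) [^] Suc n = (\<Oplus>k\<in>{..n}. nat_elt (n choose k) \<otimes> ?t n k) \<otimes> x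
      \<oplus> (\<Oplus>k\<in>{..n}. nat_elt (n choose k) \<otimes> ?t n k) \<otimes> y"
    using Suc x y tc c by (simp add: r_distr finsum_closed)
  also have "(\<Oplus>k\<in>{..n}. nat_elt (n choose k) \<otimes> ?t n k) \<otimes> x = (\<Oplus>k\<in>{..n}. nat_elt (n choose k) \<otimes> ?t (Suc n) (Suc k))"
    using x y c by (subst finsum_ldistr) (auto intro!: finsum_cong' simp: m_assoc m_comm[of x] m_lcomm)
  also have "\<dots> = (\<Oplus>k\<in>{..Suc n}. nat_elt (case k of 0 \<Rightarrow> 0 | Suc k' \<Rightarrow> n choose k') \<otimes> ?t (Suc n) k)"
    using x y c by (subst finsum_Suc2) (auto simp del: finsum_Suc simp: Pi_def)
  also have "(\<Oplus>k\<in>{..n}. nat_elt (n choose k) \<otimes> ?t n k) \<otimes> y = (\<Oplus>k\<in>{..n}. nat_elt (n choose k) \<otimes> ?t (Suc n) k)"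
    using x y c by (subst finsum_ldistr) (auto intro!: finsum_cong' simp: m_assoc Suc_diff_le)
  also have "\<dots> = (\<Oplus>k\<in>{..Suc n}. nat_elt (n choose k) \<otimes> ?t (Suc n) k)"
    using x y c by (subst finsum_Suc) (auto simp: Pi_def binomial_eq_0)
  also have "(\<Oplus>k\<in>{..Suc n}. nat_elt (case k of 0 \<Rightarrow> 0 | Suc k' \<Rightarrow> n choose k') \<otimes> ?t (Suc n) k) \<oplus>
     (\<Oplus>k\<in>{..Suc n}. nat_elt (n choose k) \<otimes> ?t (Suc n) k)
     = (\<Oplus>k\<in>{..Suc n}. nat_elt (case k of 0 \<Rightarrow> 0 | Suc k' \<Rightarrow> n choose k') \<otimes> ?t (Suc n) k \<oplus> nat_elt (n choose k) \<otimes> ?t (Suc n) k)"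
    using tc c by (subst finsum_addf) auto
  also have "\<dots> = (\<Oplus>k\<in>{..Suc n}. nat_elt (Suc n choose k) \<otimes> ?t (Suc n) k)"
  proof (rule finsum_cong')
    fix k assume "k \<in> {..Suc n}"
    have "nat_elt (Suc n choose k) = nat_elt (case k of 0 \<Rightarrow> 0 | Suc k' \<Rightarrow> n choose k') \<oplus> nat_elt (n choose k)"
      by (cases k) (simp_all only: binomial_Suc_Suc nat_elt_simps(5) nat.case binomial_n_0 nat_elt_simps(2) l_zero[OF c])
    then show "nat_elt (case k of 0 \<Rightarrow> 0 | Suc k' \<Rightarrow> n choose k') \<otimes> ?t (Suc n) k \<oplus> nat_elt (n choose k) \<otimes> ?t (Suc n) k
        = nat_elt (Suc n choose k) \<otimes> ?t (Suc n) k"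
      using tc c l_distr by metis
  qed (use tc c in auto)
  finally show ?case .
qed

lemma frobenius_add:
  assumes p: "Factorial_Ring.prime p" "nat_elt p = \<zero>" and x: "x \<in> carrier R" and y: "y \<in> carrier R"
  shows "(x \<oplus> y) [^] p = x [^] p \<oplus> y [^] p"
proof -
  have p1: "p > 1" using p(1) prime_gt_1_nat by blast
  have z: "nat_elt (p choose k) = \<zero>" if "0 < k" "k < p" for k
  proof -
    have "p dvd (p choose k)" using that p(1) by (intro dvd_choose_prime) auto
    then obtain m where "p choose k = p * m" by blast
    then show ?thesis using nat_elt_simps(1)[of m] nat_elt_simps(6)[of p m] p(2) by simp
  qed
  have "(x \<oplus> y) [^] p = (\<Oplus>k\<in>{..p}. nat_elt (p choose k) \<otimes> (x [^] k \<otimes> y [^] (p - k)))"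
    using binomial_expansion[OF x y] .
  also have "\<dots> = (\<Oplus>k\<in>{0,p}. nat_elt (p choose k) \<otimes> (x [^] k \<otimes> y [^] (p - k)))"
    using z x y by (intro add.finprod_mono_neutral_cong_right) auto
  also have "\<dots> = x [^] p \<oplus> y [^] p" using x y p1 by (simp add: a_comm)
  finally show ?thesis .
qed

lemma frobenius_embedding:
  assumes p: "Factorial_Ring.prime p" "nat_elt p = \<zero>" and M: "subfield M R"
  shows "embedding M (\<lambda>x. x [^] p)"
proof (rule embeddingI[OF M])
  have MR: "M \<subseteq> carrier R" using subfieldE(3)[OF M] .
  show "x [^] p \<in> carrier R" if "x \<in> M" for x using that MR by auto
  show "\<one> [^] p = \<one>" by simp
  show "(x \<oplus> y) [^] p = x [^] p \<oplus> y [^] p" if "x \<in> M" "y \<in> M" for x y using frobenius_add[OF p] that MR by auto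
  show "(x \<otimes> y) [^] p = x [^] p \<otimes> y [^] p" if "x \<in> M" "y \<in> M" for x y using nat_pow_distrib that MR by auto
qed

lemma frobenius_inj:
  assumes p: "Factorial_Ring.prime p" "nat_elt p = \<zero>" and "x \<in> carrier R" "y \<in> carrier R" "x [^] p = y [^] p"
  shows "x = y"
  using embedding_simps(11)[OF frobenius_embedding[OF p carrier_is_subfield]] assms(3-5) by blast

lemma characteristic_prime:
  assumes "nat_elt n = \<zero>" "n > 0"
  obtains p where "Factorial_Ring.prime p" "nat_elt p = \<zero>" "\<And>k. nat_elt k = \<zero> \<Longrightarrow> p dvd k"
proof -
  define p where "p = (LEAST n. n > 0 \<and> nat_elt n = \<zero>)"
  have p: "p > 0" "nat_elt p = \<zero>" using LeastI[of "\<lambda>n. n > 0 \<and> nat_elt n = \<zero>" n] assms unfolding p_def by auto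
  have least: "p \<le> m" if "m > 0" "nat_elt m = \<zero>" for m unfolding p_def using that by (intro Least_le) auto
  have dv: "p dvd k" if k: "nat_elt k = \<zero>" for k
  proof -
    have "nat_elt k = nat_elt (k div p * p) \<oplus> nat_elt (k mod p)"
      unfolding nat_elt_simps(5)[symmetric] by simp
    moreover have "nat_elt (k div p * p) = \<zero>" using nat_elt_simps(6)[of "k div p" p] p(2) nat_elt_simps(1) by simp
    ultimately have "nat_elt (k mod p) = \<zero>" using k nat_elt_simps(1)[of "k mod p"] by simp
    then have "k mod p = 0" using least[of "k mod p"] p(1) by (meson mod_less_divisor not_less zero_less_iff_neq_zero)
    then show ?thesis by auto
  qed
  have "p \<noteq> 1" using p(2) by auto
  have "Factorial_Ring.prime p"
  proof (rule prime_natI)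
    show "2 \<le> p" using p(1) \<open>p \<noteq> 1\<close> by simp
    fix n m assume d: "p dvd n * m"
    then have "nat_elt (n * m) = \<zero>" using nat_elt_simps(1,6) p(2) by (metis dvdE l_null)
    then have "nat_elt n = \<zero> \<or> nat_elt m = \<zero>" using nat_elt_simps(1,6) integral by metis
    then show "p dvd n \<or> p dvd m" using dv by blast
  qed
  then show thesis using that p(2) dv by blast
qed

end

context algebraically_closed
begin

abbreviation alg_cl :: "'a set \<Rightarrow> 'a set" where "alg_cl F \<equiv> rel_alg_closure L F"
abbreviation sep_cl :: "'a set \<Rightarrow> 'a set" where "sep_cl F \<equiv> rel_sep_closure L F"

lemma alg_cl_iff: "x \<in> alg_cl F \<longleftrightarrow> x \<in> carrier L \<and> algebraic F x"
  by (simp add: rel_alg_closure_def)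

lemma alg_cl_subfield:
  assumes "subfield F L" shows "subfield (alg_cl F) L" "F \<subseteq> alg_cl F"
  using subfield_of_algebraics[OF assms] algebraic_self[OF subfieldE(1)[OF assms]] subfieldE(3)[OF assms]
  by (auto simp: rel_alg_closure_def over_def)

lemma alg_mono: "F \<subseteq> F' \<Longrightarrow> algebraic F x \<Longrightarrow> algebraic F' x"
  using algebraic_mono[of F F' x] by (auto simp: over_def)

lemma alg_cl_mono: "F \<subseteq> F' \<Longrightarrow> alg_cl F \<subseteq> alg_cl F'"
  using alg_mono by (auto simp: alg_cl_iff)

text \<open>The coefficients of \<open>p\<close> generate a finite extension of \<open>F\<close>, over which \<open>x\<close> is algebraic.\<close>

lemma alg_cl_root:
  assumes F: "subfield F L" and p: "p \<in> carrier ((alg_cl F)[X])" "p \<noteq> []" and x: "x \<in> carrier L" "eval p x = \<zero>"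
  shows "x \<in> alg_cl F"
proof -
  let ?E = "finite_extension F p"
  have sp: "set p \<subseteq> alg_cl F" using subfield_polyE(1)[OF alg_cl_subfield(1)[OF F] p(1)] .
  then have spL: "set p \<subseteq> carrier L" and ap: "\<And>c. c \<in> set p \<Longrightarrow> (algebraic over F) c"
    by (auto simp: alg_cl_iff over_def)
  have E: "subfield ?E L" using finite_extension_is_subfield[OF F spL ap] .
  have fd: "finite_dimension F ?E" using finite_extension_finite_dimension(1)[OF F spL ap] .
  have "set p \<subseteq> ?E" using finite_extension_mem[OF subfieldE(1)[OF F] spL] .
  then have "p \<in> carrier (?E[X])" using p(1) by (auto simp: univ_poly_carrier[symmetric] polynomial_def)
  then have aE: "algebraic ?E x" using degree_Irr_le(1)[OF E x(1) _ p(2) x(2)] by simp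
  note S = adjoin_algebraic[OF E x(1) aE]
  have S': "subfield (adjoin L ?E {x}) L" using adjoin_simps(1)[of ?E "{x}"] subfieldE(3)[OF E] x by simp
  have "finite_dimension F (adjoin L ?E {x})"
    using telescopic_base_dim(1)[OF F E fd finite_dimensionI[OF S(3)]] .
  moreover have "x \<in> adjoin L ?E {x}" using adjoin_simps(3)[of ?E "{x}"] subfieldE(3)[OF E] x by simp
  ultimately have "(algebraic over F) x" using finite_dimension_imp_algebraic[OF F subfieldE(1)[OF S']] by blast
  then show ?thesis using x by (simp add: alg_cl_iff over_def)
qed

lemma adjoin_alg_cl:
  assumes "subfield F L" "S \<subseteq> alg_cl F" shows "adjoin L F S \<subseteq> alg_cl F"
proof -
  have "S \<subseteq> carrier L" using assms(2) by (auto simp: alg_cl_iff)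
  then show ?thesis
    using adjoin_simps(4)[of F S "alg_cl F"] alg_cl_subfield[OF assms(1)] assms subfieldE(3)[OF assms(1)] by blast
qed

text \<open>The formal derivative of \<open>(t - r) S\<close> takes the value \<open>S(r)\<close> at \<open>r\<close>; so it vanishes at a multiple
  root. A multiple root of a minimal polynomial makes the derivative, which has smaller degree, the
  zero polynomial, and then only exponents divisible by the characteristic occur.\<close>

lemma derivative_at_root:
  assumes r: "r \<in> carrier L" and q: "\<And>k. q k \<in> carrier L"
  shows "(\<Oplus>k\<in>{..<m}. nat_elt (Suc k) \<otimes> (q k \<ominus> r \<otimes> q (Suc k)) \<otimes> r [^] k)
    = (\<Oplus>k\<in>{..<m}. q k \<otimes> r [^] k) \<ominus> nat_elt m \<otimes> q m \<otimes> r [^] m"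
proof (induct m)
  case 0 then show ?case using r q by (simp add: minus_eq)
next
  case (Suc m)
  note c = nat_elt_simps(1)
  let ?S = "\<Oplus>k\<in>{..<m}. q k \<otimes> r [^] k"
  have S: "?S \<in> carrier L" using r q by (simp add: finsum_closed Pi_def)
  have ident: "(s \<ominus> n \<otimes> a \<otimes> w) \<oplus> (n \<oplus> \<one>) \<otimes> (a \<ominus> r \<otimes> b) \<otimes> w = (a \<otimes> w \<oplus> s) \<ominus> (n \<oplus> \<one>) \<otimes> b \<otimes> (w \<otimes> r)"
    if "s \<in> carrier L" "n \<in> carrier L" "a \<in> carrier L" "b \<in> carrier L" "w \<in> carrier L" for s n a b w
    using that r by algebra
  have "(\<Oplus>k\<in>{..<Suc m}. nat_elt (Suc k) \<otimes> (q k \<ominus> r \<otimes> q (Suc k)) \<otimes> r [^] k)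
    = (\<Oplus>k\<in>{..<m}. nat_elt (Suc k) \<otimes> (q k \<ominus> r \<otimes> q (Suc k)) \<otimes> r [^] k) \<oplus> nat_elt (Suc m) \<otimes> (q m \<ominus> r \<otimes> q (Suc m)) \<otimes> r [^] m"
    using r q c unfolding lessThan_Suc
    by (subst finsum_insert) (auto simp: a_comm finsum_closed Pi_def simp del: add.nat_pow_Suc)
  also have "\<dots> = (?S \<ominus> nat_elt m \<otimes> q m \<otimes> r [^] m) \<oplus> (nat_elt m \<oplus> \<one>) \<otimes> (q m \<ominus> r \<otimes> q (Suc m)) \<otimes> r [^] m"
    using Suc by simp
  also have "\<dots> = (q m \<otimes> r [^] m \<oplus> ?S) \<ominus> (nat_elt m \<oplus> \<one>) \<otimes> q (Suc m) \<otimes> (r [^] m \<otimes> r)"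
    using ident[OF S c q q] r by simp
  also have "q m \<otimes> r [^] m \<oplus> ?S = (\<Oplus>k\<in>{..<Suc m}. q k \<otimes> r [^] k)"
    using r q unfolding lessThan_Suc by (subst finsum_insert) auto
  finally show ?case by simp
qed

lemma inseparable_degree_drop:
  assumes F: "subfield F L" and x: "x \<in> carrier L" "algebraic F x" and r: "r \<in> carrier L"
    and mult: "alg_mult (Irr F x) r \<ge> 2"
  obtains p where "Factorial_Ring.prime p" "nat_elt p = \<zero>" "degree (Irr F (x [^] p)) < degree (Irr F x)"
proof -
  let ?P = "Irr F x"
  define n where "n = degree ?P"
  note I = Irr_props[OF F x]
  note lp = linear_poly[OF r]
  interpret PX: domain "poly_ring L" using univ_poly_is_domain[OF carrier_is_subring] .
  have n1: "n \<ge> 1" using I(5) n_def by simp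
  have "([\<one>, \<ominus> r] [^]\<^bsub>poly_ring L\<^esub> (2::nat)) pdivides ?P"
    using le_alg_mult_imp_pdivides[OF r I(2) mult] .
  then obtain S where S: "S \<in> carrier (poly_ring L)" "?P = ([\<one>, \<ominus> r] \<otimes>\<^bsub>poly_ring L\<^esub> [\<one>, \<ominus> r]) \<otimes>\<^bsub>poly_ring L\<^esub> S"
    using lp unfolding pdivides_def factor_def by (auto simp: numeral_2_eq_2)
  define Q where "Q = [\<one>, \<ominus> r] \<otimes>\<^bsub>poly_ring L\<^esub> S"
  have Q: "Q \<in> carrier (poly_ring L)" "?P = [\<one>, \<ominus> r] \<otimes>\<^bsub>poly_ring L\<^esub> Q"
    unfolding Q_def using S lp PX.m_assoc by auto
  have rr: "r \<ominus> r = \<zero>" using r by (simp add: r_right_minus_eq)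
  have Qr: "eval Q r = \<zero>" unfolding Q_def using eval_mult[OF lp S(1) r] eval_linear[OF r r] eval_closed[OF S(1) r] rr by simp
  have Pr: "eval ?P r = \<zero>" using Q eval_mult[OF lp Q(1) r] Qr eval_linear[OF r r] rr by simp
  have Qn: "Q \<noteq> []" using Q(2) I(3) PX.r_null[OF lp] by (auto simp: univ_poly_zero)
  have "degree ?P = 1 + degree Q"
    using poly_mult_degree_eq[OF carrier_is_subring, of "[\<one>, \<ominus> r]" Q] Q Qn lp
    by (simp add: univ_poly_mult univ_poly_carrier)
  then have lQ: "length Q = n" using Qn n_def by (cases Q) auto
  have lP: "length ?P = Suc n" using n_def I(3) by (cases ?P) auto
  note cQ = coeff_closed[OF Q(1)] and cP = coeff_closed[OF I(2)]
  have pk: "coeff ?P (Suc k) = coeff Q k \<ominus> r \<otimes> coeff Q (Suc k)" for k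
    using coeff_linear_mult[OF r Q(1), of "Suc k"] Q(2) by simp
  have "(\<Oplus>k\<in>{..<n}. nat_elt (Suc k) \<otimes> coeff ?P (Suc k) \<otimes> r [^] k) = eval Q r \<ominus> nat_elt n \<otimes> coeff Q n \<otimes> r [^] n"
    using derivative_at_root[of r "coeff Q" n, OF r cQ] eval_as_sum[OF subfield_polyE(2)[OF carrier_is_subfield Q(1)] r eq_imp_le[OF lQ]]
    by (simp only: pk)
  also have "\<dots> = \<zero>" using Qr coeff_length[of Q n] lQ r nat_elt_simps(1)[of n] by (simp add: minus_eq)
  finally have der: "(\<Oplus>k\<in>{..n - 1}. nat_elt (Suc k) \<otimes> coeff ?P (Suc k) \<otimes> r [^] k) = \<zero>"
    using n1 by (simp add: lessThan_Suc_atMost[symmetric] del: add.nat_pow_Suc)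
  have Fel: "nat_elt k \<in> F" for k
  proof (induct k)
    case (Suc k) then show ?case using subringE(3,7)[OF subfieldE(1)[OF F]] by simp
  qed (use subringE(2)[OF subfieldE(1)[OF F]] in simp)
  have dr: "degree (Irr F r) = n" using Irr_eq_of_root(2)[OF F x r Pr] n_def by simp
  have c0: "nat_elt (Suc k) \<otimes> coeff ?P (Suc k) = \<zero>" if "k \<le> n - 1" for k
  proof (rule ccontr)
    assume nz: "nat_elt (Suc k) \<otimes> coeff ?P (Suc k) \<noteq> \<zero>"
    have "nat_elt (Suc k) \<otimes> coeff ?P (Suc k) \<in> F" for k
      by (rule subringE(6)[OF subfieldE(1)[OF F] Fel coeff_subfield[OF F I(1)]])
    then have "degree (Irr F r) \<le> n - 1"
      using degree_Irr_le_relation(2)[OF F r, of "n - 1" "\<lambda>k. nat_elt (Suc k) \<otimes> coeff ?P (Suc k)"] der that nz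
      by blast
    then show False using dr n1 by simp
  qed
  have ln: "coeff ?P n = \<one>" using I(3,7) lead_coeff_simp[OF I(3)] n_def by simp
  have "nat_elt n = \<zero>" using c0[of "n - 1"] n1 ln nat_elt_simps(1)[of n] by simp
  then obtain p where p: "Factorial_Ring.prime p" "nat_elt p = \<zero>" "\<And>k. nat_elt k = \<zero> \<Longrightarrow> p dvd k"
    using characteristic_prime n1 by (metis less_le_trans zero_less_one)
  have dv: "p dvd k" if "k \<le> n" "coeff ?P k \<noteq> \<zero>" for k
  proof (cases k)
    case (Suc k')
    then have "nat_elt k \<otimes> coeff ?P k = \<zero>" using c0[of k'] that(1) by simp
    then show ?thesis using p(3) that(2) integral nat_elt_simps(1) cP by metis
  qed simp
  have p1: "p > 1" using p(1) prime_gt_1_nat by blast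
  obtain m where m: "n = p * m" using dv[of n] ln by auto
  have "eval ?P x = (\<Oplus>k\<in>{..n}. coeff ?P k \<otimes> x [^] k)"
    using eval_as_sum[OF subfield_polyE(2)[OF carrier_is_subfield I(2)] x(1), of "Suc n"] lP by (simp add: lessThan_Suc_atMost)
  also have "\<dots> = (\<Oplus>k\<in>(\<lambda>i. p * i) ` {..m}. coeff ?P k \<otimes> x [^] k)"
  proof (rule add.finprod_mono_neutral_cong_right)
    show "(\<lambda>i. p * i) ` {..m} \<subseteq> {..n}" using m by auto
    show "\<And>k. k \<in> {..n} - (\<lambda>i. p * i) ` {..m} \<Longrightarrow> coeff ?P k \<otimes> x [^] k = \<zero>"
    proof -
      fix k assume k: "k \<in> {..n} - (\<lambda>i. p * i) ` {..m}"
      have "coeff ?P k = \<zero>"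
      proof (rule ccontr)
        assume "coeff ?P k \<noteq> \<zero>"
        then have "p dvd k" using dv[of k] k by simp
        then obtain i where "k = p * i" by blast
        then show False using k m p1 by auto
      qed
      then show "coeff ?P k \<otimes> x [^] k = \<zero>" using x by simp
    qed
  qed (use cP x in auto)
  also have "\<dots> = (\<Oplus>i\<in>{..m}. coeff ?P (p * i) \<otimes> x [^] (p * i))"
    using p1 cP x by (subst finsum_reindex) (auto simp: inj_on_def)
  also have "\<dots> = (\<Oplus>i\<in>{..m}. coeff ?P (p * i) \<otimes> (x [^] p) [^] i)"
    using x cP by (intro finsum_cong') (auto simp: nat_pow_pow)
  finally have e: "(\<Oplus>i\<in>{..m}. coeff ?P (p * i) \<otimes> (x [^] p) [^] i) = \<zero>" using I(4) by simp
  have "degree (Irr F (x [^] p)) \<le> m"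
  proof (rule degree_Irr_le_relation(2)[OF F _ coeff_subfield[OF F I(1)] e])
    show "\<exists>i\<le>m. coeff ?P (p * i) \<noteq> \<zero>" using ln m by auto
  qed (use x in simp)
  moreover have "1 * m < p * m" using m p1 n1 by (intro mult_strict_right_mono) auto
  then have "m < n" using m by simp
  ultimately have "degree (Irr F (x [^] p)) < degree ?P" using n_def by simp
  then show thesis using that p by blast
qed

lemma Irr_dvd_mono:
  assumes F: "subfield F L" and M: "subfield M L" and FM: "F \<subseteq> M" and x: "x \<in> carrier L" "algebraic F x"
  shows "algebraic M x" "Irr M x pdivides Irr F x" "alg_mult (Irr M x) r \<le> alg_mult (Irr F x) r"
    "degree (Irr M x) \<le> degree (Irr F x)" "roots (Irr M x) \<subseteq># roots (Irr F x)"
proof -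
  show a: "algebraic M x" using alg_mono[OF FM x(2)] .
  note I = Irr_props[OF F x] and J = Irr_props[OF M x(1) a]
  have FX: "Irr F x \<in> carrier (M[X])" using I(1) FM by (auto simp: univ_poly_carrier[symmetric] polynomial_def)
  have "Irr M x pdivides Irr F x" using Irr_minimal[OF M x(1) _ FX I(4)] a by (simp add: over_def)
  then show d: "Irr M x pdivides Irr F x" .
  show s: "roots (Irr M x) \<subseteq># roots (Irr F x)" using pdivides_imp_roots_incl[OF J(2) I(2,3) d] .
  show "alg_mult (Irr M x) r \<le> alg_mult (Irr F x) r"
    unfolding alg_mult_eq_count_roots[OF J(2)] alg_mult_eq_count_roots[OF I(2)] using mset_subset_eq_count[OF s] .
  show "degree (Irr M x) \<le> degree (Irr F x)" using degree_Irr_le(2)[OF M x(1) FX I(3,4)] .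
qed

lemma single_root_imp_mem:
  assumes M: "subfield M L" and x: "x \<in> carrier L" "algebraic M x"
    and root: "\<And>r. r \<in> carrier L \<Longrightarrow> eval (Irr M x) r = \<zero> \<Longrightarrow> r = x" and mult: "alg_mult (Irr M x) x \<le> 1"
  shows "x \<in> M"
proof -
  note I = Irr_props[OF M x]
  have "roots (Irr M x) \<subseteq># {#x#}"
  proof (rule mset_subset_eqI)
    fix r
    show "count (roots (Irr M x)) r \<le> count {#x#} r"
    proof (cases "r = x")
      case True then show ?thesis using mult alg_mult_eq_count_roots[OF I(2)] by simp
    next
      case False
      then have "r \<notin># roots (Irr M x)" using root roots_mem_iff_is_root[OF I(2)] unfolding is_root_def by blast
      then show ?thesis by (simp add: not_in_iff)
    qed
  qed
  then have "size (roots (Irr M x)) \<le> 1" using size_mset_mono by fastforce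
  then have "degree (Irr M x) = 1" using roots_over_carrier[OF I(2)] I(5) unfolding splitted_def by simp
  then obtain b where b: "Irr M x = [\<one>, b]" using I(7)
    by (metis (no_types, lifting) One_nat_def degree_oneE[OF I(1)] list.sel(1))
  have bM: "b \<in> M" using subfield_polyE(1)[OF M I(1)] b by simp
  have "x \<oplus> b = \<zero>" using I(4) b x bM subfieldE(3)[OF M] by (auto simp: subset_iff)
  then have "x = \<ominus> b" using x bM subfieldE(3)[OF M] by (metis minus_equality subsetD)
  then show ?thesis using subringE(5)[OF subfieldE(1)[OF M] bM] by simp
qed

lemma power_poly:
  assumes M: "subfield M L" and c: "c \<in> M"
  obtains q where "q \<in> carrier (M[X])" "q \<noteq> [] \<or> k = 0" "\<And>r. r \<in> carrier L \<Longrightarrow> eval q r = r [^] (k::nat) \<ominus> c"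
proof (cases "k = 0")
  case True
  then show thesis using that poly_const[OF M, of "\<one> \<ominus> c"] c subringE(3,5,7)[OF subfieldE(1)[OF M]]
    by (metis minus_eq nat_pow_0)
next
  case k: False
  let ?c = "\<lambda>i. if i = k then \<one> else if i = 0 then \<ominus> c else \<zero>"
  have cM: "?c i \<in> M" for i using c subringE(2,3,5)[OF subfieldE(1)[OF M]] by auto
  obtain q where q: "q \<in> carrier (M[X])" "length q \<le> Suc k" "\<And>i. coeff q i = (if i < Suc k then ?c i else \<zero>)"
    "\<And>x. x \<in> carrier L \<Longrightarrow> eval q x = (\<Oplus>i\<in>{..<Suc k}. ?c i \<otimes> x [^] i)"
    using poly_from_coeffs[OF M, of "Suc k" ?c] cM by blast
  have cL: "?c i \<in> carrier L" for i using cM subfieldE(3)[OF M] by blast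
  have ccL: "c \<in> carrier L" using c subfieldE(3)[OF M] by blast
  have "coeff q k = \<one>" using q(3) by simp
  then have "q \<noteq> []" by auto
  moreover have "eval q r = r [^] k \<ominus> c" if r: "r \<in> carrier L" for r
  proof -
    have "eval q r = (\<Oplus>i\<in>{0,k}. ?c i \<otimes> r [^] i)" unfolding q(4)[OF r]
      using r cL ccL by (intro add.finprod_mono_neutral_cong_right) auto
    also have "\<dots> = r [^] k \<ominus> c" using k r ccL by (simp add: minus_eq a_comm)
    finally show ?thesis .
  qed
  ultimately show thesis using that q(1) by blast
qed

text \<open>In prime characteristic \<open>p\<close> an element \<open>x\<close> is separable over \<open>F\<close> if and only if
  \<open>F(x) = F(x\<^sup>p)\<close>; in characteristic zero the condition is void. This form of separability needs no
  counting of embeddings.\<close>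

lemma sep_cl_iff:
  assumes F: "subfield F L"
  shows "x \<in> sep_cl F \<longleftrightarrow> x \<in> alg_cl F \<and> (\<forall>p. Factorial_Ring.prime p \<and> nat_elt p = \<zero> \<longrightarrow> x \<in> adjoin L F {x [^] p})"
proof
  assume s: "x \<in> sep_cl F"
  then have a: "x \<in> alg_cl F" "x \<in> carrier L" "algebraic F x" and m: "\<And>r. r \<in> carrier L \<Longrightarrow> alg_mult (Irr F x) r \<le> 1"
    by (auto simp: rel_sep_closure_def alg_cl_iff)
  have "x \<in> adjoin L F {x [^] p}" if p: "Factorial_Ring.prime p" "nat_elt p = \<zero>" for p
  proof -
    let ?M = "adjoin L F {x [^] p}"
    have M: "subfield ?M L" "F \<subseteq> ?M" "x [^] p \<in> ?M"
      using adjoin_simps[of F "{x [^] p}"] subfieldE(3)[OF F] a by auto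
    note D = Irr_dvd_mono[OF F M(1,2) a(2,3)]
    note J = Irr_props[OF M(1) a(2) D(1)]
    show "x \<in> ?M"
    proof (rule single_root_imp_mem[OF M(1) a(2) D(1)])
      show "alg_mult (Irr ?M x) x \<le> 1" using D(3)[of x] m[OF a(2)] by simp
      fix r assume r: "r \<in> carrier L" "eval (Irr ?M x) r = \<zero>"
      obtain q where q: "q \<in> carrier (?M[X])" "\<And>r. r \<in> carrier L \<Longrightarrow> eval q r = r [^] p \<ominus> x [^] p"
        using power_poly[OF M(1,3)] by metis
      have "eval q x = \<zero>" using q(2)[OF a(2)] a(2) by (simp add: r_right_minus_eq)
      then obtain w where w: "w \<in> carrier (?M[X])" "q = Irr ?M x \<otimes>\<^bsub>?M[X]\<^esub> w" using J(8)[OF q(1)] by blast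
      have "eval q r = \<zero>" unfolding w(2) using MX_eval(1)[OF M(1) J(1) w(1) r(1)] r(2) MX_eval(4)[OF M(1) w(1) w(1) r(1)] by simp
      then have "r [^] p = x [^] p" using q(2)[OF r(1)] r(1) a(2) by (simp add: r_right_minus_eq)
      then show "r = x" using frobenius_inj[OF p r(1) a(2)] by simp
    qed
  qed
  then show "x \<in> alg_cl F \<and> (\<forall>p. Factorial_Ring.prime p \<and> nat_elt p = \<zero> \<longrightarrow> x \<in> adjoin L F {x [^] p})" using a by blast
next
  assume h: "x \<in> alg_cl F \<and> (\<forall>p. Factorial_Ring.prime p \<and> nat_elt p = \<zero> \<longrightarrow> x \<in> adjoin L F {x [^] p})"
  then have a: "x \<in> carrier L" "algebraic F x" by (auto simp: alg_cl_iff)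
  have "alg_mult (Irr F x) r \<le> 1" if r: "r \<in> carrier L" for r
  proof (rule ccontr)
    assume "\<not> alg_mult (Irr F x) r \<le> 1"
    then have "alg_mult (Irr F x) r \<ge> 2" by simp
    then obtain p where p: "Factorial_Ring.prime p" "nat_elt p = \<zero>" "degree (Irr F (x [^] p)) < degree (Irr F x)"
      using inseparable_degree_drop[OF F a r] by blast
    have xp: "x [^] p \<in> carrier L" "algebraic F (x [^] p)"
    proof -
      have "x [^] k \<in> alg_cl F" for k::nat
        using subringE(3,6)[OF subfieldE(1)[OF alg_cl_subfield(1)[OF F]]] h by (induct k) auto
      then show "x [^] p \<in> carrier L" "algebraic F (x [^] p)" by (auto simp: alg_cl_iff)
    qed
    have "x \<in> adjoin L F {x [^] p}" using h p by blast
    then have "adjoin L F {x} \<subseteq> adjoin L F {x [^] p}"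
      using adjoin_simps[of F "{x [^] p}"] adjoin_simps(4)[of F "{x}" "adjoin L F {x [^] p}"] subfieldE(3)[OF F] a xp by simp
    moreover have "adjoin L F {x [^] p} \<subseteq> adjoin L F {x}"
    proof -
      have S: "subfield (adjoin L F {x}) L" "F \<subseteq> adjoin L F {x}" "x \<in> adjoin L F {x}"
        using adjoin_simps[of F "{x}"] subfieldE(3)[OF F] a by auto
      have "x [^] k \<in> adjoin L F {x}" for k::nat
        using subringE(3,6)[OF subfieldE(1)[OF S(1)]] S(3) by (induct k) auto
      then show ?thesis using adjoin_simps(4)[of F "{x [^] p}" "adjoin L F {x}"] S xp subfieldE(3)[OF F] by simp
    qed
    ultimately show False using adjoin_algebraic(4)[OF F a] adjoin_algebraic(4)[OF F xp] p(3) by simp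
  qed
  then show "x \<in> sep_cl F" using h by (simp add: rel_sep_closure_def)
qed

lemma adjoin_mono:
  assumes "F \<subseteq> M" "M \<subseteq> carrier L" "S \<subseteq> carrier L" shows "adjoin L F S \<subseteq> adjoin L M S"
  using mono_generate_field[of "F \<union> S" "M \<union> S"] assms by blast

text \<open>If \<open>x\<close> generates the same field as \<open>x\<^sup>p\<close>, the powers of \<open>x\<^sup>p\<close> are as independent as those of
  \<open>x\<close>. Taking the \<open>p\<close>-th power of \<open>z = \<Sum> m\<^sub>i x\<^sup>i\<close> then shows that \<open>z\<^sup>p \<in> M\<close> forces \<open>z \<in> M\<close>.\<close>

lemma separable_p_root:
  assumes p: "Factorial_Ring.prime p" "nat_elt p = \<zero>" and M: "subfield M L" and x: "x \<in> carrier L" "algebraic M x"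
    and sep: "x \<in> adjoin L M {x [^] p}" and z: "z \<in> adjoin L M {x}" "z [^] p \<in> M"
  shows "z \<in> M"
proof -
  have MsL: "M \<subseteq> carrier L" using subfieldE(3)[OF M] .
  define n where "n = degree (Irr M x)"
  have S: "subfield (adjoin L M {x}) L" "M \<subseteq> adjoin L M {x}" "x \<in> adjoin L M {x}"
    using adjoin_simps[of M "{x}"] MsL x by auto
  have "x [^] k \<in> adjoin L M {x}" for k::nat
    using subringE(3,6)[OF subfieldE(1)[OF S(1)]] S(3) by (induct k) auto
  then have xp: "x [^] p \<in> carrier L" "x [^] p \<in> adjoin L M {x}" "algebraic M (x [^] p)"
    using adjoin_algebraic(5)[OF M x] x by auto
  have "adjoin L M {x} = adjoin L M {x [^] p}"
    using adjoin_simps[of M "{x [^] p}"] adjoin_simps(4)[of M "{x}" "adjoin L M {x [^] p}"]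
      adjoin_simps(4)[of M "{x [^] p}" "adjoin L M {x}"] S MsL x xp sep by auto
  then have deg: "degree (Irr M (x [^] p)) = n"
    using adjoin_algebraic(4)[OF M x] adjoin_algebraic(4)[OF M xp(1,3)] n_def by simp
  have n1: "n \<ge> 1" using Irr_props(5)[OF M x] n_def by simp
  obtain g where g: "g \<in> carrier (M[X])" "length g \<le> n" "z = eval g x"
    using z(1) unfolding adjoin_algebraic(2)[OF M x] n_def by blast
  have gL: "g \<in> carrier (poly_ring L)" using subfield_polyE(3)[OF M g(1)] .
  note fr = frobenius_embedding[OF p carrier_is_subfield]
  let ?g = "map (\<lambda>x. x [^] p) g"
  have gp: "?g \<in> carrier (poly_ring L)" using embedding_poly(1)[OF fr gL] .
  have cg: "coeff g i \<in> M" for i using coeff_subfield[OF M g(1)] .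
  have cgL: "coeff g i \<in> carrier L" for i using cg MsL by blast
  have cgp: "coeff ?g i = coeff g i [^] p" for i using embedding_poly(3)[OF fr gL] .
  have powM: "c [^] k \<in> M" if "c \<in> M" for c and k::nat
    using subringE(3,6)[OF subfieldE(1)[OF M]] that by (induct k) auto
  have zL: "z \<in> carrier L" using z(1) subfieldE(3)[OF S(1)] by blast
  have "z [^] p = eval ?g (x [^] p)" unfolding g(3) using embedding_poly(2)[OF fr gL, of x] x by simp
  also have "\<dots> = (\<Oplus>i\<in>{..<n}. coeff g i [^] p \<otimes> (x [^] p) [^] i)"
    using eval_as_sum[OF subfield_polyE(2)[OF carrier_is_subfield gp] xp(1), of n] g(2) cgp by simp
  finally have zp: "z [^] p = (\<Oplus>i\<in>{..<n}. coeff g i [^] p \<otimes> (x [^] p) [^] i)" .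
  obtain n' where n': "n = Suc n'" using n1 by (cases n) auto
  let ?c = "\<lambda>i. if i = 0 then coeff g 0 [^] p \<ominus> z [^] p else coeff g i [^] p"
  have split: "(\<Oplus>i\<in>{..n'}. f i) = f 0 \<oplus> (\<Oplus>i\<in>{1..n'}. f i)" if "f \<in> UNIV \<rightarrow> carrier L" for f :: "nat \<Rightarrow> 'a"
  proof -
    have "{..n'} = insert 0 {1..n'}" by auto
    then show ?thesis using that by (simp add: Pi_def)
  qed
  have "(\<Oplus>i\<in>{..n'}. ?c i \<otimes> (x [^] p) [^] i) = (coeff g 0 [^] p \<ominus> z [^] p) \<oplus> (\<Oplus>i\<in>{1..n'}. ?c i \<otimes> (x [^] p) [^] i)"
    using cgL zL xp(1) by (subst split) auto
  also have "(\<Oplus>i\<in>{1..n'}. ?c i \<otimes> (x [^] p) [^] i) = (\<Oplus>i\<in>{1..n'}. coeff g i [^] p \<otimes> (x [^] p) [^] i)"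
    using cgL xp(1) by (intro finsum_cong') auto
  also have "(coeff g 0 [^] p \<ominus> z [^] p) \<oplus> \<dots> = \<zero>"
  proof -
    let ?S = "\<Oplus>i\<in>{1..n'}. coeff g i [^] p \<otimes> (x [^] p) [^] i"
    have Sc: "?S \<in> carrier L" using cgL xp(1) by (intro finsum_closed) auto
    have "z [^] p = coeff g 0 [^] p \<oplus> ?S"
      unfolding zp n' lessThan_Suc_atMost using cgL xp(1) by (subst split) auto
    moreover have "(c \<ominus> (c \<oplus> s)) \<oplus> s = \<zero>" if "c \<in> carrier L" "s \<in> carrier L" for c s using that by algebra
    ultimately show ?thesis using Sc cgL by simp
  qed
  finally have rel: "(\<Oplus>i\<in>{..n'}. ?c i \<otimes> (x [^] p) [^] i) = \<zero>" .
  have cM: "?c i \<in> M" for i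
    using powM[OF cg] z(2) subringE(5,7)[OF subfieldE(1)[OF M]] by (auto simp: minus_eq)
  have "?c i = \<zero>" if "i \<le> n'" for i
  proof (rule ccontr)
    assume "?c i \<noteq> \<zero>"
    then have "degree (Irr M (x [^] p)) \<le> n'"
      using degree_Irr_le_relation(2)[OF M xp(1) cM rel] that by blast
    then show False using deg n' by simp
  qed
  then have c0: "coeff g i = \<zero>" if "1 \<le> i" "i \<le> n'" for i
    using that nonzero_pow[OF cgL, of i p] by (metis not_one_le_zero)
  have "z = (\<Oplus>i\<in>{..n'}. coeff g i \<otimes> x [^] i)"
    unfolding g(3) using eval_as_sum[OF subfield_polyE(2)[OF M g(1)] x(1) g(2)] n' by (simp add: lessThan_Suc_atMost)
  also have "\<dots> = coeff g 0 \<oplus> (\<Oplus>i\<in>{1..n'}. coeff g i \<otimes> x [^] i)"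
    using cgL x(1) by (subst split) auto
  also have "(\<Oplus>i\<in>{1..n'}. coeff g i \<otimes> x [^] i) = \<zero>"
    using c0 x(1) by (intro add.finprod_one_eqI) auto
  finally show "z \<in> M" using cg[of 0] cgL[of 0] by simp
qed

text \<open>With \<open>M = F(z\<^sup>p)\<close>, the previous lemma descends \<open>z\<close> from \<open>M(x, y)\<close> to \<open>M(x)\<close> and then to \<open>M\<close>.\<close>

lemma sep_cl_adjoin2:
  assumes F: "subfield F L" and x: "x \<in> sep_cl F" and y: "y \<in> sep_cl F" and z: "z \<in> adjoin L (adjoin L F {x}) {y}"
  shows "z \<in> sep_cl F"
proof -
  have FL: "F \<subseteq> carrier L" using subfieldE(3)[OF F] .
  have xa: "x \<in> alg_cl F" "x \<in> carrier L" "algebraic F x" and ya: "y \<in> alg_cl F" "y \<in> carrier L" "algebraic F y"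
    using x y by (auto simp: rel_sep_closure_def alg_cl_iff)
  note A = alg_cl_subfield[OF F]
  have Fx: "subfield (adjoin L F {x}) L" "adjoin L F {x} \<subseteq> alg_cl F" using adjoin_simps(1)[of F "{x}"] FL xa adjoin_alg_cl[OF F, of "{x}"] by auto
  have "adjoin L (adjoin L F {x}) {y} \<subseteq> alg_cl F"
    using adjoin_simps(4)[of "adjoin L F {x}" "{y}" "alg_cl F"] A Fx ya subfieldE(3)[OF Fx(1)] by auto
  then have za: "z \<in> alg_cl F" "z \<in> carrier L" using z by (auto simp: alg_cl_iff)
  have "z \<in> adjoin L F {z [^] p}" if p: "Factorial_Ring.prime p" "nat_elt p = \<zero>" for p
  proof -
    let ?M = "adjoin L F {z [^] p}" let ?Mx = "adjoin L ?M {x}"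
    have M: "subfield ?M L" "F \<subseteq> ?M" "z [^] p \<in> ?M"
      using adjoin_simps[of F "{z [^] p}"] FL za by auto
    have MsL: "?M \<subseteq> carrier L" using subfieldE(3)[OF M(1)] .
    have Mx: "subfield ?Mx L" "?M \<subseteq> ?Mx" using adjoin_simps[of ?M "{x}"] MsL xa by auto
    have MxL: "?Mx \<subseteq> carrier L" using subfieldE(3)[OF Mx(1)] .
    have xs: "x \<in> adjoin L ?M {x [^] p}"
      using x p adjoin_mono[OF M(2) MsL, of "{x [^] p}"] xa unfolding sep_cl_iff[OF F] by auto
    have ys: "y \<in> adjoin L ?Mx {y [^] p}"
      using y p adjoin_mono[of F ?Mx "{y [^] p}"] M(2) Mx(2) MxL ya unfolding sep_cl_iff[OF F] by auto
    have "adjoin L F {x} \<subseteq> ?Mx" using adjoin_mono[OF M(2) MsL, of "{x}"] xa by simp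
    then have "z \<in> adjoin L ?Mx {y}" using z adjoin_mono[OF _ MxL, of "adjoin L F {x}" "{y}"] ya by auto
    then have "z \<in> ?Mx"
      using separable_p_root[OF p Mx(1) ya(2) _ ys] alg_mono[OF _ ya(3), of ?Mx] M(2,3) Mx(2) by blast
    then show "z \<in> ?M"
      using separable_p_root[OF p M(1) xa(2) _ xs _ M(3)] alg_mono[OF M(2) xa(3)] by blast
  qed
  then show ?thesis unfolding sep_cl_iff[OF F] using za by blast
qed

lemma sep_cl_subfield:
  assumes F: "subfield F L"
  shows "subfield (sep_cl F) L" "F \<subseteq> sep_cl F" "sep_cl F \<subseteq> alg_cl F"
proof -
  have FL: "F \<subseteq> carrier L" using subfieldE(3)[OF F] .
  show sub: "sep_cl F \<subseteq> alg_cl F" by (auto simp: rel_sep_closure_def)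
  show FS: "F \<subseteq> sep_cl F"
  proof
    fix x assume x: "x \<in> F"
    then have "x \<in> adjoin L F {x [^] p}" for p::nat
      using adjoin_simps(2)[of F "{x [^] p}"] FL by auto
    then show "x \<in> sep_cl F" unfolding sep_cl_iff[OF F] using alg_cl_subfield(2)[OF F] x by auto
  qed
  have L: "sep_cl F \<subseteq> carrier L" using sub by (auto simp: alg_cl_iff)
  have two: "subfield (adjoin L (adjoin L F {x}) {y}) L" "x \<in> adjoin L (adjoin L F {x}) {y}" "y \<in> adjoin L (adjoin L F {x}) {y}"
    if "x \<in> carrier L" "y \<in> carrier L" for x y
    using adjoin_simps[of F "{x}"] adjoin_simps[of "adjoin L F {x}" "{y}"] subfieldE(3)[of "adjoin L F {x}" L] FL that by auto
  show "subfield (sep_cl F) L"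
  proof (rule subfieldI')
    show "subring (sep_cl F) L"
    proof (rule subringI[OF L])
      show "\<one> \<in> sep_cl F" using FS subringE(3)[OF subfieldE(1)[OF F]] by blast
      fix x y assume xy: "x \<in> sep_cl F" "y \<in> sep_cl F"
      then have c: "x \<in> carrier L" "y \<in> carrier L" using L by auto
      note T = two[OF c] and R = subringE[OF subfieldE(1)[OF two(1)[OF c]]]
      show "x \<otimes> y \<in> sep_cl F" "x \<oplus> y \<in> sep_cl F"
        using sep_cl_adjoin2[OF F xy] R(6,7) T(2,3) by blast+
      show "\<ominus> x \<in> sep_cl F" using sep_cl_adjoin2[OF F xy] R(5) T(2) by blast
    qed
    fix x assume x: "x \<in> sep_cl F - {\<zero>}"
    then have c: "x \<in> carrier L" using L by auto
    show "inv x \<in> sep_cl F"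
      using sep_cl_adjoin2[OF F] x subfield_m_inv(1)[OF two(1)[OF c c]] two(2)[OF c c] by blast
  qed
qed

text \<open>As long as an element is inseparable, its \<open>p\<close>-th power has smaller degree. In characteristic zero the
  exponent is \<open>1\<close>; otherwise it is a power of the characteristic, and Frobenius is injective.\<close>

lemma power_in_sep_cl:
  assumes F: "subfield F L" and y: "y \<in> alg_cl F"
  obtains q where "y [^] (q::nat) \<in> sep_cl F" "\<And>u w. u \<in> carrier L \<Longrightarrow> w \<in> carrier L \<Longrightarrow> u [^] q = w [^] q \<Longrightarrow> u = w"
  using y
proof (induction "degree (Irr F y)" arbitrary: y thesis rule: less_induct)
  case less
  have a: "y \<in> carrier L" "algebraic F y" using less.prems(2) by (auto simp: alg_cl_iff)
  show ?case
  proof (cases "y \<in> sep_cl F")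
    case True
    then show ?thesis using less.prems(1)[of 1] a by simp
  next
    case False
    then obtain r where "r \<in> carrier L" "alg_mult (Irr F y) r \<ge> 2"
      using less.prems(2) unfolding rel_sep_closure_def by force
    then obtain p where p: "Factorial_Ring.prime p" "nat_elt p = \<zero>" "degree (Irr F (y [^] p)) < degree (Irr F y)"
      using inseparable_degree_drop[OF F a] by blast
    have "y [^] k \<in> alg_cl F" for k::nat
      using subringE(3,6)[OF subfieldE(1)[OF alg_cl_subfield(1)[OF F]]] less.prems(2) by (induct k) auto
    then obtain q where q: "(y [^] p) [^] (q::nat) \<in> sep_cl F"
      "\<And>u w. u \<in> carrier L \<Longrightarrow> w \<in> carrier L \<Longrightarrow> u [^] q = w [^] q \<Longrightarrow> u = w"
      using less.hyps[OF p(3)] by blast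
    have "y [^] (p * q) \<in> sep_cl F" using q(1) a by (simp add: nat_pow_pow)
    moreover have "u = w" if "u \<in> carrier L" "w \<in> carrier L" "u [^] (p * q) = w [^] (p * q)" for u w
    proof -
      have "(u [^] p) [^] q = (w [^] p) [^] q" using that by (simp add: nat_pow_pow)
      then have "u [^] p = w [^] p" using q(2)[of "u [^] p" "w [^] p"] that(1,2) by blast
      then show ?thesis using frobenius_inj[OF p(1,2) that(1,2)] by blast
    qed
    ultimately show ?thesis using less.prems(1) by blast
  qed
qed

lemma sep_cl_base_mono:
  assumes F: "subfield F L" and M: "subfield M L" and FM: "F \<subseteq> M" shows "sep_cl F \<subseteq> sep_cl M"
proof
  fix x assume "x \<in> sep_cl F"
  then have a: "x \<in> carrier L" "algebraic F x" and m: "\<And>r. r \<in> carrier L \<Longrightarrow> alg_mult (Irr F x) r \<le> 1"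
    by (auto simp: rel_sep_closure_def alg_cl_iff)
  note D = Irr_dvd_mono[OF F M FM a]
  have "alg_mult (Irr M x) r \<le> 1" if "r \<in> carrier L" for r using D(3)[of r] m[OF that] by simp
  then show "x \<in> sep_cl M" using D(1) a by (auto simp: rel_sep_closure_def alg_cl_iff)
qed

end

section \<open>Valuations and Newton polygons\<close>

locale valued_field = algebraically_closed L for L :: "('a, 'b) ring_scheme" (structure) +
  fixes v :: "'a \<Rightarrow> 'g::linordered_ab_group_add extended"
  assumes krull: "krull_valuation L v"
begin

lemma v_zero_iff: "x \<in> carrier L \<Longrightarrow> v x = Pinf \<longleftrightarrow> x = \<zero>"
  and v_mult: "x \<in> carrier L \<Longrightarrow> y \<in> carrier L \<Longrightarrow> v (x \<otimes> y) = v x + v y"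
  and v_add_min: "x \<in> carrier L \<Longrightarrow> y \<in> carrier L \<Longrightarrow> min (v x) (v y) \<le> v (x \<oplus> y)"
  and v_not_Minf: "x \<in> carrier L \<Longrightarrow> v x \<noteq> Minf"
  using krull by (auto simp: krull_valuation_def)

lemma v_zero [simp]: "v \<zero> = Pinf" using v_zero_iff by simp

lemma v_finE:
  assumes "x \<in> carrier L" "x \<noteq> \<zero>" obtains g where "v x = Fin g"
  using v_zero_iff[OF assms(1)] v_not_Minf[OF assms(1)] assms(2) by (cases "v x") auto

lemma v_less_Pinf: "x \<in> carrier L \<Longrightarrow> x \<noteq> \<zero> \<Longrightarrow> v x < Pinf"
  using v_zero_iff[of x] by (cases "v x") auto

lemma v_less_nonzero: "x \<in> carrier L \<Longrightarrow> v x < c \<Longrightarrow> x \<noteq> \<zero>"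
  by auto

lemma v_one [simp]: "v \<one> = Fin 0"
proof -
  obtain g where g: "v \<one> = Fin g" using v_finE[of \<one>] by auto
  have "v (\<one> \<otimes> \<one>) = v \<one> + v \<one>" by (rule v_mult) auto
  then show ?thesis using g by simp
qed

lemma v_uminus [simp]:
  assumes "x \<in> carrier L" shows "v (\<ominus> x) = v x"
proof -
  have "\<ominus> \<one> \<otimes> \<ominus> \<one> = \<one>" by algebra
  then have m: "v (\<ominus> \<one>) + v (\<ominus> \<one>) = Fin 0" using v_mult[of "\<ominus> \<one>" "\<ominus> \<one>"] by simp
  then have "v (\<ominus> \<one>) = Fin 0" by (cases "v (\<ominus> \<one>)") auto
  moreover have "\<ominus> x = \<ominus> \<one> \<otimes> x" using assms by algebra
  ultimately have "v (\<ominus> x) = Fin 0 + v x" using v_mult[of "\<ominus> \<one>" x] assms by simp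
  then show ?thesis by (metis add_0 zero_extended_def)
qed

lemma v_inv:
  assumes "x \<in> carrier L" "x \<noteq> \<zero>" "v x = Fin g" shows "v (inv x) = Fin (- g)"
proof -
  note i = inv_simps[OF assms(1,2)]
  obtain h where h: "v (inv x) = Fin h" using v_finE[OF i(1,4)] .
  have "v (x \<otimes> inv x) = v x + v (inv x)" using v_mult i assms by blast
  then have "g + h = 0" using i h assms by simp
  then show ?thesis using h by (simp add: eq_neg_iff_add_eq_0 add.commute)
qed

lemma v_add_ge: "x \<in> carrier L \<Longrightarrow> y \<in> carrier L \<Longrightarrow> c \<le> v x \<Longrightarrow> c \<le> v y \<Longrightarrow> c \<le> v (x \<oplus> y)"
  and v_add_gt: "x \<in> carrier L \<Longrightarrow> y \<in> carrier L \<Longrightarrow> c < v x \<Longrightarrow> c < v y \<Longrightarrow> c < v (x \<oplus> y)"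
  using v_add_min[of x y] by (auto simp: min_def split: if_splits)

lemma v_minus_ge: "x \<in> carrier L \<Longrightarrow> y \<in> carrier L \<Longrightarrow> c \<le> v x \<Longrightarrow> c \<le> v y \<Longrightarrow> c \<le> v (x \<ominus> y)"
  and v_minus_gt: "x \<in> carrier L \<Longrightarrow> y \<in> carrier L \<Longrightarrow> c < v x \<Longrightarrow> c < v y \<Longrightarrow> c < v (x \<ominus> y)"
  unfolding minus_eq by (auto intro!: v_add_ge v_add_gt)

lemma v_add_eq:
  assumes "x \<in> carrier L" "y \<in> carrier L" "v x < v y" shows "v (x \<oplus> y) = v x"
proof (rule antisym)
  show "v x \<le> v (x \<oplus> y)" using assms v_add_ge[of x y "v x"] by auto
  show "v (x \<oplus> y) \<le> v x"
  proof (rule ccontr)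
    assume "\<not> v (x \<oplus> y) \<le> v x"
    then have "v x < v ((x \<oplus> y) \<ominus> y)" using assms by (intro v_minus_gt) auto
    moreover have "(x \<oplus> y) \<ominus> y = x" using assms by algebra
    ultimately show False by simp
  qed
qed

lemma v_minus_commute: "x \<in> carrier L \<Longrightarrow> y \<in> carrier L \<Longrightarrow> v (x \<ominus> y) = v (y \<ominus> x)"
proof -
  assume c: "x \<in> carrier L" "y \<in> carrier L"
  have "x \<ominus> y = \<ominus> (y \<ominus> x)" using c by algebra
  then show ?thesis using c by simp
qed

lemma v_close_eq:
  assumes "x \<in> carrier L" "u \<in> carrier L" "v x < v (x \<ominus> u)" shows "v u = v x"
proof -
  have "u = x \<oplus> \<ominus> (x \<ominus> u)" using assms by algebra
  then have "v u = v (x \<oplus> \<ominus> (x \<ominus> u))" by simp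
  also have "\<dots> = v x" using assms by (intro v_add_eq) auto
  finally show ?thesis .
qed

lemma v_finsum_ge:
  assumes "\<And>i. i \<in> A \<Longrightarrow> f i \<in> carrier L" "\<And>i. i \<in> A \<Longrightarrow> c \<le> v (f i)"
  shows "c \<le> v (\<Oplus>i\<in>A. f i)"
  using assms
proof (induct A rule: infinite_finite_induct)
  case (insert x A)
  then show ?case by (simp add: Pi_def v_add_ge finsum_closed)
qed (auto simp: finsum_infinite)

lemma v_finsum_gt:
  assumes "\<And>i. i \<in> A \<Longrightarrow> f i \<in> carrier L" "\<And>i. i \<in> A \<Longrightarrow> c < v (f i)" "c < Pinf"
  shows "c < v (\<Oplus>i\<in>A. f i)"
  using assms
proof (induct A rule: infinite_finite_induct)
  case (insert x A)
  then show ?case by (simp add: Pi_def v_add_gt finsum_closed)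
qed (auto simp: finsum_infinite)

lemma v_mult_mono:
  assumes "x \<in> carrier L" "y \<in> carrier L" "a \<in> carrier L" "b \<in> carrier L" "v a \<le> v x" "v b \<le> v y"
  shows "v (a \<otimes> b) \<le> v (x \<otimes> y)"
  using assms v_not_Minf unfolding v_mult[OF assms(1,2)] v_mult[OF assms(3,4)] by (intro add_mono)

lemma v_mult_strict_mono:
  assumes "x \<in> carrier L" "y \<in> carrier L" "a \<in> carrier L" "b \<in> carrier L" "v a < v x" "v b \<le> v y" "b \<noteq> \<zero>"
  shows "v (a \<otimes> b) < v (x \<otimes> y)"
proof -
  obtain g where "v a = Fin g" using assms v_finE[of a] by (metis v_less_nonzero)
  moreover obtain h where "v b = Fin h" using v_finE[OF assms(4,7)] .
  ultimately show ?thesis using assms v_not_Minf[OF assms(1)] v_not_Minf[OF assms(2)]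
    unfolding v_mult[OF assms(1,2)] v_mult[OF assms(3,4)]
    by (cases "v x"; cases "v y") (auto intro: add_less_le_mono)
qed

lemma v_mult_cancel:
  assumes "x \<in> carrier L" "y \<in> carrier L" "a \<in> carrier L" "a \<noteq> \<zero>"
  shows "v (a \<otimes> x) = v (a \<otimes> y) \<longleftrightarrow> v x = v y" "v (a \<otimes> x) < v (a \<otimes> y) \<longleftrightarrow> v x < v y"
    "v (a \<otimes> x) \<le> v (a \<otimes> y) \<longleftrightarrow> v x \<le> v y"
proof -
  obtain h where h: "v a = Fin h" using v_finE[OF assms(3,4)] .
  note m = v_mult[OF assms(3,1)] v_mult[OF assms(3,2)]
  show "v (a \<otimes> x) = v (a \<otimes> y) \<longleftrightarrow> v x = v y" "v (a \<otimes> x) < v (a \<otimes> y) \<longleftrightarrow> v x < v y"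
    "v (a \<otimes> x) \<le> v (a \<otimes> y) \<longleftrightarrow> v x \<le> v y"
    using v_not_Minf[OF assms(1)] v_not_Minf[OF assms(2)] unfolding m h
    by (cases "v x"; cases "v y"; simp)+
qed

text \<open>The term \<open>p\<^sub>i y\<^sup>i\<close> of a polynomial at \<open>y\<close>. A dominant index \<open>s\<close> is one whose term has least
  value, strictly less than the terms of the indices related to \<open>s\<close> by \<open>Q\<close>. With \<open>Q\<close> being \<open>(>)\<close> this
  is the right end point of a side of a Newton polygon; with \<open>(\<noteq>)\<close> it says that the polygon has no
  side of the slope belonging to \<open>y\<close>.\<close>

definition term_at :: "'a \<Rightarrow> 'a list \<Rightarrow> nat \<Rightarrow> 'a" where
  "term_at y p i = coeff p i \<otimes> y [^] i"

definition dominant :: "(nat \<Rightarrow> nat \<Rightarrow> bool) \<Rightarrow> 'a \<Rightarrow> 'a list \<Rightarrow> nat \<Rightarrow> bool" where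
  "dominant Q y p s \<longleftrightarrow> term_at y p s \<noteq> \<zero> \<and> (\<forall>i. v (term_at y p s) \<le> v (term_at y p i)) \<and>
     (\<forall>i. Q i s \<longrightarrow> v (term_at y p s) < v (term_at y p i))"

lemma term_at_closed:
  "p \<in> carrier (poly_ring L) \<Longrightarrow> y \<in> carrier L \<Longrightarrow> term_at y p i \<in> carrier L"
  unfolding term_at_def using coeff_closed by simp

lemma term_at_mult:
  assumes "p \<in> carrier (poly_ring L)" "q \<in> carrier (poly_ring L)" "y \<in> carrier L"
  shows "term_at y (p \<otimes>\<^bsub>poly_ring L\<^esub> q) k = (\<Oplus>i\<in>{..k}. term_at y p i \<otimes> term_at y q (k - i))"
proof -
  note c = coeff_closed[OF assms(1)] coeff_closed[OF assms(2)]
  have "coeff (p \<otimes>\<^bsub>poly_ring L\<^esub> q) k = (\<Oplus>i\<in>{..k}. coeff p i \<otimes> coeff q (k - i))"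
    using poly_mult_coeff[of p q] subfield_polyE(2)[OF carrier_is_subfield] assms by (simp add: univ_poly_mult)
  then have "term_at y (p \<otimes>\<^bsub>poly_ring L\<^esub> q) k = (\<Oplus>i\<in>{..k}. coeff p i \<otimes> coeff q (k - i)) \<otimes> y [^] k"
    by (simp add: term_at_def)
  also have "\<dots> = (\<Oplus>i\<in>{..k}. (coeff p i \<otimes> coeff q (k - i)) \<otimes> y [^] k)"
    using c assms(3) by (subst finsum_ldistr) auto
  also have "\<dots> = (\<Oplus>i\<in>{..k}. term_at y p i \<otimes> term_at y q (k - i))"
  proof (rule finsum_cong')
    fix i assume "i \<in> {..k}"
    then have "y [^] k = y [^] i \<otimes> y [^] (k - i)" using assms(3) by (simp add: nat_pow_mult)
    then show "(coeff p i \<otimes> coeff q (k - i)) \<otimes> y [^] k = term_at y p i \<otimes> term_at y q (k - i)"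
      unfolding term_at_def using c assms(3) by (simp add: m_assoc m_lcomm)
  qed (use term_at_closed assms in auto)
  finally show ?thesis .
qed

text \<open>In the sum for the coefficient of index \<open>s + t\<close> only the product of the two dominant terms has the least
  value, since \<open>Q\<close> holds in one of the factors of every other product.\<close>

lemma dominant_mult:
  assumes p: "p \<in> carrier (poly_ring L)" "dominant Q y p s" and q: "q \<in> carrier (poly_ring L)" "dominant Q y q t"
    and y: "y \<in> carrier L"
    and Q1: "\<And>i j. i + j = s + t \<Longrightarrow> i \<noteq> s \<Longrightarrow> Q i s \<or> Q j t"
    and Q2: "\<And>i j. Q (i + j) (s + t) \<Longrightarrow> Q i s \<or> Q j t"
  shows "dominant Q y (p \<otimes>\<^bsub>poly_ring L\<^esub> q) (s + t)"
    "v (term_at y (p \<otimes>\<^bsub>poly_ring L\<^esub> q) (s + t)) = v (term_at y p s \<otimes> term_at y q t)"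
proof -
  note c = term_at_closed[OF p(1) y] term_at_closed[OF q(1) y]
  let ?pq = "p \<otimes>\<^bsub>poly_ring L\<^esub> q" and ?m = "term_at y p s \<otimes> term_at y q t"
  have nz: "term_at y p s \<noteq> \<zero>" "term_at y q t \<noteq> \<zero>" using p q by (auto simp: dominant_def)
  then have mz: "?m \<noteq> \<zero>" using nonzero_mult c by blast
  have mc: "?m \<in> carrier L" using c by simp
  then have mP: "v ?m < Pinf" using v_less_Pinf[OF mc mz] by blast
  have ge: "v ?m \<le> v (term_at y p i \<otimes> term_at y q j)" for i j
    using p q c by (intro v_mult_mono) (auto simp: dominant_def)
  have gt: "v ?m < v (term_at y p i \<otimes> term_at y q j)" if "Q i s \<or> Q j t" for i j
    using that
  proof
    assume "Q i s" then show ?thesis using p q c nz by (intro v_mult_strict_mono) (auto simp: dominant_def)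
  next
    assume "Q j t"
    then have "v (term_at y q t \<otimes> term_at y p s) < v (term_at y q j \<otimes> term_at y p i)"
      using p q c nz by (intro v_mult_strict_mono) (auto simp: dominant_def)
    then show ?thesis using c m_comm by simp
  qed
  have all_ge: "v ?m \<le> v (term_at y ?pq k)" for k
    unfolding term_at_mult[OF p(1) q(1) y] using ge c by (intro v_finsum_ge) auto
  have all_gt: "v ?m < v (term_at y ?pq k)" if k: "Q k (s + t)" for k
    unfolding term_at_mult[OF p(1) q(1) y]
  proof (rule v_finsum_gt[OF _ _ mP])
    fix i assume "i \<in> {..k}"
    then show "v ?m < v (term_at y p i \<otimes> term_at y q (k - i))" using gt Q2[of i "k - i"] k by simp
  qed (use c in auto)
  have eq: "v (term_at y ?pq (s + t)) = v ?m"
  proof -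
    let ?f = "\<lambda>i. term_at y p i \<otimes> term_at y q (s + t - i)"
    have "term_at y ?pq (s + t) = ?f s \<oplus> (\<Oplus>i\<in>{..s+t} - {s}. ?f i)"
      unfolding term_at_mult[OF p(1) q(1) y] using c
      by (subst add.finprod_insert[symmetric]) (auto simp: insert_absorb)
    moreover have "v (?f s \<oplus> (\<Oplus>i\<in>{..s+t} - {s}. ?f i)) = v ?m"
    proof -
      have "v ?m < v (\<Oplus>i\<in>{..s+t} - {s}. ?f i)"
      proof (rule v_finsum_gt[OF _ _ mP])
        fix i assume "i \<in> {..s+t} - {s}"
        then show "v ?m < v (?f i)" using gt Q1[of i "s + t - i"] by simp
      qed (use c in auto)
      then show ?thesis using v_add_eq[of ?m "\<Oplus>i\<in>{..s+t} - {s}. ?f i"] c by (simp add: finsum_closed Pi_def)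
    qed
    ultimately show ?thesis by simp
  qed
  then have "term_at y ?pq (s + t) \<noteq> \<zero>" using mP by auto
  then show "dominant Q y ?pq (s + t)" unfolding dominant_def eq using all_ge all_gt by blast
  show "v (term_at y ?pq (s + t)) = v ?m" using eq .
qed

lemma term_at_linear:
  assumes "r \<in> carrier L" "y \<in> carrier L"
  shows "term_at y [\<one>, \<ominus> r] i = (if i = 0 then \<ominus> r else if i = 1 then y else \<zero>)"
  using assms by (auto simp: term_at_def)

lemma dominant_linear:
  assumes "r \<in> carrier L" "y \<in> carrier L" "y \<noteq> \<zero>"
  shows "v r < v y \<Longrightarrow> dominant (\<noteq>) y [\<one>, \<ominus> r] 0" "v y < v r \<Longrightarrow> dominant (\<noteq>) y [\<one>, \<ominus> r] 1"
    "v r < v y \<Longrightarrow> dominant (>) y [\<one>, \<ominus> r] 0" "v y \<le> v r \<Longrightarrow> dominant (>) y [\<one>, \<ominus> r] 1"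
proof -
  have rz: "r \<noteq> \<zero>" if "v r < v y" using that by auto
  have fin: "v y < Pinf" using v_less_Pinf[OF assms(2,3)] by blast
  show "v r < v y \<Longrightarrow> dominant (\<noteq>) y [\<one>, \<ominus> r] 0" "v r < v y \<Longrightarrow> dominant (>) y [\<one>, \<ominus> r] 0"
    using rz assms fin unfolding dominant_def term_at_linear[OF assms(1,2)] by auto
  show "v y < v r \<Longrightarrow> dominant (\<noteq>) y [\<one>, \<ominus> r] 1" "v y \<le> v r \<Longrightarrow> dominant (>) y [\<one>, \<ominus> r] 1"
    using assms fin unfolding dominant_def term_at_linear[OF assms(1,2)] by auto
qed

lemma dominant_const:
  assumes "c \<in> carrier L" "c \<noteq> \<zero>" "y \<in> carrier L"
  shows "dominant (\<noteq>) y [c] 0" "dominant (>) y [c] 0"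
proof -
  have "v c < Pinf" using v_less_Pinf[OF assms(1,2)] by blast
  then show "dominant (\<noteq>) y [c] 0" "dominant (>) y [c] 0"
    using assms by (auto simp: dominant_def term_at_def)
qed

text \<open>Each linear factor \<open>t - r\<close> has a single dominant term at \<open>y\<close> unless \<open>v r = v y\<close>.\<close>

lemma no_root_of_value_dominant:
  assumes "p \<in> carrier (poly_ring L)" "p \<noteq> []" "y \<in> carrier L" "y \<noteq> \<zero>"
    "\<And>r. r \<in> carrier L \<Longrightarrow> eval p r = \<zero> \<Longrightarrow> v r \<noteq> v y"
  shows "\<exists>s. dominant (\<noteq>) y p s"
  using assms(1,2,5)
proof (induction p rule: linear_factor_induct)
  case (const c)
  then show ?case using dominant_const assms(3) by blast
next
  case (linear r q)
  have "eval [\<one>, \<ominus> r] r = \<zero>" using eval_linear[OF linear(1,1)] linear(1) by (simp add: r_right_minus_eq)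
  then have "eval ([\<one>, \<ominus> r] \<otimes>\<^bsub>poly_ring L\<^esub> q) r = \<zero>"
    using eval_mult[OF linear_poly[OF linear(1)] linear(2) linear(1)] eval_closed[OF linear(2,1)] by simp
  then have "v r \<noteq> v y" using linear by blast
  then obtain s where s: "dominant (\<noteq>) y [\<one>, \<ominus> r] s"
    using dominant_linear(1,2)[OF linear(1) assms(3,4)] by (meson linorder_neqE)
  have "v r' \<noteq> v y" if "r' \<in> carrier L" "eval q r' = \<zero>" for r'
    using linear.prems[OF that(1)] eval_mult[OF linear_poly[OF linear(1)] linear(2) that(1)] that(2)
      eval_closed[OF linear_poly[OF linear(1)] that(1)] by simp
  then obtain t where t: "dominant (\<noteq>) y q t" using linear.IH by blast
  have "dominant (\<noteq>) y ([\<one>, \<ominus> r] \<otimes>\<^bsub>poly_ring L\<^esub> q) (s + t)"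
    by (rule dominant_mult(1)[OF linear_poly[OF linear(1)] s linear(2) t assms(3)]) auto
  then show ?case by blast
qed

lemma eval_terms:
  assumes "p \<in> carrier (poly_ring L)" "y \<in> carrier L" "length p \<le> n"
  shows "eval p y = (\<Oplus>i\<in>{..<n}. term_at y p i)"
  unfolding term_at_def using eval_as_sum[OF subfield_polyE(2)[OF carrier_is_subfield assms(1)] assms(2,3)] .

lemma dominant_eval_nonzero:
  assumes "p \<in> carrier (poly_ring L)" "y \<in> carrier L" "dominant (\<noteq>) y p s"
  shows "eval p y \<noteq> \<zero>"
proof -
  note c = term_at_closed[OF assms(1,2)]
  have d: "term_at y p s \<noteq> \<zero>" "\<And>i. i \<noteq> s \<Longrightarrow> v (term_at y p s) < v (term_at y p i)" using assms(3) by (auto simp: dominant_def)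
  have fin: "v (term_at y p s) < Pinf" using v_less_Pinf[OF c d(1)] by blast
  have "s < length p"
  proof (rule ccontr)
    assume "\<not> s < length p"
    then show False using d(1) assms(2) coeff_length[of p s] by (simp add: term_at_def)
  qed
  then have "eval p y = term_at y p s \<oplus> (\<Oplus>i\<in>{..<length p} - {s}. term_at y p i)"
    unfolding eval_terms[OF assms(1,2) order_refl] using c
    by (subst add.finprod_insert[symmetric]) (auto simp: insert_absorb)
  moreover have "v (\<Oplus>i\<in>{..<length p} - {s}. term_at y p i) > v (term_at y p s)"
    using c d fin by (intro v_finsum_gt) auto
  ultimately have "v (eval p y) = v (term_at y p s)" using v_add_eq c by (simp add: finsum_closed Pi_def)
  then show ?thesis using fin by auto
qed

subsection \<open>Separating valuations by one element\<close>

text \<open>Distinct valuations need not be independent, but the homomorphisms \<open>z \<mapsto> v(\<tau> z) - v z\<close> into a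
  torsion free group behave like linear forms: finitely many nonzero ones have a common element
  outside all their kernels, because \<open>m d + e = 0\<close> has at most one solution \<open>m\<close> if \<open>d \<noteq> 0\<close>. The multiple \<open>m d\<close> is
  written as an iterated sum, which makes sense in any ordered abelian group.\<close>

lemma multiple_mono:
  fixes d :: 'g shows "d > 0 \<Longrightarrow> m < n \<Longrightarrow> (((+) d) ^^ m) 0 < (((+) d) ^^ n) 0"
proof (rule lift_Suc_mono_less[of "\<lambda>n. (((+) d) ^^ n) 0"])
qed simp_all

lemma multiple_antimono:
  fixes d :: 'g shows "d < 0 \<Longrightarrow> m < n \<Longrightarrow> (((+) d) ^^ n) 0 < (((+) d) ^^ m) 0"
proof (induct n)
  case (Suc n)
  have 1: "d + (((+) d) ^^ n) 0 < (((+) d) ^^ n) 0" using Suc(2) by simp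
  show ?case
  proof (cases "m = n")
    case True then show ?thesis using 1 by simp
  next
    case False
    then have "(((+) d) ^^ n) 0 < (((+) d) ^^ m) 0" using Suc by simp
    then show ?thesis using less_trans[OF 1] by simp
  qed
qed simp

lemma multiple_inj:
  fixes d :: 'g shows "d \<noteq> 0 \<Longrightarrow> inj (\<lambda>m. (((+) d) ^^ m) 0)"
  using multiple_mono[of d] multiple_antimono[of d] by (intro injI) (metis linorder_neqE less_irrefl)

lemma v_pow:
  assumes "x \<in> carrier L" "v x = Fin g" shows "v (x [^] (n::nat)) = Fin ((((+) g) ^^ n) 0)"
  using assms by (induct n) (simp_all add: v_mult add.commute)

lemma multiple_diff:
  fixes g h :: 'g shows "(((+) (g - h)) ^^ n) 0 = (((+) g) ^^ n) 0 - (((+) h) ^^ n) 0"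
  by (induct n) simp_all

text \<open>For each \<open>i\<close> at most one exponent \<open>m\<close> fails.\<close>

lemma separating_power:
  assumes emb: "\<And>i. i \<in> I \<Longrightarrow> embedding M (\<tau> i)" and I: "finite I"
    and z: "z \<in> M" "z \<noteq> \<zero>" "\<And>i. i \<in> I \<Longrightarrow> v (\<tau> i z) \<noteq> v z" and x: "x \<in> M" "x \<noteq> \<zero>" and M: "subfield M L"
  obtains m where "m \<ge> (1::nat)" "\<And>i. i \<in> I \<Longrightarrow> v (\<tau> i (z [^] m \<otimes> x)) \<noteq> v (z [^] m \<otimes> x)"
proof -
  have MsL: "M \<subseteq> carrier L" using subfieldE(3)[OF M] .
  have zp: "z [^] m \<in> M" for m::nat using z(1) subringE(3,6)[OF subfieldE(1)[OF M]] by (induct m) auto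
  have one: "m = n" if i: "i \<in> I" and e: "v (\<tau> i (z [^] m \<otimes> x)) = v (z [^] m \<otimes> x)" "v (\<tau> i (z [^] n \<otimes> x)) = v (z [^] n \<otimes> x)" for i and m n :: nat
  proof -
    note E = embedding_simps[OF emb[OF i]]
    obtain g where g: "v z = Fin g" using v_finE[of z] z MsL by blast
    obtain g' where g': "v (\<tau> i z) = Fin g'" using v_finE[of "\<tau> i z"] z E(1,8) by blast
    obtain h where h: "v x = Fin h" using v_finE[of x] x MsL by blast
    obtain h' where h': "v (\<tau> i x) = Fin h'" using v_finE[of "\<tau> i x"] x E(1,8) by blast
    have k: "(((+) (g' - g)) ^^ m) 0 = h - h'" if e: "v (\<tau> i (z [^] m \<otimes> x)) = v (z [^] m \<otimes> x)" for m :: nat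
    proof -
      have "v (z [^] m \<otimes> x) = Fin ((((+) g) ^^ m) 0 + h)"
        using v_mult[of "z [^] m" x] v_pow[OF _ g, of m] h subsetD[OF MsL z(1)] subsetD[OF MsL x(1)] by simp
      moreover have "v (\<tau> i (z [^] m \<otimes> x)) = Fin ((((+) g') ^^ m) 0 + h')"
        using v_mult[of "\<tau> i z [^] m" "\<tau> i x"] v_pow[OF _ g'] h' E(1,3,10) z x zp by auto
      ultimately show ?thesis using e unfolding multiple_diff by (simp add: algebra_simps)
    qed
    have "g' - g \<noteq> 0" using z(3)[OF i] g g' by auto
    then show ?thesis using multiple_inj k[OF e(1)] k[OF e(2)] by (metis injD)
  qed
  let ?bad = "\<lambda>i. {m::nat. v (\<tau> i (z [^] m \<otimes> x)) = v (z [^] m \<otimes> x)}"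
  have "finite (?bad i)" if "i \<in> I" for i
  proof (cases "?bad i = {}")
    case False
    then obtain m where "m \<in> ?bad i" by blast
    then have "?bad i \<subseteq> {m}" using one[OF that] by blast
    then show ?thesis by (metis finite.emptyI finite_insert finite_subset)
  qed simp
  then have "finite (insert 0 (\<Union>i\<in>I. ?bad i))" using I by simp
  then obtain m where "m \<notin> insert 0 (\<Union>i\<in>I. ?bad i)" using ex_new_if_finite infinite_UNIV_nat by blast
  then show thesis using that[of m] by auto
qed

lemma separating_element:
  assumes I: "finite I" and emb: "\<And>i. i \<in> I \<Longrightarrow> embedding M (\<tau> i)" and M: "subfield M L"
    and ex: "\<And>i. i \<in> I \<Longrightarrow> \<exists>z\<in>M. z \<noteq> \<zero> \<and> v (\<tau> i z) \<noteq> v z"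
  shows "\<exists>z\<in>M. z \<noteq> \<zero> \<and> (\<forall>i\<in>I. v (\<tau> i z) \<noteq> v z)"
  using I emb ex
proof (induct I)
  case empty
  show ?case using subringE(3)[OF subfieldE(1)[OF M]] by (intro bexI[of _ \<one>]) auto
next
  case (insert j I)
  have MsL: "M \<subseteq> carrier L" using subfieldE(3)[OF M] .
  obtain z where z: "z \<in> M" "z \<noteq> \<zero>" "\<And>i. i \<in> I \<Longrightarrow> v (\<tau> i z) \<noteq> v z" using insert by auto
  obtain w where w: "w \<in> M" "w \<noteq> \<zero>" "v (\<tau> j w) \<noteq> v w" using insert.prems(2)[of j] by auto
  show ?case
  proof (cases "v (\<tau> j z) = v z")
    case False
    then show ?thesis using z by blast
  next
    case True
    obtain m where m: "m \<ge> (1::nat)" "\<And>i. i \<in> I \<Longrightarrow> v (\<tau> i (z [^] m \<otimes> w)) \<noteq> v (z [^] m \<otimes> w)"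
      using separating_power[of I M \<tau> z w, OF insert.prems(1)[OF insertI2] insert(1) z w(1,2) M] by blast
    have zp: "z [^] m \<in> M" using z(1) subringE(3,6)[OF subfieldE(1)[OF M]] by (induct m) auto
    note E = embedding_simps[OF insert.prems(1)[of j]]
    have c: "z \<in> carrier L" "w \<in> carrier L" "\<tau> j z \<in> carrier L" "\<tau> j w \<in> carrier L" using z w MsL E(1) by auto
    obtain g where g: "v z = Fin g" using v_finE[of z] z MsL by blast
    have vp: "v (\<tau> j z [^] m) = v (z [^] m)" using v_pow[OF c(1) g] v_pow[OF c(3)] True g by simp
    have nz: "z [^] m \<noteq> \<zero>" using nonzero_pow c(1) z(2) by blast
    obtain h where h: "v (z [^] m) = Fin h" using v_finE[OF _ nz] c by auto
    have "v (\<tau> j (z [^] m \<otimes> w)) = Fin h + v (\<tau> j w)" using E(3,10) zp z w vp c h by (simp add: v_mult)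
    moreover have "v (z [^] m \<otimes> w) = Fin h + v w" using c h by (simp add: v_mult)
    moreover have "v (\<tau> j w) \<noteq> v w" using w by simp
    ultimately have "v (\<tau> j (z [^] m \<otimes> w)) \<noteq> v (z [^] m \<otimes> w)" using v_not_Minf[OF c(2)] v_not_Minf[OF c(4)]
      by (cases "v w"; cases "v (\<tau> j w)") auto
    moreover have "z [^] m \<otimes> w \<in> M" using zp w(1) subringE(6)[OF subfieldE(1)[OF M]] by blast
    moreover have "z [^] m \<otimes> w \<noteq> \<zero>" using nonzero_mult nz w c by auto
    ultimately show ?thesis using m(2) by blast
  qed
qed

subsection \<open>Extending valuation preserving embeddings\<close>

text \<open>One step of the extension. Suppose that for each root \<open>y\<close> of the transported minimal polynomial of
  \<open>x\<close> the extension \<open>x \<mapsto> y\<close> changes some value. Then one \<open>z \<in> M(x)\<close> has its value changed by all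
  these extensions; so the minimal polynomial of \<open>z\<close>, once transported, has no root of the same value
  as \<open>z\<close>. This is visible in the values of its coefficients, which are the same before the transport,
  and contradicts that \<open>z\<close> is a root.\<close>

lemma valued_extension_step:
  assumes emb: "embedding M \<tau>" and vM: "\<And>z. z \<in> M \<Longrightarrow> v (\<tau> z) = v z" and x: "x \<in> carrier L" "algebraic M x"
  shows "\<exists>y\<in>carrier L. \<forall>p\<in>carrier (M[X]). v (eval (map \<tau> p) y) = v (eval p x)"
proof (rule ccontr)
  assume no: "\<not> ?thesis"
  have M: "subfield M L" using embedding_subfield[OF emb] .
  have MsL: "M \<subseteq> carrier L" using subfieldE(3)[OF M] .
  note I = Irr_props[OF M x]
  let ?E = "adjoin L M {x}"
  have E: "subfield ?E L" "M \<subseteq> ?E" "x \<in> ?E" using adjoin_simps[of M "{x}"] MsL x by auto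
  have Eimg: "?E = (\<lambda>p. eval p x) ` carrier (M[X])"
    unfolding adjoin_algebraic(1)[OF M x] using simple_extension_as_eval_img[OF MsL x(1)] .
  define Y where "Y = {y \<in> carrier L. eval (map \<tau> (Irr M x)) y = \<zero>}"
  have IP: "map \<tau> (Irr M x) \<in> carrier (poly_ring L)" using embedding_poly(1)[OF emb I(1)] .
  have "Y \<subseteq> {y. is_root (map \<tau> (Irr M x)) y}" using I(3) by (auto simp: Y_def is_root_def)
  then have fY: "finite Y" using finite_number_of_roots[OF IP] finite_subset by blast
  have "\<forall>y\<in>Y. \<exists>\<tau>'. embedding ?E \<tau>' \<and> (\<forall>p\<in>carrier (M[X]). \<tau>' (eval p x) = eval (map \<tau> p) y)"
  proof
    fix y assume y: "y \<in> Y"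
    have "\<And>p. p \<in> carrier (M[X]) \<Longrightarrow> eval p x = \<zero> \<longleftrightarrow> eval (map \<tau> p) y = \<zero>"
      using root_of_Irr_relations[OF emb x] y unfolding Y_def by blast
    then show "\<exists>\<tau>'. embedding ?E \<tau>' \<and> (\<forall>p\<in>carrier (M[X]). \<tau>' (eval p x) = eval (map \<tau> p) y)"
      using embedding_extend[OF emb x(1)] y unfolding Y_def by (metis (no_types, lifting) mem_Collect_eq)
  qed
  then obtain S where S: "\<And>y. y \<in> Y \<Longrightarrow> embedding ?E (S y)"
    "\<And>y p. y \<in> Y \<Longrightarrow> p \<in> carrier (M[X]) \<Longrightarrow> S y (eval p x) = eval (map \<tau> p) y" by metis
  have ex: "\<exists>z\<in>?E. z \<noteq> \<zero> \<and> v (S y z) \<noteq> v z" if y: "y \<in> Y" for y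
  proof -
    have "y \<in> carrier L" using y by (simp add: Y_def)
    then obtain p where p: "p \<in> carrier (M[X])" "v (eval (map \<tau> p) y) \<noteq> v (eval p x)" using no by blast
    then have "v (S y (eval p x)) \<noteq> v (eval p x)" using S(2)[OF y] by simp
    moreover from this have "eval p x \<noteq> \<zero>" using embedding_simps(5)[OF S(1)[OF y]] by metis
    ultimately show ?thesis using p(1) unfolding Eimg by blast
  qed
  have "\<exists>z\<in>?E. z \<noteq> \<zero> \<and> (\<forall>y\<in>Y. v (S y z) \<noteq> v z)"
    by (rule separating_element[OF fY S(1) E(1) ex])
  then obtain z where z: "z \<in> ?E" "z \<noteq> \<zero>" "\<And>y. y \<in> Y \<Longrightarrow> v (S y z) \<noteq> v z" by blast
  have zc: "z \<in> carrier L" "algebraic M z" using z(1) subfieldE(3)[OF E(1)] adjoin_algebraic(5)[OF M x] by auto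
  note J = Irr_props[OF M zc]
  have JP: "map \<tau> (Irr M z) \<in> carrier (poly_ring L)" using embedding_poly(1)[OF emb J(1)] .
  have "v r \<noteq> v z" if r: "r \<in> carrier L" "eval (map \<tau> (Irr M z)) r = \<zero>" for r
  proof -
    let ?E1 = "adjoin L M {z}"
    obtain \<tau>1 where t1: "embedding ?E1 \<tau>1" "\<And>c. c \<in> M \<Longrightarrow> \<tau>1 c = \<tau> c" "\<tau>1 z = r"
      using embedding_extend[OF emb zc(1) r(1) root_of_Irr_relations[OF emb zc r]] by metis
    have E1: "subfield ?E1 L" "M \<subseteq> ?E1" "z \<in> ?E1" using adjoin_simps[of M "{z}"] MsL zc by auto
    have x1: "algebraic ?E1 x" using alg_mono[OF E1(2) x(2)] .
    note K = Irr_props[OF E1(1) x(1) x1]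
    obtain y where y: "y \<in> carrier L" "eval (map \<tau>1 (Irr ?E1 x)) y = \<zero>"
      using root_exists[OF embedding_poly(1)[OF t1(1) K(1)]] K(5) by auto
    obtain \<tau>2 where t2: "embedding (adjoin L ?E1 {x}) \<tau>2" "\<And>c. c \<in> ?E1 \<Longrightarrow> \<tau>2 c = \<tau>1 c" "\<tau>2 x = y"
      "\<And>p. p \<in> carrier (?E1[X]) \<Longrightarrow> \<tau>2 (eval p x) = eval (map \<tau>1 p) y"
      using embedding_extend[OF t1(1) x(1) y(1) root_of_Irr_relations[OF t1(1) x(1) x1 y]] by metis
    have MX: "p \<in> carrier (?E1[X])" "map \<tau>1 p = map \<tau> p" if "p \<in> carrier (M[X])" for p
    proof -
      show "p \<in> carrier (?E1[X])" using that E1(2) by (auto simp: univ_poly_carrier[symmetric] polynomial_def)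
      show "map \<tau>1 p = map \<tau> p" using subfield_polyE(1)[OF M that] t1(2) by (auto simp: map_eq_conv)
    qed
    have ev: "\<tau>2 (eval p x) = eval (map \<tau> p) y" if "p \<in> carrier (M[X])" for p
      using t2(4)[OF MX(1)[OF that]] MX(2)[OF that] by simp
    have "eval (map \<tau> (Irr M x)) y = \<zero>" using ev[OF I(1)] I(4) embedding_simps(5)[OF t2(1)] by simp
    then have yY: "y \<in> Y" using y(1) by (simp add: Y_def)
    obtain p where p: "p \<in> carrier (M[X])" "z = eval p x" using z(1) unfolding Eimg by blast
    have "S y z = r" using S(2)[OF yY p(1)] ev[OF p(1)] p(2) t2(2)[OF E1(3)] t1(3) by simp
    then show ?thesis using z(3)[OF yY] by simp
  qed
  then obtain s where "dominant (\<noteq>) z (map \<tau> (Irr M z)) s"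
    using no_root_of_value_dominant[OF JP _ zc(1) z(2)] J(3) by auto
  moreover have "v (term_at z (map \<tau> (Irr M z)) i) = v (term_at z (Irr M z) i)" for i
    unfolding term_at_def embedding_poly(3)[OF emb J(1)]
    using v_mult[of "\<tau> (coeff (Irr M z) i)" "z [^] i"] v_mult[of "coeff (Irr M z) i" "z [^] i"]
      vM[OF coeff_subfield[OF M J(1)]] coeff_subfield[OF M J(1), of i] MsL embedding_simps(1)[OF emb] zc(1) by auto
  ultimately have "dominant (\<noteq>) z (Irr M z) s"
    unfolding dominant_def using v_zero_iff[OF term_at_closed[OF J(2) zc(1)]] v_zero_iff[OF term_at_closed[OF JP zc(1)]] by metis
  then show False using dominant_eval_nonzero[OF J(2) zc(1)] J(4) by blast
qed

text \<open>A valuation preserving embedding, recorded by its graph: a subfield of the product ring on which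
  the two components have the same value. In this form unions of chains are immediate, and
  preservation of values gives single-valuedness and injectivity.\<close>

definition valued_graph :: "('a \<times> 'a) set \<Rightarrow> bool" where
  "valued_graph g \<longleftrightarrow> g \<subseteq> carrier L \<times> carrier L \<and> (\<one>, \<one>) \<in> g \<and>
     (\<forall>x y x' y'. (x, y) \<in> g \<and> (x', y') \<in> g \<longrightarrow> (x \<oplus> x', y \<oplus> y') \<in> g \<and> (x \<otimes> x', y \<otimes> y') \<in> g) \<and>
     (\<forall>x y. (x, y) \<in> g \<longrightarrow> (\<ominus> x, \<ominus> y) \<in> g \<and> v y = v x \<and> (x \<noteq> \<zero> \<longrightarrow> (inv x, inv y) \<in> g))"

lemma valued_graphD:
  assumes "valued_graph g"
  shows "(x, y) \<in> g \<Longrightarrow> x \<in> carrier L \<and> y \<in> carrier L" "(\<one>, \<one>) \<in> g"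
    "(x, y) \<in> g \<Longrightarrow> (x', y') \<in> g \<Longrightarrow> (x \<oplus> x', y \<oplus> y') \<in> g"
    "(x, y) \<in> g \<Longrightarrow> (x', y') \<in> g \<Longrightarrow> (x \<otimes> x', y \<otimes> y') \<in> g"
    "(x, y) \<in> g \<Longrightarrow> (\<ominus> x, \<ominus> y) \<in> g" "(x, y) \<in> g \<Longrightarrow> v y = v x"
    "(x, y) \<in> g \<Longrightarrow> x \<noteq> \<zero> \<Longrightarrow> (inv x, inv y) \<in> g"
  using assms unfolding valued_graph_def by blast+

lemma valued_graph_of_embedding:
  assumes "embedding M \<tau>" "\<And>z. z \<in> M \<Longrightarrow> v (\<tau> z) = v z"
  shows "valued_graph {(x, \<tau> x) | x. x \<in> M}"
proof -
  have M: "subfield M L" using embedding_subfield[OF assms(1)] .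
  note R = subringE[OF subfieldE(1)[OF M]] and E = embedding_simps[OF assms(1)]
  show ?thesis unfolding valued_graph_def
  proof (intro conjI allI impI)
    show "{(x, \<tau> x) |x. x \<in> M} \<subseteq> carrier L \<times> carrier L" using R(1) E(1) by blast
    show "(\<one>, \<one>) \<in> {(x, \<tau> x) |x. x \<in> M}" using R(3) E(4) by simp
    fix x y assume "(x, y) \<in> {(x, \<tau> x) |x. x \<in> M}"
    then have xy: "x \<in> M" "y = \<tau> x" by auto
    show "(\<ominus> x, \<ominus> y) \<in> {(x, \<tau> x) |x. x \<in> M}" using R(5)[OF xy(1)] E(6)[OF xy(1)] xy(2) by simp
    show "v y = v x" using assms(2) xy by simp
    show "(inv x, inv y) \<in> {(x, \<tau> x) |x. x \<in> M}" if "x \<noteq> \<zero>"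
      using E(9)[OF xy(1) that] subfield_m_inv(1)[OF M, of x] xy that by simp
  next
    fix x y x' y' assume "(x, y) \<in> {(x, \<tau> x) |x. x \<in> M} \<and> (x', y') \<in> {(x, \<tau> x) |x. x \<in> M}"
    then have xy: "x \<in> M" "y = \<tau> x" "x' \<in> M" "y' = \<tau> x'" by auto
    show "(x \<oplus> x', y \<oplus> y') \<in> {(x, \<tau> x) |x. x \<in> M}" using R(7)[OF xy(1,3)] E(2)[OF xy(1,3)] xy by simp
    show "(x \<otimes> x', y \<otimes> y') \<in> {(x, \<tau> x) |x. x \<in> M}" using R(6)[OF xy(1,3)] E(3)[OF xy(1,3)] xy by simp
  qed
qed

lemma embedding_of_valued_graph:
  assumes g: "valued_graph g"
  shows "\<exists>\<tau>. embedding (Domain g) \<tau> \<and> (\<forall>x y. (x, y) \<in> g \<longleftrightarrow> x \<in> Domain g \<and> y = \<tau> x) \<and>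
    (\<forall>z\<in>Domain g. v (\<tau> z) = v z)"
proof -
  note G = valued_graphD[OF g]
  have single: "y = y'" if "(x, y) \<in> g" "(x, y') \<in> g" for x y y'
  proof -
    have "(x \<oplus> \<ominus> x, y \<oplus> \<ominus> y') \<in> g" using G(3)[OF that(1) G(5)[OF that(2)]] .
    then have "v (y \<oplus> \<ominus> y') = v \<zero>" using G(1,6) that by (metis r_neg)
    then have "y \<oplus> \<ominus> y' = \<zero>" using v_zero_iff G(1)[OF that(1)] G(1)[OF that(2)] by simp
    then show ?thesis using G(1) that by (metis minus_eq r_right_minus_eq)
  qed
  define \<tau> where "\<tau> x = (THE y. (x, y) \<in> g)" for x
  have t: "(x, y) \<in> g \<longleftrightarrow> x \<in> Domain g \<and> y = \<tau> x" for x y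
  proof
    assume "(x, y) \<in> g" then show "x \<in> Domain g \<and> y = \<tau> x" unfolding \<tau>_def using single by (auto intro!: the_equality[symmetric])
  next
    assume a: "x \<in> Domain g \<and> y = \<tau> x"
    then obtain y' where y': "(x, y') \<in> g" by blast
    then have "\<tau> x = y'" unfolding \<tau>_def using single by (auto intro!: the_equality)
    then show "(x, y) \<in> g" using a y' by simp
  qed
  have tt: "(x, \<tau> x) \<in> g" if "x \<in> Domain g" for x using t that by blast
  have sf: "subfield (Domain g) L"
  proof (rule subfieldI')
    show "subring (Domain g) L"
    proof (rule subringI)
      show "Domain g \<subseteq> carrier L" using G(1) by blast
      show "\<one> \<in> Domain g" using G(2) by blast
    qed (use G(3-5) in blast)+
    show "inv k \<in> Domain g" if "k \<in> Domain g - {\<zero>}" for k using that G(7) by blast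
  qed
  have "embedding (Domain g) \<tau>"
  proof (rule embeddingI[OF sf])
    show "\<tau> x \<in> carrier L" if "x \<in> Domain g" for x using G(1) tt[OF that] by blast
    have tD: "\<tau> x = y" if "(x, y) \<in> g" for x y using t that by simp
    show "\<tau> \<one> = \<one>" using tD[OF G(2)] .
    fix x y assume xy: "x \<in> Domain g" "y \<in> Domain g"
    show "\<tau> (x \<oplus> y) = \<tau> x \<oplus> \<tau> y" using tD[OF G(3)[OF tt[OF xy(1)] tt[OF xy(2)]]] .
    show "\<tau> (x \<otimes> y) = \<tau> x \<otimes> \<tau> y" using tD[OF G(4)[OF tt[OF xy(1)] tt[OF xy(2)]]] .
  qed
  moreover have "\<forall>z\<in>Domain g. v (\<tau> z) = v z" using G(6)[OF tt] by blast
  ultimately show ?thesis using t by blast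
qed

lemma valued_graph_Union:
  assumes "C \<noteq> {}" "subset.chain {g. valued_graph g} C" shows "valued_graph (\<Union>C)"
proof -
  have G: "valued_graph g" if "g \<in> C" for g using assms(2) that by (auto simp: subset.chain_def)
  have two: "\<exists>g\<in>C. a \<in> g \<and> b \<in> g" if ab: "a \<in> \<Union>C" "b \<in> \<Union>C" for a b
  proof -
    obtain g h where gh: "g \<in> C" "h \<in> C" "a \<in> g" "b \<in> h" using ab by blast
    then have "g \<subseteq> h \<or> h \<subseteq> g" using assms(2) by (auto simp: subset.chain_def)
    then show ?thesis using gh by blast
  qed
  show ?thesis unfolding valued_graph_def
  proof (intro conjI allI impI)
    show "\<Union>C \<subseteq> carrier L \<times> carrier L" using valued_graphD(1)[OF G] by fast
    show "(\<one>, \<one>) \<in> \<Union>C" using assms(1) valued_graphD(2)[OF G] by blast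
    fix x y x' y' assume a: "(x, y) \<in> \<Union>C \<and> (x', y') \<in> \<Union>C"
    then obtain g where g: "g \<in> C" "(x, y) \<in> g" "(x', y') \<in> g" using two by blast
    show "(x \<oplus> x', y \<oplus> y') \<in> \<Union>C" using valued_graphD(3)[OF G[OF g(1)] g(2,3)] g(1) by blast
    show "(x \<otimes> x', y \<otimes> y') \<in> \<Union>C" using valued_graphD(4)[OF G[OF g(1)] g(2,3)] g(1) by blast
  next
    fix x y assume "(x, y) \<in> \<Union>C"
    then obtain g where g: "g \<in> C" "(x, y) \<in> g" by blast
    show "(\<ominus> x, \<ominus> y) \<in> \<Union>C" "v y = v x" using valued_graphD(5,6)[OF G[OF g(1)] g(2)] g(1) by blast+
    show "(inv x, inv y) \<in> \<Union>C" if "x \<noteq> \<zero>" using valued_graphD(7)[OF G[OF g(1)] g(2) that] g(1) by blast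
  qed
qed

lemma valued_graph_step:
  assumes g: "valued_graph g" and x: "x \<in> carrier L" "algebraic (Domain g) x"
  obtains g' where "valued_graph g'" "g \<subseteq> g'" "x \<in> Domain g'"
proof -
  obtain \<tau> where t: "embedding (Domain g) \<tau>" "\<And>x y. (x, y) \<in> g \<longleftrightarrow> x \<in> Domain g \<and> y = \<tau> x"
    "\<And>z. z \<in> Domain g \<Longrightarrow> v (\<tau> z) = v z"
    using embedding_of_valued_graph[OF g] by blast
  let ?M = "Domain g"
  have M: "subfield ?M L" using embedding_subfield[OF t(1)] .
  obtain y where y: "y \<in> carrier L" "\<And>p. p \<in> carrier (?M[X]) \<Longrightarrow> v (eval (map \<tau> p) y) = v (eval p x)"
    using valued_extension_step[OF t(1,3) x] by blast
  have ec: "eval p x \<in> carrier L" "eval (map \<tau> p) y \<in> carrier L" if "p \<in> carrier (?M[X])" for p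
    using MX_eval(4)[OF M that that x(1)] eval_closed[OF embedding_poly(1)[OF t(1) that] y(1)] by auto
  have rel: "eval p x = \<zero> \<longleftrightarrow> eval (map \<tau> p) y = \<zero>" if "p \<in> carrier (?M[X])" for p
    using v_zero_iff[OF ec(1)[OF that]] v_zero_iff[OF ec(2)[OF that]] y(2)[OF that] by simp
  obtain \<tau>' where t': "embedding (adjoin L ?M {x}) \<tau>'" "\<And>z. z \<in> ?M \<Longrightarrow> \<tau>' z = \<tau> z" "\<tau>' x = y"
    "\<And>p. p \<in> carrier (?M[X]) \<Longrightarrow> \<tau>' (eval p x) = eval (map \<tau> p) y"
    using embedding_extend[OF t(1) x(1) y(1) rel] by metis
  have v': "v (\<tau>' z) = v z" if z: "z \<in> adjoin L ?M {x}" for z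
  proof -
    obtain p where p: "p \<in> carrier (?M[X])" "z = eval p x"
      using z unfolding adjoin_algebraic(1)[OF M x] simple_extension_as_eval_img[OF subfieldE(3)[OF M] x(1)] by blast
    show ?thesis using t'(4)[OF p(1)] y(2)[OF p(1)] p(2) by simp
  qed
  have A: "?M \<subseteq> adjoin L ?M {x}" "x \<in> adjoin L ?M {x}" using adjoin_simps[of ?M "{x}"] subfieldE(3)[OF M] x by auto
  show thesis
  proof (rule that[OF valued_graph_of_embedding[OF t'(1) v']])
    show "g \<subseteq> {(x', \<tau>' x') |x'. x' \<in> adjoin L ?M {x}}"
    proof
      fix c assume c: "c \<in> g"
      obtain z w where zw: "c = (z, w)" by fastforce
      then have "z \<in> ?M" "w = \<tau> z" using c t(2)[of z w] by auto
      then show "c \<in> {(x', \<tau>' x') |x'. x' \<in> adjoin L ?M {x}}" using A(1) t'(2) zw by auto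
    qed
    show "x \<in> Domain {(x', \<tau>' x') |x'. x' \<in> adjoin L ?M {x}}" using A(2) by blast
  qed
qed

end

context algebraically_closed
begin

lemma Gal_closure_iff:
  assumes F: "subfield F L"
  shows "\<rho> \<in> Gal_closure L F \<longleftrightarrow> embedding (alg_cl F) \<rho> \<and> bij_betw \<rho> (alg_cl F) (alg_cl F) \<and> (\<forall>x\<in>F. \<rho> x = x)"
proof -
  have N: "subfield (alg_cl F) L" using alg_cl_subfield(1)[OF F] .
  have NL: "alg_cl F \<subseteq> carrier L" using subfieldE(3)[OF N] .
  have "\<rho> \<in> ring_hom (L\<lparr>carrier := alg_cl F\<rparr>) (L\<lparr>carrier := alg_cl F\<rparr>) \<longleftrightarrow> embedding (alg_cl F) \<rho>"
    if b: "bij_betw \<rho> (alg_cl F) (alg_cl F)"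
  proof -
    have "\<rho> x \<in> alg_cl F" "\<rho> x \<in> carrier L" if "x \<in> alg_cl F" for x using b that NL by (auto simp: bij_betw_def)
    then show ?thesis using N unfolding embedding_def ring_hom_def by auto
  qed
  then show ?thesis unfolding Gal_closure_def ring_iso_def by auto
qed

lemma root_image:
  assumes F: "subfield F L" and emb: "embedding M \<tau>" and FM: "F \<subseteq> M" "\<And>c. c \<in> F \<Longrightarrow> \<tau> c = c"
    and p: "p \<in> carrier (F[X])" and x: "x \<in> M"
  shows "\<tau> (eval p x) = eval p (\<tau> x)"
proof -
  have pM: "p \<in> carrier (M[X])" using p FM(1) by (auto simp: univ_poly_carrier[symmetric] polynomial_def)
  have "map \<tau> p = p" using subfield_polyE(1)[OF F p] FM(2) by (auto intro: map_idI)
  then show ?thesis using embedding_poly(2)[OF emb pM x] by simp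
qed

lemma embedding_restrict:
  assumes "embedding M \<tau>" "subfield M' L" "M' \<subseteq> M" shows "embedding M' \<tau>"
  using embedding_simps[OF assms(1)] assms(3) by (intro embeddingI[OF assms(2)]) (auto simp: subset_iff)

text \<open>A self-embedding over \<open>F\<close> permutes the finitely many roots of each polynomial over \<open>F\<close>, so it is onto.\<close>

lemma Gal_closureI:
  assumes F: "subfield F L" and emb: "embedding M \<rho>" and ND: "alg_cl F \<subseteq> M" and fix_F: "\<And>c. c \<in> F \<Longrightarrow> \<rho> c = c"
  shows "\<rho> \<in> Gal_closure L F"
proof -
  have FD: "F \<subseteq> M" "\<And>c. c \<in> F \<Longrightarrow> \<rho> c = c" using ND alg_cl_subfield(2)[OF F] fix_F by auto
  have N: "subfield (alg_cl F) L" "F \<subseteq> alg_cl F" using alg_cl_subfield[OF F] .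
  have rootimg: "\<rho> (eval p x) = eval p (\<rho> x)" if "p \<in> carrier (F[X])" "x \<in> M" for p x
    using root_image[OF F emb FD(1) FD(2) that] .
  let ?Z = "\<lambda>x. {r \<in> carrier L. eval (Irr F x) r = \<zero>}"
  have Z: "finite (?Z x)" "?Z x \<subseteq> alg_cl F" "\<rho> ` ?Z x \<subseteq> ?Z x" "x \<in> ?Z x" if x: "x \<in> alg_cl F" for x
  proof -
    have xc: "x \<in> carrier L" "algebraic F x" using x by (auto simp: alg_cl_iff)
    note I = Irr_props[OF F xc]
    have "?Z x \<subseteq> {r. is_root (Irr F x) r}" using I(3) by (auto simp: is_root_def)
    then show "finite (?Z x)" using finite_number_of_roots[OF I(2)] finite_subset by blast
    show s: "?Z x \<subseteq> alg_cl F" using degree_Irr_le(1)[OF F _ I(1,3)] by (auto simp: alg_cl_iff)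
    show "\<rho> ` ?Z x \<subseteq> ?Z x"
    proof
      fix y assume "y \<in> \<rho> ` ?Z x"
      then obtain r' where r': "r' \<in> ?Z x" "y = \<rho> r'" by blast
      then have "r' \<in> M" using s ND by blast
      then have "eval (Irr F x) (\<rho> r') = \<zero>" "\<rho> r' \<in> carrier L"
        using rootimg[OF I(1), of r'] r'(1) embedding_simps(1)[OF emb, of r'] embedding_simps(5)[OF emb] by auto
      then show "y \<in> ?Z x" using r'(2) by simp
    qed
    show "x \<in> ?Z x" using xc I(4) by simp
  qed
  have "embedding (alg_cl F) \<rho>"
    using embedding_restrict[OF emb N(1) ND] .
  moreover have "bij_betw \<rho> (alg_cl F) (alg_cl F)"
  proof -
    have inj: "inj_on \<rho> (alg_cl F)" using embedding_simps(11)[OF emb] ND by (auto simp: inj_on_def)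
    have "\<rho> ` alg_cl F \<subseteq> alg_cl F" using Z(2,3,4) by blast
    moreover have "alg_cl F \<subseteq> \<rho> ` alg_cl F"
    proof
      fix x assume x: "x \<in> alg_cl F"
      have "\<rho> ` ?Z x = ?Z x"
        using endo_inj_surj[OF Z(1)[OF x] Z(3)[OF x]] inj Z(2)[OF x] inj_on_subset by blast
      then show "x \<in> \<rho> ` alg_cl F" using Z(2,4)[OF x] by blast
    qed
    ultimately show ?thesis using inj by (auto simp: bij_betw_def)
  qed
  ultimately show ?thesis using Gal_closure_iff[OF F] FD(2) by blast
qed

end

context valued_field
begin

text \<open>By Zorn there is a maximal value preserving extension; the extension step shows that its domain
  contains every algebraic element.\<close>

theorem extend_to_closure:
  assumes F: "subfield F L" and emb: "embedding M \<tau>" and FM: "F \<subseteq> M" "\<And>c. c \<in> F \<Longrightarrow> \<tau> c = c"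
    and vM: "\<And>z. z \<in> M \<Longrightarrow> v (\<tau> z) = v z"
  obtains \<rho> where "\<rho> \<in> Gal_closure L F" "\<And>z. z \<in> M \<Longrightarrow> z \<in> alg_cl F \<Longrightarrow> \<rho> z = \<tau> z" "\<And>z. z \<in> alg_cl F \<Longrightarrow> v (\<rho> z) = v z"
proof -
  let ?g0 = "{(x, \<tau> x) | x. x \<in> M}"
  let ?A = "{g. valued_graph g \<and> ?g0 \<subseteq> g}"
  have "\<exists>m\<in>?A. \<forall>g\<in>?A. m \<subseteq> g \<longrightarrow> g = m"
  proof (rule subset_Zorn_nonempty)
    show "?A \<noteq> {}" using valued_graph_of_embedding[OF emb vM] by blast
    fix C assume C: "C \<noteq> {}" "subset.chain ?A C"
    then have "subset.chain {g. valued_graph g} C" by (auto simp: subset.chain_def)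
    then have "valued_graph (\<Union>C)" using valued_graph_Union C(1) by blast
    moreover have "?g0 \<subseteq> \<Union>C" using C unfolding subset.chain_def by blast
    ultimately show "\<Union>C \<in> ?A" by blast
  qed
  then obtain g where gA: "g \<in> ?A" "\<forall>h\<in>?A. g \<subseteq> h \<longrightarrow> h = g" by (rule bexE)
  have g: "valued_graph g" "?g0 \<subseteq> g" using gA(1) by simp_all
  have g_max: "g' = g" if "valued_graph g'" "g \<subseteq> g'" for g'
  proof -
    have "g' \<in> ?A" using that g(2) by (simp add: subset_trans[OF g(2) that(2)])
    then show ?thesis using gA(2) that(2) by blast
  qed
  obtain \<rho> where r: "embedding (Domain g) \<rho>" "\<And>x y. (x, y) \<in> g \<longleftrightarrow> x \<in> Domain g \<and> y = \<rho> x"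
    "\<And>z. z \<in> Domain g \<Longrightarrow> v (\<rho> z) = v z"
    using embedding_of_valued_graph[OF g(1)] by blast
  have MD: "M \<subseteq> Domain g" "\<And>z. z \<in> M \<Longrightarrow> \<rho> z = \<tau> z"
  proof -
    have "(z, \<tau> z) \<in> g" if "z \<in> M" for z using g(2) that by auto
    then have "z \<in> Domain g \<and> \<tau> z = \<rho> z" if "z \<in> M" for z using r(2)[of z "\<tau> z"] that by simp
    then show "M \<subseteq> Domain g" "\<And>z. z \<in> M \<Longrightarrow> \<rho> z = \<tau> z" by auto
  qed
  have FD: "F \<subseteq> Domain g" "\<And>c. c \<in> F \<Longrightarrow> \<rho> c = c" using MD FM by auto
  have ND: "alg_cl F \<subseteq> Domain g"
  proof
    fix x assume x: "x \<in> alg_cl F"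
    then have "x \<in> carrier L" "algebraic (Domain g) x" using alg_mono[OF FD(1)] by (auto simp: alg_cl_iff)
    then obtain g' where "valued_graph g'" "g \<subseteq> g'" "x \<in> Domain g'" using valued_graph_step[OF g(1)] by blast
    then show "x \<in> Domain g" using g_max[of g'] by simp
  qed
  have "\<rho> \<in> Gal_closure L F" using Gal_closureI[OF F r(1) ND FD(2)] .
  then show thesis using that MD(2) r(3) ND by blast
qed

end

text \<open>The trivial valuation turns the extension theorem into the purely algebraic one.\<close>

context algebraically_closed
begin

lemma extend_to_closure_plain:
  assumes F: "subfield F L" and emb: "embedding M \<tau>" and FM: "F \<subseteq> M" "\<And>c. c \<in> F \<Longrightarrow> \<tau> c = c"
  obtains \<rho> where "\<rho> \<in> Gal_closure L F" "\<And>z. z \<in> M \<Longrightarrow> z \<in> alg_cl F \<Longrightarrow> \<rho> z = \<tau> z"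
proof -
  define v :: "'a \<Rightarrow> int extended" where "v x = (if x = \<zero> then Pinf else Fin 0)" for x
  have "krull_valuation L v"
    unfolding krull_valuation_def v_def using integral by auto
  then interpret V: valued_field L v by unfold_locales
  have "v (\<tau> z) = v z" if "z \<in> M" for z using embedding_simps(5,8)[OF emb] that by (auto simp: v_def)
  then show thesis using V.extend_to_closure[OF F emb FM] that by metis
qed

lemma conjugate_exists:
  assumes F: "subfield F L" and x: "x \<in> alg_cl F" and r: "r \<in> carrier L" "eval (Irr F x) r = \<zero>"
  obtains \<rho> where "\<rho> \<in> Gal_closure L F" "\<rho> x = r"
proof -
  have xc: "x \<in> carrier L" "algebraic F x" using x by (auto simp: alg_cl_iff)
  have id: "embedding F (\<lambda>x. x)" using embedding_id[OF F] .
  have r': "eval (map (\<lambda>x. x) (Irr F x)) r = \<zero>" using r(2) by simp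
  obtain \<tau> where t: "embedding (adjoin L F {x}) \<tau>" "\<And>z. z \<in> F \<Longrightarrow> \<tau> z = z" "\<tau> x = r"
    using embedding_extend[OF id xc(1) r(1) root_of_Irr_relations[OF id xc r(1) r']] by metis
  have A: "F \<subseteq> adjoin L F {x}" "x \<in> adjoin L F {x}" using adjoin_simps[of F "{x}"] subfieldE(3)[OF F] xc by auto
  show thesis using extend_to_closure_plain[OF F t(1) A(1) t(2)] A(2) x t(3) that by metis
qed

end

section \<open>Henselizations\<close>

context algebraically_closed
begin

lemma alg_cl_eq:
  assumes F: "subfield F L" and M: "subfield M L" and FM: "F \<subseteq> M" "M \<subseteq> alg_cl F"
  shows "alg_cl M = alg_cl F"
proof
  show "alg_cl F \<subseteq> alg_cl M" using alg_cl_mono[OF FM(1)] .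
  show "alg_cl M \<subseteq> alg_cl F"
  proof
    fix x assume "x \<in> alg_cl M"
    then have x: "x \<in> carrier L" "algebraic M x" by (auto simp: alg_cl_iff)
    note I = Irr_props[OF M x]
    have "Irr M x \<in> carrier ((alg_cl F)[X])"
      using I(1) FM(2) by (auto simp: univ_poly_carrier[symmetric] polynomial_def)
    then show "x \<in> alg_cl F" using alg_cl_root[OF F _ I(3) x(1) I(4)] by blast
  qed
qed

lemma Gal_closureD:
  assumes "subfield F L" "\<rho> \<in> Gal_closure L F"
  shows "embedding (alg_cl F) \<rho>" "x \<in> F \<Longrightarrow> \<rho> x = x" "x \<in> alg_cl F \<Longrightarrow> \<rho> x \<in> alg_cl F"
    "p \<in> carrier (F[X]) \<Longrightarrow> x \<in> alg_cl F \<Longrightarrow> \<rho> (eval p x) = eval p (\<rho> x)"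
proof -
  note G = Gal_closure_iff[OF assms(1), THEN iffD1, OF assms(2)]
  show e: "embedding (alg_cl F) \<rho>" and f: "x \<in> F \<Longrightarrow> \<rho> x = x" for x using G by auto
  show "x \<in> alg_cl F \<Longrightarrow> \<rho> x \<in> alg_cl F" using G by (auto simp: bij_betw_def)
  show "p \<in> carrier (F[X]) \<Longrightarrow> x \<in> alg_cl F \<Longrightarrow> \<rho> (eval p x) = eval p (\<rho> x)"
    using root_image[OF assms(1) e alg_cl_subfield(2)[OF assms(1)] f] by blast
qed

lemma Gal_closure_mono:
  assumes F: "subfield F L" and M: "subfield M L" and FM: "F \<subseteq> M" "M \<subseteq> alg_cl F"
  shows "Gal_closure L M \<subseteq> Gal_closure L F"
proof
  fix \<rho> assume "\<rho> \<in> Gal_closure L M"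
  then have "embedding (alg_cl F) \<rho> \<and> bij_betw \<rho> (alg_cl F) (alg_cl F) \<and> (\<forall>x\<in>M. \<rho> x = x)"
    unfolding Gal_closure_iff[OF M] alg_cl_eq[OF assms] .
  then show "\<rho> \<in> Gal_closure L F" unfolding Gal_closure_iff[OF F] using FM(1) by blast
qed

lemma Gal_closure_comp:
  assumes F: "subfield F L" and s: "\<sigma>' \<in> Gal_closure L F" and t: "\<tau> \<in> Gal_closure L F"
  shows "\<sigma>' \<circ> \<tau> \<in> Gal_closure L F"
proof -
  note S = Gal_closure_iff[OF F, THEN iffD1, OF s] and T = Gal_closure_iff[OF F, THEN iffD1, OF t]
  note C = Gal_closureD(3)[OF F t]
  have "embedding (alg_cl F) (\<sigma>' \<circ> \<tau>)"
  proof (rule embeddingI[OF alg_cl_subfield(1)[OF F]])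
    note E1 = embedding_simps[OF Gal_closureD(1)[OF F s]] and E2 = embedding_simps[OF Gal_closureD(1)[OF F t]]
    show "(\<sigma>' \<circ> \<tau>) x \<in> carrier L" if "x \<in> alg_cl F" for x using E1(1) C that by simp
    show "(\<sigma>' \<circ> \<tau>) \<one> = \<one>" using E1(4) E2(4) by simp
    show "(\<sigma>' \<circ> \<tau>) (x \<oplus> y) = (\<sigma>' \<circ> \<tau>) x \<oplus> (\<sigma>' \<circ> \<tau>) y" if "x \<in> alg_cl F" "y \<in> alg_cl F" for x y
      using E1(2) E2(2) C that by simp
    show "(\<sigma>' \<circ> \<tau>) (x \<otimes> y) = (\<sigma>' \<circ> \<tau>) x \<otimes> (\<sigma>' \<circ> \<tau>) y" if "x \<in> alg_cl F" "y \<in> alg_cl F" for x y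
      using E1(3) E2(3) C that by simp
  qed
  then show ?thesis unfolding Gal_closure_iff[OF F] using S T bij_betw_trans by auto
qed

lemma id_Gal_closure: "subfield F L \<Longrightarrow> id \<in> Gal_closure L F"
  using embedding_id[OF alg_cl_subfield(1)] by (auto simp: Gal_closure_iff id_def bij_betw_def)

lemma product_of_linear_factors:
  assumes N: "subfield N L" and S: "finite S" "S \<subseteq> N"
  defines "P \<equiv> \<lambda>S. finprod (poly_ring L) (\<lambda>s. [\<one>, \<ominus> s]) S"
  shows "P S \<in> carrier (N[X])" "r \<in> carrier L \<Longrightarrow> eval (P S) r = \<zero> \<longleftrightarrow> r \<in> S"
    "embedding N \<tau> \<Longrightarrow> map \<tau> (P S) = finprod (poly_ring L) (\<lambda>s. [\<one>, \<ominus> (\<tau> s)]) S"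
proof -
  interpret PX: domain "poly_ring L" using univ_poly_is_domain[OF carrier_is_subring] .
  have NL: "N \<subseteq> carrier L" using subfieldE(3)[OF N] .
  have lin: "[\<one>, \<ominus> s] \<in> carrier (N[X])" if "s \<in> N" for s
    using that subringE(3,5)[OF subfieldE(1)[OF N]] by (auto simp: univ_poly_carrier[symmetric] polynomial_def)
  have "P S \<in> carrier (N[X]) \<and> (\<forall>r\<in>carrier L. eval (P S) r = \<zero> \<longleftrightarrow> r \<in> S) \<and>
     (\<forall>\<tau>. embedding N \<tau> \<longrightarrow> map \<tau> (P S) = finprod (poly_ring L) (\<lambda>s. [\<one>, \<ominus> (\<tau> s)]) S)"
    using S
  proof (induct S)
    case empty
    have "[\<one>] \<in> carrier (N[X])"
      using subringE(3)[OF subfieldE(1)[OF N]] by (auto simp: univ_poly_carrier[symmetric] polynomial_def)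
    then show ?case using embedding_simps(4) by (auto simp: P_def univ_poly_one)
  next
    case (insert s S)
    have IH: "P S \<in> carrier (N[X])" "\<And>r. r \<in> carrier L \<Longrightarrow> eval (P S) r = \<zero> \<longleftrightarrow> r \<in> S"
      "\<And>\<tau>. embedding N \<tau> \<Longrightarrow> map \<tau> (P S) = finprod (poly_ring L) (\<lambda>s. [\<one>, \<ominus> (\<tau> s)]) S" using insert by auto
    have s: "s \<in> N" "s \<in> carrier L" using insert NL by auto
    have fc: "(\<lambda>s. [\<one>, \<ominus> s]) \<in> insert s S \<rightarrow> carrier (poly_ring L)" using linear_poly insert NL by auto
    have e: "P (insert s S) = [\<one>, \<ominus> s] \<otimes>\<^bsub>N[X]\<^esub> P S"
      unfolding P_def poly_mult_shell[where M = N] using insert fc by (subst PX.finprod_insert) auto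
    have "P (insert s S) \<in> carrier (N[X])" unfolding e using MX_closed(1)[OF N lin[OF s(1)] IH(1)] .
    moreover have "eval (P (insert s S)) r = \<zero> \<longleftrightarrow> r \<in> insert s S" if r: "r \<in> carrier L" for r
    proof -
      have c: "r \<ominus> s \<in> carrier L" "eval (P S) r \<in> carrier L" using r s MX_eval(4)[OF N IH(1) IH(1) r] by auto
      have "eval (P (insert s S)) r = (r \<ominus> s) \<otimes> eval (P S) r"
        unfolding e using MX_eval(1)[OF N lin[OF s(1)] IH(1) r] eval_linear[OF s(2) r] by simp
      then have "eval (P (insert s S)) r = \<zero> \<longleftrightarrow> r \<ominus> s = \<zero> \<or> eval (P S) r = \<zero>"
        using integral_iff[OF c] by simp
      then show ?thesis using IH(2)[OF r] r s by (simp add: r_right_minus_eq)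
    qed
    moreover have "map \<tau> (P (insert s S)) = finprod (poly_ring L) (\<lambda>s. [\<one>, \<ominus> (\<tau> s)]) (insert s S)" if t: "embedding N \<tau>" for \<tau>
    proof -
      have "map \<tau> (P (insert s S)) = map \<tau> [\<one>, \<ominus> s] \<otimes>\<^bsub>poly_ring L\<^esub> map \<tau> (P S)"
        unfolding e using embedding_poly(4)[OF t lin[OF s(1)] IH(1)] .
      moreover have "map \<tau> [\<one>, \<ominus> s] = [\<one>, \<ominus> (\<tau> s)]" using embedding_simps(4,6)[OF t] s(1) by simp
      moreover have "(\<lambda>s. [\<one>, \<ominus> (\<tau> s)]) \<in> insert s S \<rightarrow> carrier (poly_ring L)"
        using linear_poly insert embedding_simps(1)[OF t] by (auto intro!: linear_poly)
      ultimately show ?thesis using IH(3)[OF t] insert by (subst PX.finprod_insert) auto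
    qed
    ultimately show ?case by blast
  qed
  then show "P S \<in> carrier (N[X])" "r \<in> carrier L \<Longrightarrow> eval (P S) r = \<zero> \<longleftrightarrow> r \<in> S"
    "embedding N \<tau> \<Longrightarrow> map \<tau> (P S) = finprod (poly_ring L) (\<lambda>s. [\<one>, \<ominus> (\<tau> s)]) S" by auto
qed

text \<open>Galois theory in a pointwise form: over the field fixed by a monoid \<open>G\<close> of automorphisms, all conjugates
  of an element lie in its \<open>G\<close>-orbit, because \<open>\<Prod>(t - s)\<close>, with \<open>s\<close> in the orbit, has fixed coefficients. Of the
  fixed elements only the separable ones are assumed to be fixed by \<open>\<rho>\<close>; this suffices because a power of
  each coefficient is separable and taking this power is injective.\<close>

lemma conjugates_over_fixed_field:
  assumes F: "subfield F L" and G: "G \<subseteq> Gal_closure L F" "id \<in> G" "\<And>g h. g \<in> G \<Longrightarrow> h \<in> G \<Longrightarrow> g \<circ> h \<in> G"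
    and rho: "\<rho> \<in> Gal_closure L F" "\<And>y. y \<in> sep_cl F \<Longrightarrow> (\<And>g. g \<in> G \<Longrightarrow> g y = y) \<Longrightarrow> \<rho> y = y"
    and x: "x \<in> alg_cl F"
  obtains g where "g \<in> G" "\<rho> x = g x"
proof -
  let ?N = "alg_cl F"
  have N: "subfield ?N L" using alg_cl_subfield(1)[OF F] .
  have xc: "x \<in> carrier L" "algebraic F x" using x by (auto simp: alg_cl_iff)
  note I = Irr_props[OF F xc]
  define S where "S = (\<lambda>g. g x) ` G"
  have SN: "S \<subseteq> ?N" using Gal_closureD(3)[OF F] G(1) x by (auto simp: S_def)
  have "S \<subseteq> {r. is_root (Irr F x) r}"
  proof
    fix s assume "s \<in> S"
    then obtain g where g: "g \<in> G" "s = g x" by (auto simp: S_def)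
    then have gg: "g \<in> Gal_closure L F" using G(1) by blast
    have "eval (Irr F x) s = \<zero>"
      using Gal_closureD(4)[OF F gg I(1) x] I(4) g(2) embedding_simps(5)[OF Gal_closureD(1)[OF F gg]] by simp
    then show "s \<in> {r. is_root (Irr F x) r}" using SN \<open>s \<in> S\<close> I(3) by (auto simp: is_root_def alg_cl_iff)
  qed
  then have fS: "finite S" using finite_number_of_roots[OF I(2)] finite_subset by blast
  define P where "P = finprod (poly_ring L) (\<lambda>s. [\<one>, \<ominus> s]) S"
  note PP = product_of_linear_factors[OF N fS SN, folded P_def]
  have fixG: "map g P = P" if g: "g \<in> G" for g
  proof -
    have gg: "g \<in> Gal_closure L F" using G(1) g by blast
    note E = Gal_closureD(1)[OF F gg]
    have inj: "inj_on g S" using embedding_simps(11)[OF E] SN by (auto simp: inj_on_def)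
    have "g ` S \<subseteq> S"
    proof
      fix z assume "z \<in> g ` S"
      then obtain h where "h \<in> G" "z = g (h x)" by (auto simp: S_def)
      then show "z \<in> S" using G(3)[OF g, of h] unfolding S_def by (metis comp_apply image_eqI)
    qed
    then have gS: "g ` S = S" using endo_inj_surj[OF fS _ inj] by blast
    interpret PX: domain "poly_ring L" using univ_poly_is_domain[OF carrier_is_subring] .
    have "P = finprod (poly_ring L) (\<lambda>s. [\<one>, \<ominus> s]) (g ` S)" unfolding gS P_def ..
    also have "\<dots> = finprod (poly_ring L) (\<lambda>s. [\<one>, \<ominus> (g s)]) S"
      using inj SN gS subfieldE(3)[OF N] linear_poly by (subst PX.finprod_reindex) (auto intro!: linear_poly)
    finally show ?thesis using PP(3)[OF E] by simp
  qed
  note R = Gal_closureD(1)[OF F rho(1)]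
  have "\<rho> c = c" if c: "c \<in> set P" for c
  proof -
    have cN: "c \<in> ?N" using subfield_polyE(1)[OF N PP(1)] c by blast
    then have cL: "c \<in> carrier L" by (simp add: alg_cl_iff)
    have gc: "g c = c" if "g \<in> G" for g using fixG[OF that] c by (metis map_eq_conv list.map_ident)
    obtain q where q: "c [^] (q::nat) \<in> sep_cl F" "\<And>u w. u \<in> carrier L \<Longrightarrow> w \<in> carrier L \<Longrightarrow> u [^] q = w [^] q \<Longrightarrow> u = w"
      using power_in_sep_cl[OF F cN] by metis
    have "\<rho> (c [^] q) = c [^] q"
    proof (rule rho(2)[OF q(1)])
      fix g assume g: "g \<in> G"
      then have "g (c [^] q) = g c [^] q" using embedding_simps(10)[OF Gal_closureD(1)[OF F]] G(1) cN by blast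
      then show "g (c [^] q) = c [^] q" using gc[OF g] by simp
    qed
    then have "\<rho> c [^] q = c [^] q" using embedding_simps(10)[OF R cN] by simp
    then show ?thesis using q(2) embedding_simps(1)[OF R cN] cL by blast
  qed
  then have "map \<rho> P = P" by (simp add: map_idI)
  moreover have "x \<in> S" unfolding S_def using G(2) by (metis id_apply image_eqI)
  then have "eval P x = \<zero>" using PP(2)[OF xc(1)] by simp
  ultimately have "eval P (\<rho> x) = \<zero>"
    using embedding_poly(2)[OF R PP(1) x] embedding_simps(5)[OF R] by simp
  then have "\<rho> x \<in> S" using PP(2)[OF embedding_simps(1)[OF R x]] by simp
  then show thesis using that by (auto simp: S_def)
qed

end

context valued_field
begin

text \<open>Automorphisms preserving the value on the whole algebraic closure. They have the same restrictions to
  the separable closure as the decomposition group.\<close>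

definition value_automorphisms :: "'a set \<Rightarrow> ('a \<Rightarrow> 'a) set" where
  "value_automorphisms F = {\<rho> \<in> Gal_closure L F. \<forall>x\<in>alg_cl F. v (\<rho> x) = v x}"

abbreviation hens :: "'a set \<Rightarrow> 'a set" where "hens F \<equiv> henselization L v F"

lemma value_automorphismsD:
  assumes "\<rho> \<in> value_automorphisms F" shows "\<rho> \<in> Gal_closure L F" "x \<in> alg_cl F \<Longrightarrow> v (\<rho> x) = v x"
  using assms by (auto simp: value_automorphisms_def)

lemma value_automorphisms_comp:
  assumes "subfield F L" "\<rho> \<in> value_automorphisms F" "\<rho>' \<in> value_automorphisms F"
  shows "\<rho> \<circ> \<rho>' \<in> value_automorphisms F"
  using assms Gal_closure_comp[OF assms(1)] Gal_closureD(3)[OF assms(1)]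
  by (auto simp: value_automorphisms_def)

lemma id_value_automorphisms: "subfield F L \<Longrightarrow> id \<in> value_automorphisms F"
  using id_Gal_closure by (auto simp: value_automorphisms_def)

text \<open>The restriction of an element of the decomposition group to the separable closure extends to a value
  preserving automorphism of the whole algebraic closure.\<close>

lemma hens_iff:
  assumes F: "subfield F L"
  shows "x \<in> hens F \<longleftrightarrow> x \<in> sep_cl F \<and> (\<forall>\<rho>\<in>value_automorphisms F. \<rho> x = x)"
proof
  assume "x \<in> hens F"
  then show "x \<in> sep_cl F \<and> (\<forall>\<rho>\<in>value_automorphisms F. \<rho> x = x)"
    using sep_cl_subfield(3)[OF F]
    by (auto simp: henselization_def decomposition_group_def value_automorphisms_def)
next
  assume h: "x \<in> sep_cl F \<and> (\<forall>\<rho>\<in>value_automorphisms F. \<rho> x = x)"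
  note S = sep_cl_subfield[OF F]
  have "\<tau> x = x" if t: "\<tau> \<in> decomposition_group L v F" for \<tau>
  proof -
    have tg: "\<tau> \<in> Gal_closure L F" and tv: "\<And>z. z \<in> sep_cl F \<Longrightarrow> v (\<tau> z) = v z"
      using t by (auto simp: decomposition_group_def)
    have "embedding (sep_cl F) \<tau>" using embedding_restrict[OF Gal_closureD(1)[OF F tg] S(1,3)] .
    then obtain \<rho> where "\<rho> \<in> Gal_closure L F" "\<And>z. z \<in> sep_cl F \<Longrightarrow> z \<in> alg_cl F \<Longrightarrow> \<rho> z = \<tau> z"
      "\<And>z. z \<in> alg_cl F \<Longrightarrow> v (\<rho> z) = v z"
      using extend_to_closure[OF F _ S(2) Gal_closureD(2)[OF F tg] tv] by metis
    moreover from this have "\<rho> \<in> value_automorphisms F" by (simp add: value_automorphisms_def)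
    ultimately show ?thesis using h S(3) by (metis subsetD)
  qed
  then show "x \<in> hens F" using h by (auto simp: henselization_def)
qed

lemma hens_subfield:
  assumes F: "subfield F L"
  shows "subfield (hens F) L" "F \<subseteq> hens F" "hens F \<subseteq> sep_cl F" "hens F \<subseteq> alg_cl F"
proof -
  note S = sep_cl_subfield[OF F]
  show sub: "hens F \<subseteq> sep_cl F" using hens_iff[OF F] by blast
  show "hens F \<subseteq> alg_cl F" using sub S(3) by blast
  have gal: "\<rho> \<in> Gal_closure L F" if "\<rho> \<in> value_automorphisms F" for \<rho> using value_automorphismsD(1)[OF that] .
  show "F \<subseteq> hens F" using S(2) Gal_closureD(2)[OF F gal] hens_iff[OF F] by blast
  have E: "embedding (sep_cl F) \<rho>" if "\<rho> \<in> value_automorphisms F" for \<rho>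
    using embedding_restrict[OF Gal_closureD(1)[OF F gal[OF that]] S(1,3)] .
  have L: "hens F \<subseteq> carrier L" using sub subfieldE(3)[OF S(1)] by blast
  note R = subringE[OF subfieldE(1)[OF S(1)]]
  have hI: "z \<in> hens F" if "z \<in> sep_cl F" "\<And>\<rho>. \<rho> \<in> value_automorphisms F \<Longrightarrow> \<rho> z = z" for z
    using that hens_iff[OF F] by blast
  have hD: "z \<in> sep_cl F" "\<And>\<rho>. \<rho> \<in> value_automorphisms F \<Longrightarrow> \<rho> z = z" if "z \<in> hens F" for z
    using that hens_iff[OF F] by auto
  show "subfield (hens F) L"
  proof (rule subfieldI')
    show "subring (hens F) L"
    proof (rule subringI[OF L])
      show "\<one> \<in> hens F" by (rule hI[OF R(3)]) (rule embedding_simps(4)[OF E])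
      fix x assume x: "x \<in> hens F"
      show "\<ominus> x \<in> hens F"
        by (rule hI[OF R(5)[OF hD(1)[OF x]]]) (simp add: embedding_simps(6)[OF E hD(1)[OF x]] hD(2)[OF x])
      fix y assume y: "y \<in> hens F"
      show "x \<otimes> y \<in> hens F"
        by (rule hI[OF R(6)[OF hD(1)[OF x] hD(1)[OF y]]])
          (simp add: embedding_simps(3)[OF E hD(1)[OF x] hD(1)[OF y]] hD(2)[OF x] hD(2)[OF y])
      show "x \<oplus> y \<in> hens F"
        by (rule hI[OF R(7)[OF hD(1)[OF x] hD(1)[OF y]]])
          (simp add: embedding_simps(2)[OF E hD(1)[OF x] hD(1)[OF y]] hD(2)[OF x] hD(2)[OF y])
    qed
    fix x assume "x \<in> hens F - {\<zero>}"
    then have x: "x \<in> hens F" "x \<noteq> \<zero>" by auto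
    show "inv x \<in> hens F"
    proof (rule hI)
      show "inv x \<in> sep_cl F" using subfield_m_inv(1)[OF S(1), of x] hD(1)[OF x(1)] x(2) by blast
      show "\<rho> (inv x) = inv x" if "\<rho> \<in> value_automorphisms F" for \<rho>
        using embedding_simps(9)[OF E[OF that] hD(1)[OF x(1)] x(2)] hD(2)[OF x(1) that] by simp
    qed
  qed
qed

text \<open>A henselization is henselian: an automorphism over it sends each element to an image under some
  value preserving automorphism.\<close>

lemma hens_henselian:
  assumes F: "subfield F L" and r: "\<rho> \<in> Gal_closure L F" "\<And>x. x \<in> hens F \<Longrightarrow> \<rho> x = x" and z: "z \<in> alg_cl F"
  shows "v (\<rho> z) = v z"
proof -
  obtain g where "g \<in> value_automorphisms F" "\<rho> z = g z"
  proof (rule conjugates_over_fixed_field[OF F _ _ _ r(1) _ z, of "value_automorphisms F"])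
    show "\<rho> y = y" if "y \<in> sep_cl F" "\<And>g. g \<in> value_automorphisms F \<Longrightarrow> g y = y" for y
      using that r(2) hens_iff[OF F] by blast
  qed (use value_automorphismsD(1) id_value_automorphisms[OF F] value_automorphisms_comp[OF F] in blast)+
  then show ?thesis using value_automorphismsD(2) z by simp
qed

lemma hens_mono:
  assumes F: "subfield F L" and M: "subfield M L" and FM: "F \<subseteq> M" "M \<subseteq> alg_cl F"
  shows "hens F \<subseteq> hens M"
proof
  fix x assume "x \<in> hens F"
  then have x: "x \<in> sep_cl F" "\<And>\<rho>. \<rho> \<in> value_automorphisms F \<Longrightarrow> \<rho> x = x" using hens_iff[OF F] by auto
  have "value_automorphisms M \<subseteq> value_automorphisms F"
    using Gal_closure_mono[OF assms] alg_cl_eq[OF assms] by (auto simp: value_automorphisms_def)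
  then show "x \<in> hens M" using x sep_cl_base_mono[OF F M FM(1)] hens_iff[OF M] by blast
qed

text \<open>An automorphism over \<open>H(a)\<close> preserves the value by assumption, hence fixes each element of the henselization
  of \<open>F(a)\<close>; these elements are separable and have no other conjugate over \<open>H(a)\<close>.\<close>

lemma hens_adjoin:
  assumes F: "subfield F L" and a: "a \<in> alg_cl F" and H: "subfield H L" "F \<subseteq> H" "H \<subseteq> hens (adjoin L F {a})"
    and val: "\<And>\<rho> z. \<rho> \<in> Gal_closure L F \<Longrightarrow> (\<And>h. h \<in> H \<Longrightarrow> \<rho> h = h) \<Longrightarrow> z \<in> alg_cl F \<Longrightarrow> v (\<rho> z) = v z"
  shows "hens (adjoin L F {a}) = adjoin L H {a}"
proof
  have FL: "F \<subseteq> carrier L" "H \<subseteq> carrier L" using subfieldE(3)[OF F] subfieldE(3)[OF H(1)] by auto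
  have ac: "{a} \<subseteq> carrier L" using a by (simp add: alg_cl_iff)
  let ?Fa = "adjoin L F {a}" and ?Ha = "adjoin L H {a}"
  note Fa = adjoin_simps[OF FL(1) ac] and Ha = adjoin_simps[OF FL(2) ac]
  note h = hens_subfield[OF Fa(1)]
  have FaN: "?Fa \<subseteq> alg_cl F" using adjoin_alg_cl[OF F, of "{a}"] a by blast
  note eq = alg_cl_eq[OF F Fa(1,2) FaN]
  have HN: "H \<subseteq> alg_cl F" using H(3) h(4) eq by blast
  have HaN: "?Ha \<subseteq> alg_cl F" using Ha(4)[OF alg_cl_subfield(1)[OF F] HN] a by simp
  have FHa: "F \<subseteq> ?Ha" using H(2) Ha(2) by blast
  have FaHa: "?Fa \<subseteq> ?Ha" using Fa(4)[OF Ha(1) FHa Ha(3)] .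
  note eq' = alg_cl_eq[OF F Ha(1) FHa HaN]
  show "?Ha \<subseteq> hens ?Fa" using Ha(4)[OF h(1) H(3)] Fa(3) h(2) by blast
  show "hens ?Fa \<subseteq> ?Ha"
  proof
    fix x assume "x \<in> hens ?Fa"
    then have x: "x \<in> sep_cl ?Fa" "\<And>\<rho>. \<rho> \<in> value_automorphisms ?Fa \<Longrightarrow> \<rho> x = x" using hens_iff[OF Fa(1)] by auto
    then have xa: "x \<in> alg_cl ?Fa" "x \<in> carrier L" "algebraic ?Fa x" by (auto simp: rel_sep_closure_def alg_cl_iff)
    note D = Irr_dvd_mono[OF Fa(1) Ha(1) FaHa xa(2,3)]
    show "x \<in> ?Ha"
    proof (rule single_root_imp_mem[OF Ha(1) xa(2) D(1)])
      have "alg_mult (Irr ?Fa x) x \<le> 1" using x(1) xa(2) by (auto simp: rel_sep_closure_def)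
      then show "alg_mult (Irr ?Ha x) x \<le> 1" using D(3)[of x] by simp
      fix r assume r: "r \<in> carrier L" "eval (Irr ?Ha x) r = \<zero>"
      have xHa: "x \<in> alg_cl ?Ha" using eq eq' xa(1) by simp
      obtain \<rho> where rho: "\<rho> \<in> Gal_closure L ?Ha" "\<rho> x = r" using conjugate_exists[OF Ha(1) xHa r] by metis
      have rF: "\<rho> \<in> Gal_closure L F" using Gal_closure_mono[OF F Ha(1) FHa HaN] rho(1) by blast
      have fx: "\<rho> c = c" if "c \<in> ?Ha" for c using Gal_closureD(2)[OF Ha(1) rho(1) that] .
      have "\<rho> \<in> Gal_closure L ?Fa"
        using Gal_closure_iff[OF F, THEN iffD1, OF rF] fx FaHa unfolding Gal_closure_iff[OF Fa(1)] eq by blast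
      moreover have "v (\<rho> z) = v z" if "z \<in> alg_cl ?Fa" for z
        using val[OF rF] fx Ha(2) that eq by blast
      ultimately have "\<rho> \<in> value_automorphisms ?Fa" unfolding value_automorphisms_def by blast
      from x(2)[OF this] show "r = x" using rho(2) by simp
    qed
  qed
qed

subsection \<open>Henselizations are immediate\<close>

text \<open>If \<open>y\<close> is a simple root of its minimal polynomial \<open>(t - y) Q\<close> and no other root has the value of \<open>y\<close>, then
  \<open>Q\<close> has a single dominant term at \<open>y\<close>; so exactly two neighbouring terms of the minimal polynomial
  carry the least value at \<open>y\<close>, and the linear equation they form approximates \<open>y\<close>.\<close>

lemma approximation_isolated_root:
  assumes F: "subfield F L" and y: "y \<in> carrier L" "algebraic F y" "y \<noteq> \<zero>" and mult: "alg_mult (Irr F y) y \<le> 1"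
    and iso: "\<And>r. r \<in> carrier L \<Longrightarrow> eval (Irr F y) r = \<zero> \<Longrightarrow> r \<noteq> y \<Longrightarrow> v r \<noteq> v y"
  shows "\<exists>u\<in>F. v y < v (y \<ominus> u)"
proof -
  let ?P = "Irr F y"
  note I = Irr_props[OF F y(1,2)]
  have "[\<one>, \<ominus> y] pdivides ?P" using is_root_imp_pdivides[OF I(2)] I(3,4) y(1) by (auto simp: is_root_def)
  then obtain Q where Q: "Q \<in> carrier (poly_ring L)" "?P = [\<one>, \<ominus> y] \<otimes>\<^bsub>poly_ring L\<^esub> Q"
    unfolding pdivides_def factor_def by blast
  interpret PX: domain "poly_ring L" using univ_poly_is_domain[OF carrier_is_subring] .
  note lp = linear_poly[OF y(1)]
  have Qn: "Q \<noteq> []" using Q(2) I(3) PX.r_null[OF lp] by (auto simp: univ_poly_zero)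
  have rP: "roots ?P = add_mset y (roots Q)"
    using poly_mult_degree_one_monic_imp_same_roots[OF y(1) Q(1) Qn] Q(2) by simp
  have "count (roots ?P) y \<le> 1" using mult alg_mult_eq_count_roots[OF I(2)] by simp
  then have "y \<notin># roots Q" unfolding rP by (simp add: not_in_iff)
  then have Qy: "eval Q y \<noteq> \<zero>" using roots_mem_iff_is_root[OF Q(1)] Qn y(1) by (simp add: is_root_def)
  have "v r \<noteq> v y" if r: "r \<in> carrier L" "eval Q r = \<zero>" for r
  proof (rule iso[OF r(1)])
    show "eval ?P r = \<zero>" unfolding Q(2) using eval_mult[OF lp Q(1) r(1)] r(2) eval_closed[OF lp r(1)] by simp
    show "r \<noteq> y" using Qy r(2) by auto
  qed
  then obtain s where s: "dominant (\<noteq>) y Q s" using no_root_of_value_dominant[OF Q(1) Qn y(1,3)] by blast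
  define t where "t = term_at y Q"
  have tc: "t i \<in> carrier L" for i using term_at_closed[OF Q(1) y(1)] by (simp add: t_def)
  have d: "t s \<noteq> \<zero>" "\<And>i. i \<noteq> s \<Longrightarrow> v (t s) < v (t i)" using s by (auto simp: dominant_def t_def)
  note cQ = coeff_closed[OF Q(1)] and cP = coeff_closed[OF I(2)]
  define m where "m = (if s = 0 then \<zero> else t (s - 1))"
  have mc: "m \<in> carrier L" using tc by (simp add: m_def)
  have vm: "v (t s) < v m" using d v_less_Pinf[OF tc d(1)] by (cases "s = 0") (auto simp: m_def)
  let ?w = "y [^] s"
  have w: "?w \<in> carrier L" "?w \<noteq> \<zero>" using y nonzero_pow by auto
  have pS: "coeff ?P (Suc i) = coeff Q i \<ominus> y \<otimes> coeff Q (Suc i)" for i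
    unfolding Q(2) coeff_linear_mult[OF y(1) Q(1)] by simp
  have p0: "coeff ?P 0 = \<zero> \<ominus> y \<otimes> coeff Q 0"
    unfolding Q(2) coeff_linear_mult[OF y(1) Q(1)] by simp
  have tS: "t (Suc i) = coeff Q (Suc i) \<otimes> (y [^] i \<otimes> y)" "t i = coeff Q i \<otimes> y [^] i" for i
    by (simp_all add: t_def term_at_def)
  have id1: "(w \<otimes> y) \<otimes> (q \<ominus> y \<otimes> q') = y \<otimes> (q \<otimes> w \<ominus> q' \<otimes> (w \<otimes> y))"
    if "w \<in> carrier L" "q \<in> carrier L" "q' \<in> carrier L" for w q q' using that y(1) by algebra
  have e1: "(?w \<otimes> y) \<otimes> coeff ?P (Suc s) = y \<otimes> (t s \<ominus> t (Suc s))"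
    unfolding pS tS(1) tS(2)[of s] by (rule id1[OF w(1) cQ cQ])
  have e2: "?w \<otimes> (coeff ?P s \<oplus> y \<otimes> coeff ?P (Suc s)) = y \<otimes> (m \<ominus> t (Suc s))"
  proof (cases s)
    case 0
    have "(\<zero> \<ominus> y \<otimes> q) \<oplus> y \<otimes> (q \<ominus> y \<otimes> q') = y \<otimes> (\<zero> \<ominus> q' \<otimes> y)"
      if "q \<in> carrier L" "q' \<in> carrier L" for q q' using that y(1) by algebra
    then have "(\<zero> \<ominus> y \<otimes> coeff Q 0) \<oplus> y \<otimes> (coeff Q 0 \<ominus> y \<otimes> coeff Q (Suc 0)) = y \<otimes> (\<zero> \<ominus> coeff Q (Suc 0) \<otimes> y)"
      using cQ by blast
    then show ?thesis unfolding 0 pS p0 tS(1) m_def using cQ[of 0] cQ[of "Suc 0"] y(1) by simp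
  next
    case (Suc k)
    have "(w \<otimes> y) \<otimes> ((q \<ominus> y \<otimes> q') \<oplus> y \<otimes> (q' \<ominus> y \<otimes> q'')) = y \<otimes> (q \<otimes> w \<ominus> q'' \<otimes> ((w \<otimes> y) \<otimes> y))"
      if "w \<in> carrier L" "q \<in> carrier L" "q' \<in> carrier L" "q'' \<in> carrier L" for w q q' q'' using that y(1) by algebra
    then have "(y [^] k \<otimes> y) \<otimes> ((coeff Q k \<ominus> y \<otimes> coeff Q (Suc k)) \<oplus> y \<otimes> (coeff Q (Suc k) \<ominus> y \<otimes> coeff Q (Suc (Suc k))))
      = y \<otimes> (coeff Q k \<otimes> y [^] k \<ominus> coeff Q (Suc (Suc k)) \<otimes> ((y [^] k \<otimes> y) \<otimes> y))"
      using cQ nat_pow_closed[OF y(1)] by blast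
    then show ?thesis unfolding Suc pS tS(1) m_def tS(2)[of "Suc k - 1"] by simp
  qed
  have vt: "v (t s \<ominus> t (Suc s)) = v (t s)" unfolding minus_eq using d(2)[of "Suc s"] tc by (intro v_add_eq) auto
  have v2: "v (t s) < v (m \<ominus> t (Suc s))" using vm d(2)[of "Suc s"] tc mc by (intro v_minus_gt) auto
  let ?c = "coeff ?P (Suc s)"
  have cnz: "?c \<noteq> \<zero>"
  proof
    assume "?c = \<zero>"
    then have "y \<otimes> (t s \<ominus> t (Suc s)) = \<zero>" using e1 w(1) y(1) by simp
    then have "t s \<ominus> t (Suc s) = \<zero>" using integral[of y "t s \<ominus> t (Suc s)"] y tc by auto
    then show False using vt v_less_Pinf[OF tc d(1)] by simp
  qed
  define u where "u = \<ominus> (coeff ?P s \<otimes> inv ?c)"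
  note ci = inv_simps[OF cP cnz]
  have uF: "u \<in> F" unfolding u_def
    using coeff_subfield[OF F I(1)] subfield_m_inv(1)[OF F, of ?c] cnz subringE(5,6)[OF subfieldE(1)[OF F]] by auto
  have uc: "u \<in> carrier L" using uF subfieldE(3)[OF F] by blast
  have "?c \<otimes> u = \<ominus> coeff ?P s"
  proof -
    have "?c \<otimes> u = \<ominus> (coeff ?P s \<otimes> (?c \<otimes> inv ?c))" unfolding u_def using cP[of s] cP[of "Suc s"] ci(1) by algebra
    then show ?thesis using ci(2) cP by simp
  qed
  then have cu: "?c \<otimes> (y \<ominus> u) = coeff ?P s \<oplus> y \<otimes> ?c"
  proof -
    assume h: "?c \<otimes> u = \<ominus> coeff ?P s"
    have "?c \<otimes> (y \<ominus> u) = y \<otimes> ?c \<ominus> ?c \<otimes> u" using cP[of "Suc s"] y(1) uc by algebra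
    also have "\<dots> = coeff ?P s \<oplus> y \<otimes> ?c" unfolding h using cP[of s] cP[of "Suc s"] y(1) by algebra
    finally show ?thesis .
  qed
  define A where "A = (?w \<otimes> y) \<otimes> ?c"
  have Ac: "A \<in> carrier L" unfolding A_def using w y cP by simp
  have Anz: "A \<noteq> \<zero>" unfolding A_def using nonzero_mult[OF _ _ nonzero_mult[OF w(1) y(1) w(2) y(3)] cnz] w y cP by simp
  have yt: "y \<otimes> t s \<noteq> \<zero>" using nonzero_mult y tc d(1) by blast
  have "v (A \<otimes> y) = v (y \<otimes> (y \<otimes> (t s \<ominus> t (Suc s))))" unfolding A_def e1 using y(1) tc m_comm by simp
  also have "\<dots> = v (y \<otimes> (y \<otimes> t s))" using v_mult_cancel(1)[of _ _ y] y tc vt by simp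
  also have "\<dots> < v (y \<otimes> (y \<otimes> (m \<ominus> t (Suc s))))" using v_mult_cancel(2)[of _ _ y] y tc mc v2 by simp
  also have "\<dots> = v (A \<otimes> (y \<ominus> u))"
  proof -
    have "A \<otimes> (y \<ominus> u) = y \<otimes> (?w \<otimes> (?c \<otimes> (y \<ominus> u)))"
      unfolding A_def using w(1) y(1) cP[of "Suc s"] uc by algebra
    also have "\<dots> = y \<otimes> (y \<otimes> (m \<ominus> t (Suc s)))" unfolding cu e2 ..
    finally show ?thesis by simp
  qed
  finally have "v y < v (y \<ominus> u)" using v_mult_cancel(2)[of y "y \<ominus> u" A] Ac Anz y(1) uc by simp
  then show ?thesis using uF by blast
qed

text \<open>The condition \<open>v x < v(x - u)\<close> means that \<open>x\<close> and \<open>u\<close> agree up to a factor of the form \<open>1 + m\<close> with \<open>v m > 0\<close>;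
  these factors form a group.\<close>

lemma approx_mult:
  assumes c: "x \<in> carrier L" "u \<in> carrier L" "y \<in> carrier L" "w \<in> carrier L"
    and a: "v x < v (x \<ominus> u)" "v y < v (y \<ominus> w)"
  shows "v (x \<otimes> y) < v (x \<otimes> y \<ominus> u \<otimes> w)"
proof -
  have nz: "x \<noteq> \<zero>" "y \<noteq> \<zero>" "w \<noteq> \<zero>" using a c v_close_eq[OF c(3,4) a(2)] by auto
  have "x \<otimes> y \<ominus> u \<otimes> w = x \<otimes> (y \<ominus> w) \<oplus> w \<otimes> (x \<ominus> u)" using c by algebra
  moreover have "v (x \<otimes> y) < v (x \<otimes> (y \<ominus> w))" using v_mult_cancel(2)[of y "y \<ominus> w" x] c a nz by simp
  moreover have "v (x \<otimes> y) < v (w \<otimes> (x \<ominus> u))"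
  proof -
    have "v (x \<otimes> y) = v (w \<otimes> x)" using v_mult c v_close_eq[OF c(3,4) a(2)] by (simp add: add.commute)
    then show ?thesis using v_mult_cancel(2)[of x "x \<ominus> u" w] c a nz by simp
  qed
  ultimately show ?thesis using v_add_gt c by simp
qed

lemma approx_divide:
  assumes c: "x \<in> carrier L" "p \<in> carrier L" "q \<in> carrier L" "u \<in> carrier L"
    and nz: "x \<noteq> \<zero>" and a: "v p < v (p \<ominus> q)" "v (p \<otimes> x) < v (p \<otimes> x \<ominus> u)"
  shows "v x < v (x \<ominus> u \<otimes> inv q)"
proof -
  have vq: "v q = v p" using v_close_eq[OF c(2,3) a(1)] .
  have pz: "p \<noteq> \<zero>" using a(1) by auto
  then have qz: "q \<noteq> \<zero>" using vq v_zero_iff[OF c(2)] by auto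
  note qi = inv_simps[OF c(3) qz]
  have "q \<otimes> (x \<ominus> u \<otimes> inv q) = q \<otimes> x \<ominus> u \<otimes> (q \<otimes> inv q)" using c qi(1) by algebra
  also have "\<dots> = (p \<otimes> x \<ominus> u) \<ominus> x \<otimes> (p \<ominus> q)" unfolding qi(2) using c by algebra
  finally have e: "q \<otimes> (x \<ominus> u \<otimes> inv q) = (p \<otimes> x \<ominus> u) \<ominus> x \<otimes> (p \<ominus> q)" .
  have "v (p \<otimes> x) < v (x \<otimes> (p \<ominus> q))" using v_mult_cancel(2)[of p "p \<ominus> q" x] c nz a(1) m_comm[of p x] by simp
  then have "v (p \<otimes> x) < v (q \<otimes> (x \<ominus> u \<otimes> inv q))" unfolding e using v_minus_gt[OF _ _ a(2)] c by simp
  moreover have "v (p \<otimes> x) = v (q \<otimes> x)" using v_mult c vq by simp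
  ultimately show ?thesis using v_mult_cancel(2)[of x "x \<ominus> u \<otimes> inv q" q] c qz qi(1) by simp
qed

text \<open>For \<open>x\<close> in the henselization, no automorphism moving \<open>x\<close> preserves the value on \<open>F(x)\<close>. Hence some
  \<open>z \<in> F(x)\<close> has a value different from those of its other conjugates, and so does \<open>z\<^sup>m x\<close> for a
  suitable \<open>m\<close>; both can be approximated in \<open>F\<close>, and then their quotient can.\<close>

theorem hens_immediate:
  assumes F: "subfield F L" and x: "x \<in> hens F" "x \<noteq> \<zero>"
  shows "\<exists>u\<in>F. v x < v (x \<ominus> u)"
proof -
  note h = hens_subfield[OF F]
  have xN: "x \<in> alg_cl F" using x h by blast
  have xc: "x \<in> carrier L" "algebraic F x" using xN by (auto simp: alg_cl_iff)
  note I = Irr_props[OF F xc]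
  let ?M = "adjoin L F {x}"
  have FL: "F \<subseteq> carrier L" using subfieldE(3)[OF F] .
  have M: "subfield ?M L" "F \<subseteq> ?M" "x \<in> ?M" using adjoin_simps[of F "{x}"] FL xc by auto
  have Mh: "?M \<subseteq> hens F" using adjoin_simps(4)[of F "{x}" "hens F"] FL xc h x by auto
  have MN: "?M \<subseteq> alg_cl F" using Mh h by blast
  have Mimg: "?M = (\<lambda>p. eval p x) ` carrier (F[X])"
    unfolding adjoin_algebraic(1)[OF F xc] using simple_extension_as_eval_img[OF FL xc(1)] .
  define R where "R = {r \<in> carrier L. eval (Irr F x) r = \<zero> \<and> r \<noteq> x}"
  have "R \<subseteq> {r. is_root (Irr F x) r}" using I(3) by (auto simp: R_def is_root_def)
  then have fR: "finite R" using finite_number_of_roots[OF I(2)] finite_subset by blast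
  have "\<forall>r\<in>R. \<exists>\<rho>. \<rho> \<in> Gal_closure L F \<and> \<rho> x = r" using conjugate_exists[OF F xN] unfolding R_def by blast
  then obtain g where g: "\<And>r. r \<in> R \<Longrightarrow> g r \<in> Gal_closure L F" "\<And>r. r \<in> R \<Longrightarrow> g r x = r" by metis
  have gM: "embedding ?M (g r)" if "r \<in> R" for r
    using embedding_restrict[OF Gal_closureD(1)[OF F g(1)[OF that]] M(1) MN] .
  have ex: "\<exists>z\<in>?M. z \<noteq> \<zero> \<and> v (g r z) \<noteq> v z" if r: "r \<in> R" for r
  proof (rule ccontr)
    assume no: "\<not> (\<exists>z\<in>?M. z \<noteq> \<zero> \<and> v (g r z) \<noteq> v z)"
    have "v (g r z) = v z" if "z \<in> ?M" for z using no that embedding_simps(5)[OF gM[OF r]] by (cases "z = \<zero>") auto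
    then obtain \<rho> where "\<rho> \<in> Gal_closure L F" "\<And>z. z \<in> ?M \<Longrightarrow> z \<in> alg_cl F \<Longrightarrow> \<rho> z = g r z" "\<And>z. z \<in> alg_cl F \<Longrightarrow> v (\<rho> z) = v z"
      using extend_to_closure[OF F gM[OF r] M(2) Gal_closureD(2)[OF F g(1)[OF r]]] by metis
    then have "\<rho> \<in> value_automorphisms F" "\<rho> x = r" using M(3) xN g(2)[OF r] by (auto simp: value_automorphisms_def)
    then have "x = r" using x(1) hens_iff[OF F] by metis
    then show False using r by (simp add: R_def)
  qed
  have approx: "\<exists>u\<in>F. v y < v (y \<ominus> u)" if y: "y \<in> ?M" "y \<noteq> \<zero>" "\<And>r. r \<in> R \<Longrightarrow> v (g r y) \<noteq> v y" for y
  proof -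
    have yN: "y \<in> alg_cl F" using y(1) MN by blast
    have yc: "y \<in> carrier L" "algebraic F y" using yN by (auto simp: alg_cl_iff)
    have "y \<in> sep_cl F" using y(1) Mh h(3) by blast
    then have m: "alg_mult (Irr F y) y \<le> 1" using yc by (auto simp: rel_sep_closure_def)
    show ?thesis
    proof (rule approximation_isolated_root[OF F yc y(2) m])
      fix r' assume r': "r' \<in> carrier L" "eval (Irr F y) r' = \<zero>" "r' \<noteq> y"
      obtain \<rho> where rho: "\<rho> \<in> Gal_closure L F" "\<rho> y = r'" using conjugate_exists[OF F yN r'(1,2)] by metis
      obtain p where p: "p \<in> carrier (F[X])" "y = eval p x" using y(1) unfolding Mimg by blast
      have ry: "\<rho>' y = eval p (\<rho>' x)" if "\<rho>' \<in> Gal_closure L F" for \<rho>' using Gal_closureD(4)[OF F that p(1) xN] p(2) by simp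
      have "\<rho> x \<noteq> x" using ry[OF rho(1)] rho(2) r'(3) p(2) by auto
      moreover have "eval (Irr F x) (\<rho> x) = \<zero>"
        using Gal_closureD(4)[OF F rho(1) I(1) xN] I(4) embedding_simps(5)[OF Gal_closureD(1)[OF F rho(1)]] by simp
      ultimately have rR: "\<rho> x \<in> R" using embedding_simps(1)[OF Gal_closureD(1)[OF F rho(1)] xN] by (simp add: R_def)
      have "r' = g (\<rho> x) y" using ry[OF rho(1)] ry[OF g(1)[OF rR]] g(2)[OF rR] rho(2) by simp
      then show "v r' \<noteq> v y" using y(3)[OF rR] by simp
    qed
  qed
  have "\<exists>z\<in>?M. z \<noteq> \<zero> \<and> (\<forall>r\<in>R. v (g r z) \<noteq> v z)"
    by (rule separating_element[OF fR gM M(1) ex])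
  then obtain z where z: "z \<in> ?M" "z \<noteq> \<zero>" "\<And>r. r \<in> R \<Longrightarrow> v (g r z) \<noteq> v z" by blast
  obtain m where m: "m \<ge> (1::nat)" "\<And>r. r \<in> R \<Longrightarrow> v (g r (z [^] m \<otimes> x)) \<noteq> v (z [^] m \<otimes> x)"
    using separating_power[where I = R and M = ?M and \<tau> = g and z = z and x = x, OF gM fR z M(3) x(2) M(1)] by blast
  have zc: "z \<in> carrier L" using z(1) subfieldE(3)[OF M(1)] by blast
  have zp: "z [^] k \<in> ?M" for k::nat using z(1) subringE(3,6)[OF subfieldE(1)[OF M(1)]] by (induct k) auto
  obtain u where u: "u \<in> F" "v z < v (z \<ominus> u)" using approx[OF z] by blast
  have uL: "u \<in> carrier L" using u FL by blast
  have up: "u [^] k \<in> F" for k::nat using u(1) subringE(3,6)[OF subfieldE(1)[OF F]] by (induct k) auto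
  have pw: "v (z [^] k) < v (z [^] k \<ominus> u [^] k)" for k::nat
  proof (induct k)
    case 0 then show ?case by (simp add: minus_eq r_neg)
  next
    case (Suc k) then show ?case using approx_mult[of "z [^] k" "u [^] k" z u] u(2) zc uL by simp
  qed
  obtain w where w: "w \<in> F" "v (z [^] m \<otimes> x) < v (z [^] m \<otimes> x \<ominus> w)"
    using approx[of "z [^] m \<otimes> x"] m(2) zp M(3) subringE(6)[OF subfieldE(1)[OF M(1)]] nonzero_mult nonzero_pow zc z(2) xc(1) x(2)
    by (metis nat_pow_closed)
  have wL: "w \<in> carrier L" using w FL by blast
  have "v x < v (x \<ominus> w \<otimes> inv (u [^] m))"
    using approx_divide[OF xc(1) _ _ wL x(2) pw w(2)] zc uL by simp
  moreover have "u [^] m \<noteq> \<zero>" using pw[of m] v_close_eq[of "z [^] m" "u [^] m"] zc uL by fastforce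
  then have "w \<otimes> inv (u [^] m) \<in> F"
    using w(1) subfield_m_inv(1)[OF F, of "u [^] m"] up subringE(6)[OF subfieldE(1)[OF F]] by blast
  ultimately show ?thesis by blast
qed

end

section \<open>Minimal pairs and the implicit constant field\<close>

context algebraically_closed
begin

lemma linear_factor_induct_alg_cl [consumes 3, case_names const linear]:
  assumes K: "subfield K L" and "p \<in> carrier ((alg_cl K)[X])" "p \<noteq> []"
    and "\<And>c. c \<in> alg_cl K \<Longrightarrow> c \<noteq> \<zero> \<Longrightarrow> P [c]"
    and "\<And>r q. r \<in> alg_cl K \<Longrightarrow> q \<in> carrier ((alg_cl K)[X]) \<Longrightarrow> q \<noteq> [] \<Longrightarrow> [\<one>, \<ominus> r] \<in> carrier ((alg_cl K)[X]) \<Longrightarrow>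
      P q \<Longrightarrow> P ([\<one>, \<ominus> r] \<otimes>\<^bsub>poly_ring L\<^esub> q)"
  shows "P p"
  using assms(2,3)
proof (induction "degree p" arbitrary: p rule: less_induct)
  case less
  let ?N = "alg_cl K"
  have N: "subfield ?N L" using alg_cl_subfield(1)[OF K] .
  have pL: "p \<in> carrier (poly_ring L)" using subfield_polyE(3)[OF N less.prems(1)] .
  show ?case
  proof (cases "degree p = 0")
    case True
    then obtain c where c: "p = [c]" using less.prems(2) by (cases p) auto
    then show ?thesis using assms(4) less.prems by (auto simp: univ_poly_carrier[symmetric] polynomial_def)
  next
    case False
    then have "degree p \<ge> 1" by simp
    then obtain r where r: "r \<in> carrier L" "eval p r = \<zero>" using root_exists[OF pL] by blast
    have rN: "r \<in> ?N" using alg_cl_root[OF K less.prems r] .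
    have lin: "[\<one>, \<ominus> r] \<in> carrier (?N[X])"
      using rN subringE(3,5)[OF subfieldE(1)[OF N]] by (auto simp: univ_poly_carrier[symmetric] polynomial_def)
    have "[\<one>, \<ominus> r] pdivides p" using is_root_imp_pdivides[OF pL] r less.prems(2) by (simp add: is_root_def)
    then obtain q where q: "q \<in> carrier (?N[X])" "p = [\<one>, \<ominus> r] \<otimes>\<^bsub>?N[X]\<^esub> q"
      using pdivides_iff_shell[OF N lin less.prems(1)] unfolding factor_def by blast
    interpret NX: domain "?N[X]" using univ_poly_is_domain[OF subfieldE(1)[OF N]] .
    have nz: "q \<noteq> []" using q(2) less.prems(2) NX.r_null[OF lin] by (auto simp: univ_poly_zero)
    have "degree p = 1 + degree q"
      using poly_mult_degree_eq[OF subfieldE(1)[OF N], of "[\<one>, \<ominus> r]" q] nz q lin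
      by (simp add: univ_poly_mult univ_poly_carrier)
    then have "P q" using less.hyps[of q] q nz by simp
    then show ?thesis using assms(5)[OF rN q(1) nz lin] q(2) poly_mult_shell[where M = ?N] by simp
  qed
qed

lemma subfield_fixed:
  assumes "embedding M \<tau>" shows "subfield {z \<in> M. \<tau> z = z} L"
proof -
  have M: "subfield M L" using embedding_subfield[OF assms] .
  note R = subringE[OF subfieldE(1)[OF M]] and E = embedding_simps[OF assms]
  show ?thesis
  proof (rule subfieldI')
    show "subring {z \<in> M. \<tau> z = z} L"
      using R E by (intro subringI) auto
    show "inv k \<in> {z \<in> M. \<tau> z = z}" if "k \<in> {z \<in> M. \<tau> z = z} - {\<zero>}" for k
      using that E(9)[of k] subfield_m_inv(1)[OF M, of k] by auto
  qed
qed

lemma subfield_Int: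
  assumes "subfield M L" "subfield M' L" shows "subfield (M \<inter> M') L"
proof (rule subfieldI')
  show "subring (M \<inter> M') L" using subring_inter subfieldE(1) assms by blast
  show "inv k \<in> M \<inter> M'" if "k \<in> M \<inter> M' - {\<zero>}" for k
    using that subfield_m_inv(1)[OF assms(1), of k] subfield_m_inv(1)[OF assms(2), of k] by blast
qed

end

locale minimal_pair = valued_field L v
  for L :: "('a, 'b) ring_scheme" (structure) and v :: "'a \<Rightarrow> 'g::linordered_ab_group_add extended" +
  fixes K :: "'a set" and T a :: 'a and \<gamma> :: 'g
  assumes K: "subfield K L" and T: "T \<in> carrier L" and T_trans: "transcendental K T"
    and L_alg: "\<And>x. x \<in> carrier L \<Longrightarrow> algebraic (adjoin L K {T}) x"
    and pair: "minimal_pair_of_definition L v K T a \<gamma>"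
begin

abbreviation "N \<equiv> alg_cl K"
abbreviation "F \<equiv> adjoin L K {T}"

definition "y = T \<ominus> a"

definition "close r \<longleftrightarrow> Fin \<gamma> \<le> v (a \<ominus> r)"

lemma N: "subfield N L" "K \<subseteq> N" "N \<subseteq> carrier L" and KL: "K \<subseteq> carrier L"
  using alg_cl_subfield[OF K] subfieldE(3)[OF K] by (auto simp: alg_cl_iff)

lemma N_carrier: "r \<in> N \<Longrightarrow> r \<in> carrier L" by (simp add: alg_cl_iff)

lemma F: "subfield F L" "K \<subseteq> F" "T \<in> F" "F \<subseteq> carrier L"
  using adjoin_simps[OF KL, of "{T}"] T subfieldE(3)[of F L] by auto

lemma alg_cl_F: "alg_cl F = carrier L" using L_alg by (auto simp: alg_cl_iff)

lemma a: "a \<in> N" "a \<in> carrier L" "algebraic K a"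
  using pair by (auto simp: minimal_pair_of_definition_def alg_cl_iff)

lemma y: "y \<in> carrier L" "v y = Fin \<gamma>" "y \<noteq> \<zero>"
proof -
  show "y \<in> carrier L" using T a by (simp add: y_def)
  show vy: "v y = Fin \<gamma>" using pair by (simp add: y_def minimal_pair_of_definition_def)
  then show "y \<noteq> \<zero>" by auto
qed

lemma T_not_algebraic: "T \<notin> N" using T_trans by (auto simp: alg_cl_iff)

lemma eval_T_nonzero:
  assumes "p \<in> carrier (N[X])" "p \<noteq> []" shows "eval p T \<noteq> \<zero>"
  using alg_cl_root[OF K assms T] T_not_algebraic by blast

lemma close_a: "close a" unfolding close_def using a(2) by (simp add: minus_eq r_neg)

text \<open>The maximality of \<open>\<gamma>\<close> determines the values \<open>v(T - r) = min {\<gamma>, v(a - r)}\<close> of the linear polynomials, hence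
  those of all polynomials in \<open>T\<close>. So the valuation is the Gauss valuation of the ball around \<open>a\<close>.\<close>

lemma v_T_minus:
  assumes r: "r \<in> N"
  shows "close r \<Longrightarrow> v (T \<ominus> r) = Fin \<gamma>" "\<not> close r \<Longrightarrow> v (T \<ominus> r) = v (a \<ominus> r)"
proof -
  have rL: "r \<in> carrier L" using r N by blast
  have e: "T \<ominus> r = (a \<ominus> r) \<oplus> y" unfolding y_def using T a rL by algebra
  show "v (T \<ominus> r) = Fin \<gamma>" if "close r"
  proof (rule antisym)
    show "v (T \<ominus> r) \<le> Fin \<gamma>" using pair r by (simp add: minimal_pair_of_definition_def)
    show "Fin \<gamma> \<le> v (T \<ominus> r)" unfolding e using that y a rL by (intro v_add_ge) (auto simp: close_def)
  qed
  show "v (T \<ominus> r) = v (a \<ominus> r)" if "\<not> close r"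
    unfolding e using that y a rL by (intro v_add_eq) (auto simp: close_def not_le)
qed

lemma degree_close:
  assumes "r \<in> N" "close r" shows "degree (Irr K a) \<le> degree (Irr K r)"
proof -
  have rc: "r \<in> carrier L" "algebraic K r" using assms(1) by (auto simp: alg_cl_iff)
  have "dim K (adjoin L K {a}) \<le> dim K (adjoin L K {r})"
    using pair assms unfolding minimal_pair_of_definition_def close_def by blast
  then show ?thesis using adjoin_algebraic(4)[OF K a(2,3)] adjoin_algebraic(4)[OF K rc] by simp
qed

subsection \<open>Automorphisms over \<open>K\<close> and over \<open>K(T)\<close>\<close>

text \<open>The value of \<open>T - r\<close> depends only on the position of \<open>r\<close> relative to the ball around \<open>a\<close>. An automorphism that
  preserves the values and sends \<open>a\<close> into this ball does not change the position, and it maps linear factors to linear factors.\<close>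

lemma value_polynomial_invariant:
  assumes t: "embedding N \<tau>" "\<And>z. z \<in> N \<Longrightarrow> \<tau> z \<in> N" "\<And>z. z \<in> N \<Longrightarrow> v (\<tau> z) = v z" "close (\<tau> a)"
    and p: "p \<in> carrier (N[X])"
  shows "v (eval (map \<tau> p) T) = v (eval p T)"
proof (cases "p = []")
  case False
  note E = embedding_simps[OF t(1)]
  have lin: "v (T \<ominus> \<tau> r) = v (T \<ominus> r)" if r: "r \<in> N" for r
  proof -
    have c: "r \<in> carrier L" "\<tau> r \<in> carrier L" "\<tau> a \<in> carrier L" "\<tau> r \<in> N" "a \<ominus> r \<in> N"
      using N_carrier[OF r] N_carrier[OF t(2)[OF r]] N_carrier[OF t(2)[OF a(1)]] t(2)[OF r] r a(1)
        subringE(5,7)[OF subfieldE(1)[OF N(1)]] by (auto simp: minus_eq)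
    have e: "a \<ominus> \<tau> r = (\<tau> a \<ominus> \<tau> r) \<oplus> (a \<ominus> \<tau> a)" using a c by algebra
    have vt: "v (\<tau> a \<ominus> \<tau> r) = v (a \<ominus> r)" using t(3)[OF c(5)] E(7)[OF a(1) r] by simp
    have ca: "Fin \<gamma> \<le> v (a \<ominus> \<tau> a)" using t(4) by (simp add: close_def)
    show ?thesis
    proof (cases "close r")
      case True
      then have "Fin \<gamma> \<le> v (a \<ominus> \<tau> r)" unfolding e using vt ca a c by (intro v_add_ge) (auto simp: close_def)
      then show ?thesis using v_T_minus(1)[OF c(4)] v_T_minus(1)[OF r True] by (simp add: close_def)
    next
      case False
      then have "v (\<tau> a \<ominus> \<tau> r) < v (a \<ominus> \<tau> a)" using vt ca by (simp add: close_def)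
      then have "v (a \<ominus> \<tau> r) = v (a \<ominus> r)" unfolding e using vt a c v_add_eq by simp
      then show ?thesis using v_T_minus(2)[OF c(4)] v_T_minus(2)[OF r False] False by (simp add: close_def)
    qed
  qed
  from K p False show ?thesis
  proof (induction p rule: linear_factor_induct_alg_cl)
    case (const c)
    then show ?case using t(3)[of c] N_carrier[of c] N_carrier[OF t(2)[of c]] T by simp
  next
    case (linear r q)
    have c: "r \<in> carrier L" "\<tau> r \<in> carrier L" using linear(1) N_carrier t(2) by auto
    have qL: "q \<in> carrier (poly_ring L)" "map \<tau> q \<in> carrier (poly_ring L)"
      using subfield_polyE(3)[OF N(1) linear(2)] embedding_poly(1)[OF t(1) linear(2)] by auto
    have m: "map \<tau> ([\<one>, \<ominus> r] \<otimes>\<^bsub>poly_ring L\<^esub> q) = [\<one>, \<ominus> (\<tau> r)] \<otimes>\<^bsub>poly_ring L\<^esub> map \<tau> q"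
      using embedding_poly(4)[OF t(1) linear(4,2)] E(4,6) linear(1) poly_mult_shell[where M = N] by simp
    have "v (eval (map \<tau> ([\<one>, \<ominus> r] \<otimes>\<^bsub>poly_ring L\<^esub> q)) T) = v (T \<ominus> \<tau> r) + v (eval (map \<tau> q) T)"
      unfolding m using eval_mult[OF linear_poly[OF c(2)] qL(2) T] eval_linear[OF c(2) T] v_mult eval_closed[OF qL(2) T] c T by simp
    also have "\<dots> = v (T \<ominus> r) + v (eval q T)" using lin[OF linear(1)] linear(5) by simp
    also have "\<dots> = v (eval ([\<one>, \<ominus> r] \<otimes>\<^bsub>poly_ring L\<^esub> q) T)"
      using eval_mult[OF linear_poly[OF c(1)] qL(1) T] eval_linear[OF c(1) T] v_mult eval_closed[OF qL(1) T] c T by simp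
    finally show ?case .
  qed
qed simp

text \<open>Extend \<open>\<tau>\<close> to \<open>N(T)\<close> by \<open>T \<mapsto> T\<close>. As values of polynomials are preserved, so are those of fractions, and
  the extension theorem applies.\<close>

lemma lift_automorphism:
  assumes s: "\<tau> \<in> value_automorphisms K" and ca: "close (\<tau> a)"
  obtains \<rho> where "\<rho> \<in> value_automorphisms F" "\<And>x. x \<in> N \<Longrightarrow> \<rho> x = \<tau> x"
proof -
  note sG = value_automorphismsD(1)[OF s] and sv = value_automorphismsD(2)[OF s]
  note E = Gal_closureD(1)[OF K sG] and EN = Gal_closureD(3)[OF K sG]
  have inv: "v (eval (map \<tau> p) T) = v (eval p T)" if "p \<in> carrier (N[X])" for p
    by (rule value_polynomial_invariant[OF E _ _ ca that]) (use EN sv in auto)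
  have ec: "eval p T \<in> carrier L" "eval (map \<tau> p) T \<in> carrier L" if "p \<in> carrier (N[X])" for p
    using MX_eval(4)[OF N(1) that that T] eval_closed[OF embedding_poly(1)[OF E that] T] by auto
  have rel: "eval p T = \<zero> \<longleftrightarrow> eval (map \<tau> p) T = \<zero>" if "p \<in> carrier (N[X])" for p
    using v_zero_iff[OF ec(1)[OF that]] v_zero_iff[OF ec(2)[OF that]] inv[OF that] by simp
  let ?M = "adjoin L N {T}"
  have M: "subfield ?M L" "N \<subseteq> ?M" "T \<in> ?M" using adjoin_simps[OF N(3), of "{T}"] T by auto
  obtain \<tau>' where t: "embedding ?M \<tau>'" "\<And>z. z \<in> N \<Longrightarrow> \<tau>' z = \<tau> z" "\<tau>' T = T"
    "\<And>p q. p \<in> carrier (N[X]) \<Longrightarrow> q \<in> carrier (N[X]) \<Longrightarrow> eval q T \<noteq> \<zero> \<Longrightarrow>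
       \<tau>' (eval p T \<otimes> inv (eval q T)) = eval (map \<tau> p) T \<otimes> inv (eval (map \<tau> q) T)"
    using embedding_extend[OF E T T rel] by metis
  have tv: "v (\<tau>' z) = v z" if z: "z \<in> ?M" for z
  proof -
    obtain p q where pq: "z = eval p T \<otimes> inv (eval q T)" "p \<in> carrier (N[X])" "q \<in> carrier (N[X])" "eval q T \<noteq> \<zero>"
      using z unfolding adjoin_fractions[OF N(1) T] by blast
    have q': "eval (map \<tau> q) T \<noteq> \<zero>" using rel pq by blast
    obtain g where g: "v (eval q T) = Fin g" using v_finE[OF ec(1)[OF pq(3)] pq(4)] .
    have g': "v (eval (map \<tau> q) T) = Fin g" using inv[OF pq(3)] g by simp
    have "v (inv (eval q T)) = v (inv (eval (map \<tau> q) T))"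
      using v_inv[OF ec(1)[OF pq(3)] pq(4) g] v_inv[OF ec(2)[OF pq(3)] q' g'] by simp
    then show ?thesis unfolding pq(1) t(4)[OF pq(2-4)]
      using v_mult[OF ec(1)[OF pq(2)] inv_simps(1)[OF ec(1)[OF pq(3)] pq(4)]]
        v_mult[OF ec(2)[OF pq(2)] inv_simps(1)[OF ec(2)[OF pq(3)] q']] inv[OF pq(2)] by simp
  qed
  have TL: "{T} \<subseteq> carrier L" using T by blast
  have "K \<subseteq> {z \<in> ?M. \<tau>' z = z}" using M(2) N(2) t(2) Gal_closureD(2)[OF K sG] by (auto simp: subset_iff)
  moreover have "{T} \<subseteq> {z \<in> ?M. \<tau>' z = z}" using M(3) t(3) by blast
  ultimately have "F \<subseteq> {z \<in> ?M. \<tau>' z = z}" by (rule adjoin_simps(4)[OF KL TL subfield_fixed[OF t(1)]])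
  then have FM: "F \<subseteq> ?M" "\<And>c. c \<in> F \<Longrightarrow> \<tau>' c = c" by auto
  obtain \<rho> where r: "\<rho> \<in> Gal_closure L F" "\<And>z. z \<in> ?M \<Longrightarrow> z \<in> alg_cl F \<Longrightarrow> \<rho> z = \<tau>' z" "\<And>z. z \<in> alg_cl F \<Longrightarrow> v (\<rho> z) = v z"
    using extend_to_closure[OF F(1) t(1) FM tv] by metis
  have "\<rho> \<in> value_automorphisms F" using r(1,3) by (simp add: value_automorphisms_def)
  moreover have "\<rho> x = \<tau> x" if "x \<in> N" for x using r(2)[of x] t(2)[OF that] M(2) that alg_cl_F N(3) by auto
  ultimately show thesis using that by blast
qed

text \<open>An automorphism over \<open>K(T)\<close> maps \<open>T - a\<close> to \<open>T - \<rho> a\<close>, so both have value \<open>\<gamma>\<close>, and \<open>a - \<rho> a\<close> is their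
  difference up to sign.\<close>

lemma restrict_automorphism:
  assumes "\<rho> \<in> value_automorphisms F"
  shows "\<rho> \<in> value_automorphisms K" "close (\<rho> a)"
proof -
  note rG = value_automorphismsD(1)[OF assms] and rv = value_automorphismsD(2)[OF assms]
  note E = Gal_closureD(1)[OF F(1) rG]
  have g: "\<rho> \<in> Gal_closure L K"
    using Gal_closureI[OF K E] Gal_closureD(2)[OF F(1) rG] F(2) N(3) alg_cl_F by auto
  then show "\<rho> \<in> value_automorphisms K" using rv N(3) alg_cl_F by (auto simp: value_automorphisms_def)
  have ra: "\<rho> a \<in> carrier L" using Gal_closureD(3)[OF K g a(1)] N(3) by blast
  have "\<rho> y = T \<ominus> \<rho> a"
    unfolding y_def using embedding_simps(7)[OF E] alg_cl_F T a(2) Gal_closureD(2)[OF F(1) rG F(3)] by simp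
  then have "v (T \<ominus> \<rho> a) = Fin \<gamma>" using rv[of y] y alg_cl_F by simp
  moreover have "a \<ominus> \<rho> a = (T \<ominus> \<rho> a) \<ominus> y" unfolding y_def using T a ra by algebra
  ultimately show "close (\<rho> a)" unfolding close_def using v_minus_ge[of "T \<ominus> \<rho> a" y "Fin \<gamma>"] T ra y by simp
qed

subsection \<open>The implicit constant field\<close>

abbreviation "IC \<equiv> implicit_constant_field L v K T"

lemma IC_iff: "x \<in> IC \<longleftrightarrow> x \<in> N \<and> x \<in> hens F"
  by (simp add: implicit_constant_field_def)

lemma IC: "subfield IC L" "IC \<subseteq> N" "IC \<subseteq> hens F"
  using subfield_Int[OF N(1) hens_subfield(1)[OF F(1)]] by (auto simp: implicit_constant_field_def)

lemma hens_K_IC: "hens K \<subseteq> IC"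
proof
  fix x assume x: "x \<in> hens K"
  then have s: "x \<in> sep_cl K" "\<And>\<rho>. \<rho> \<in> value_automorphisms K \<Longrightarrow> \<rho> x = x" using hens_iff[OF K] by auto
  then have "x \<in> sep_cl F" using sep_cl_base_mono[OF K F(1,2)] by blast
  then have "x \<in> hens F" using s(2) restrict_automorphism(1) hens_iff[OF F(1)] by blast
  then show "x \<in> IC" using hens_subfield(4)[OF K] x IC_iff by blast
qed

lemma K_IC: "K \<subseteq> IC" using hens_subfield(2)[OF K] hens_K_IC by blast

text \<open>If \<open>x g(T) = f(T)\<close>, comparing coefficients expresses \<open>x\<close> as a quotient of coefficients of \<open>f\<close> and \<open>g\<close>.\<close>

lemma algebraic_in_transcendental_extension:
  assumes M: "subfield M L" "M \<subseteq> N" and x: "x \<in> adjoin L M {T}" "x \<in> N"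
  shows "x \<in> M"
proof (cases "x = \<zero>")
  case True then show ?thesis using subringE(2)[OF subfieldE(1)[OF M(1)]] by simp
next
  case False
  obtain f g where fg: "x = eval f T \<otimes> inv (eval g T)" "f \<in> carrier (M[X])" "g \<in> carrier (M[X])" "eval g T \<noteq> \<zero>"
    using x(1) unfolding adjoin_fractions[OF M(1) T] by blast
  have NN: "f \<in> carrier (N[X])" "g \<in> carrier (N[X])"
    using fg M(2) by (auto simp: univ_poly_carrier[symmetric] polynomial_def)
  note c = coeff_subfield[OF M(1) fg(2)] coeff_subfield[OF M(1) fg(3)]
  have cL: "coeff f i \<in> carrier L" "coeff g i \<in> carrier L" for i using c M N by blast+
  have ec: "eval f T \<in> carrier L" "eval g T \<in> carrier L" using MX_eval(4)[OF N(1) NN(1,1) T] MX_eval(4)[OF N(1) NN(2,2) T] by auto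
  have xL: "x \<in> carrier L" using x N by blast
  have mx: "\<ominus> x \<in> N" "\<ominus> x \<noteq> \<zero>" using x(2) False xL subringE(5)[OF subfieldE(1)[OF N(1)]] by (auto simp: minus_equality[symmetric] dest: r_neg)
  have mxp: "[\<ominus> x] \<in> carrier (N[X])" using mx by (auto simp: univ_poly_carrier[symmetric] polynomial_def)
  define h where "h = f \<oplus>\<^bsub>N[X]\<^esub> ([\<ominus> x] \<otimes>\<^bsub>N[X]\<^esub> g)"
  have h: "h \<in> carrier (N[X])" unfolding h_def using MX_closed(1,2)[OF N(1)] NN mxp by blast
  have "eval h T = eval f T \<oplus> (\<ominus> x) \<otimes> eval g T"
    unfolding h_def using MX_eval(1,2)[OF N(1) _ _ T] MX_closed(1)[OF N(1) mxp NN(2)] NN mxp xL T by simp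
  also have "\<dots> = \<zero>"
  proof -
    have "x \<otimes> eval g T = eval f T" unfolding fg(1) using ec inv_simps[OF ec(2) fg(4)] by (simp add: m_assoc)
    then show ?thesis using ec xL by (simp add: l_minus r_neg)
  qed
  finally have "h = []" using eval_T_nonzero[OF h] by blast
  then have h0: "coeff h i = \<zero>" for i by simp
  have hc: "coeff h i = coeff f i \<oplus> (\<ominus> x) \<otimes> coeff g i" for i
  proof -
    have sf: "set f \<subseteq> carrier L" "set g \<subseteq> carrier L" using subfield_polyE(2)[OF N(1)] NN by auto
    have e: "poly_mult [\<ominus> x] g = normalize (map (\<lambda>b. (\<ominus> x) \<otimes> b) g)" using poly_mult_const'(1)[OF sf(2)] xL by simp
    have "coeff (poly_mult [\<ominus> x] g) i = (\<ominus> x) \<otimes> coeff g i"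
      unfolding e using fun_cong[OF normalize_coeff[of "map (\<lambda>b. (\<ominus> x) \<otimes> b) g"], of i] fun_cong[OF scalar_coeff[of "\<ominus> x" g], of i] xL
      by (metis a_inv_closed)
    moreover have "set (poly_mult [\<ominus> x] g) \<subseteq> carrier L" using poly_mult_in_carrier[of "[\<ominus> x]" g] sf xL by simp
    ultimately show ?thesis unfolding h_def univ_poly_add univ_poly_mult using poly_add_coeff[OF sf(1)] by simp
  qed
  have "g \<noteq> []" using fg(4) by auto
  then obtain i where i: "coeff g i \<noteq> \<zero>" using poly_zero_iff[OF M(1) fg(3)] by blast
  have "coeff f i = x \<otimes> coeff g i"
  proof -
    have "coeff f i \<oplus> (\<ominus> x) \<otimes> coeff g i = \<zero>" using h0 hc by metis
    then have "coeff f i \<ominus> x \<otimes> coeff g i = \<zero>" using cL xL by (simp add: minus_eq l_minus)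
    then show ?thesis using cL xL by (meson m_closed r_right_minus_eq)
  qed
  then have "x = coeff f i \<otimes> inv (coeff g i)" using inv_simps[OF cL(2) i] cL xL by (simp add: m_assoc)
  then show ?thesis using c i subfield_m_inv(1)[OF M(1), of "coeff g i"] subringE(6)[OF subfieldE(1)[OF M(1)]] by blast
qed

text \<open>Separability over \<open>K(T)\<close> puts \<open>x\<close> into \<open>K(T)(x\<^sup>p) = K(x\<^sup>p)(T)\<close>, hence into \<open>K(x\<^sup>p)\<close> by the previous lemma.\<close>

lemma IC_separable:
  assumes x: "x \<in> IC" shows "x \<in> sep_cl K"
proof -
  have xN: "x \<in> N" "x \<in> carrier L" using x IC(2) N(3) by auto
  have xF: "x \<in> sep_cl F" using x IC(3) hens_subfield(3)[OF F(1)] by blast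
  have "x \<in> adjoin L K {x [^] p}" if p: "Factorial_Ring.prime p" "nat_elt p = \<zero>" for p
  proof -
    let ?M = "adjoin L K {x [^] p}"
    have xpN: "x [^] p \<in> N" using xN(1) subringE(3,6)[OF subfieldE(1)[OF N(1)]] by (induct p) auto
    have M: "subfield ?M L" "K \<subseteq> ?M" "x [^] p \<in> ?M" using adjoin_simps[OF KL, of "{x [^] p}"] xN by auto
    have MN: "?M \<subseteq> N" using adjoin_alg_cl[OF K, of "{x [^] p}"] xpN by blast
    have M_carrier: "?M \<subseteq> carrier L" using subfieldE(3)[OF M(1)] .
    have MT: "subfield (adjoin L ?M {T}) L" "?M \<subseteq> adjoin L ?M {T}" "T \<in> adjoin L ?M {T}"
      using adjoin_simps[OF M_carrier, of "{T}"] T by auto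
    have "F \<subseteq> adjoin L ?M {T}" using adjoin_simps(4)[OF KL _ MT(1), of "{T}"] M MT T by auto
    then have "adjoin L F {x [^] p} \<subseteq> adjoin L ?M {T}"
      using adjoin_simps(4)[OF F(4) _ MT(1), of "{x [^] p}"] M MT xN by auto
    then have "x \<in> adjoin L ?M {T}" using xF p unfolding sep_cl_iff[OF F(1)] by blast
    then show ?thesis using algebraic_in_transcendental_extension[OF M(1) MN] xN(1) by blast
  qed
  then show ?thesis unfolding sep_cl_iff[OF K] using xN by blast
qed

abbreviation "Ka \<equiv> adjoin L K {a}"

lemma Ka: "subfield Ka L" "K \<subseteq> Ka" "a \<in> Ka" "Ka \<subseteq> N"
  using adjoin_simps[OF KL, of "{a}"] adjoin_alg_cl[OF K, of "{a}"] a by auto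

text \<open>A value preserving automorphism over \<open>K(a)\<close> fixes \<open>a\<close>, so it lifts to \<open>K(T)\<close> and fixes \<open>IC\<close>.\<close>

lemma IC_in_hens_Ka: "IC \<subseteq> hens Ka"
proof
  fix x assume x: "x \<in> IC"
  have "x \<in> sep_cl Ka" using IC_separable[OF x] sep_cl_base_mono[OF K Ka(1,2)] by blast
  moreover have "\<tau> x = x" if t: "\<tau> \<in> value_automorphisms Ka" for \<tau>
  proof -
    have tK: "\<tau> \<in> value_automorphisms K"
      using t Gal_closure_mono[OF K Ka(1,2,4)] alg_cl_eq[OF K Ka(1,2,4)] by (auto simp: value_automorphisms_def)
    have "\<tau> a = a" using Gal_closureD(2)[OF Ka(1) value_automorphismsD(1)[OF t] Ka(3)] .
    then obtain \<rho> where "\<rho> \<in> value_automorphisms F" "\<And>x. x \<in> N \<Longrightarrow> \<rho> x = \<tau> x"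
      using lift_automorphism[OF tK] close_a by metis
    then show ?thesis using x IC(2,3) hens_iff[OF F(1)] by (metis subsetD)
  qed
  ultimately show "x \<in> hens Ka" using hens_iff[OF Ka(1)] by blast
qed

lemma hens_Ka: "hens Ka = adjoin L IC {a}"
proof (rule hens_adjoin[OF K a(1) IC(1) K_IC IC_in_hens_Ka])
  fix \<rho> z assume "\<rho> \<in> Gal_closure L K" "\<And>h. h \<in> IC \<Longrightarrow> \<rho> h = h" "z \<in> N"
  then show "v (\<rho> z) = v z" using hens_henselian[OF K] hens_K_IC by blast
qed

lemma adjoin_aT: "adjoin L K {a, T} = adjoin L F {a}"
proof (rule subset_antisym)
  note A = adjoin_simps[OF F(4), of "{a}"] and B = adjoin_simps[OF KL, of "{a, T}"]
  show "adjoin L K {a, T} \<subseteq> adjoin L F {a}" using B(4)[of "adjoin L F {a}"] A F a T by auto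
  have "F \<subseteq> adjoin L K {a, T}" using adjoin_simps(4)[OF KL _, of "{T}" "adjoin L K {a, T}"] B a T by auto
  then show "adjoin L F {a} \<subseteq> adjoin L K {a, T}" using A(4)[of "adjoin L K {a, T}"] B a T by auto
qed

lemma hens_KaT: "hens (adjoin L K {a, T}) = adjoin L (hens F) {a}"
  unfolding adjoin_aT
proof (rule hens_adjoin[OF F(1)])
  note h = hens_subfield[OF F(1)] and A = adjoin_simps[OF F(4), of "{a}"]
  show "a \<in> alg_cl F" using a alg_cl_F by simp
  show "subfield (hens F) L" "F \<subseteq> hens F" using h by auto
  have "adjoin L F {a} \<subseteq> carrier L" using A(1) a subfieldE(3) by blast
  then show "hens F \<subseteq> hens (adjoin L F {a})" using hens_mono[OF F(1) A(1,2)] a alg_cl_F by simp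
  fix \<rho> z assume "\<rho> \<in> Gal_closure L F" "\<And>h. h \<in> hens F \<Longrightarrow> \<rho> h = h" "z \<in> alg_cl F"
  then show "v (\<rho> z) = v z" using hens_henselian[OF F(1)] by blast
qed

text \<open>The conjugates of \<open>a\<close> over the implicit constant field are images of \<open>a\<close> under automorphisms that preserve the value
  and fix \<open>T\<close>; so they are close to \<open>a\<close>.\<close>

lemma degree_over_IC: "degree (Irr IC a) \<le> num_close_conjugates L v K a \<gamma>"
proof -
  note D = Irr_dvd_mono[OF K IC(1) K_IC a(2,3)]
  note J = Irr_props[OF IC(1) a(2) D(1)]
  have cl: "close r" if r: "r \<in># roots (Irr IC a)" for r
  proof -
    have rr: "r \<in> carrier L" "eval (Irr IC a) r = \<zero>" using r roots_mem_iff_is_root[OF J(2)] by (auto simp: is_root_def)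
    have aIC: "a \<in> alg_cl IC" using a D(1) by (simp add: alg_cl_iff)
    obtain \<rho> where rho: "\<rho> \<in> Gal_closure L IC" "\<rho> a = r" using conjugate_exists[OF IC(1) aIC rr] by metis
    have rK: "\<rho> \<in> Gal_closure L K" using Gal_closure_mono[OF K IC(1) K_IC IC(2)] rho(1) by blast
    obtain g where "g \<in> value_automorphisms F" "\<rho> a = g a"
    proof (rule conjugates_over_fixed_field[OF K _ _ _ rK _ a(1), of "value_automorphisms F"])
      show "value_automorphisms F \<subseteq> Gal_closure L K" using restrict_automorphism(1) value_automorphismsD(1) by blast
      show "id \<in> value_automorphisms F" using id_value_automorphisms[OF F(1)] .
      show "g \<circ> h \<in> value_automorphisms F" if "g \<in> value_automorphisms F" "h \<in> value_automorphisms F" for g h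
        using value_automorphisms_comp[OF F(1) that] .
      show "\<rho> z = z" if z: "z \<in> sep_cl K" "\<And>g. g \<in> value_automorphisms F \<Longrightarrow> g z = z" for z
      proof -
        have "z \<in> hens F" using z sep_cl_base_mono[OF K F(1,2)] hens_iff[OF F(1)] by blast
        then have "z \<in> IC" using z(1) sep_cl_subfield(3)[OF K] IC_iff by blast
        then show ?thesis using Gal_closureD(2)[OF IC(1) rho(1)] by blast
      qed
    qed
    then show ?thesis using restrict_automorphism(2) rho(2) by simp
  qed
  have "filter_mset close (roots (Irr IC a)) \<subseteq># filter_mset close (roots (Irr K a))"
    using multiset_filter_mono[OF D(5)] .
  moreover have "filter_mset close (roots (Irr IC a)) = roots (Irr IC a)"
    using cl by (simp add: filter_mset_eq_conv)
  ultimately have "size (roots (Irr IC a)) \<le> size (filter_mset close (roots (Irr K a)))"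
    using size_mset_mono by fastforce
  then show ?thesis using roots_over_carrier[OF J(2)] unfolding splitted_def num_close_conjugates_def by (simp add: close_def[abs_def])
qed

subsection \<open>Independence of the values of polynomials in \<open>T\<close>\<close>

text \<open>Write an element of \<open>N[T]\<close> as a polynomial in \<open>y = T - a\<close>. Its top is the largest exponent at which the least value is
  attained. It behaves like a degree: additive on products, and never subject to cancellation in sums of elements with
  different tops.\<close>

definition top :: "'a \<Rightarrow> nat \<Rightarrow> bool" where
  "top z s \<longleftrightarrow> (\<exists>p\<in>carrier (N[X]). z = eval p y \<and> dominant (>) y p s)"

lemma y_minus:
  assumes "r \<in> N"
  shows "v r < Fin \<gamma> \<Longrightarrow> v (y \<ominus> r) = v r" "Fin \<gamma> \<le> v r \<Longrightarrow> v (y \<ominus> r) = Fin \<gamma>"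
proof -
  have r: "r \<in> carrier L" "a \<oplus> r \<in> N" using assms N_carrier a subringE(7)[OF subfieldE(1)[OF N(1)]] by auto
  have e: "y \<ominus> r = T \<ominus> (a \<oplus> r)" unfolding y_def using T a r by algebra
  have "a \<ominus> (a \<oplus> r) = \<ominus> r" using a r by algebra
  then have "v (a \<ominus> (a \<oplus> r)) = v r" using r by simp
  then show "v r < Fin \<gamma> \<Longrightarrow> v (y \<ominus> r) = v r" "Fin \<gamma> \<le> v r \<Longrightarrow> v (y \<ominus> r) = Fin \<gamma>"
    unfolding e using v_T_minus[OF r(2)] by (auto simp: close_def)
qed

lemma mult_gt:
  assumes "p \<in> carrier (poly_ring L)" "dominant (>) y p s" "q \<in> carrier (poly_ring L)" "dominant (>) y q t"
  shows "dominant (>) y (p \<otimes>\<^bsub>poly_ring L\<^esub> q) (s + t)"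
    "v (term_at y (p \<otimes>\<^bsub>poly_ring L\<^esub> q) (s + t)) = v (term_at y p s \<otimes> term_at y q t)"
  by (rule dominant_mult[where Q = "(>)", OF assms y(1)]; auto)+

text \<open>The value of \<open>y - r\<close> is the minimum of the values of its terms, and both sides are multiplicative.\<close>

lemma gauss_exists:
  assumes "p \<in> carrier (N[X])" "p \<noteq> []"
  shows "\<exists>s. dominant (>) y p s \<and> v (eval p y) = v (term_at y p s)"
  using K assms
proof (induction p rule: linear_factor_induct_alg_cl)
  case (const c)
  then have "c \<in> carrier L" using N by blast
  then show ?case using dominant_const(2)[of c y] const y by (intro exI[of _ 0]) (simp add: term_at_def)
next
  case (linear r q)
  have rL: "r \<in> carrier L" using N_carrier[OF linear(1)] .
  have qL: "q \<in> carrier (poly_ring L)" using subfield_polyE(3)[OF N(1) linear(2)] .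
  note lp = linear_poly[OF rL]
  obtain t where t: "dominant (>) y q t" "v (eval q y) = v (term_at y q t)" using linear.IH by blast
  have "\<exists>s. dominant (>) y [\<one>, \<ominus> r] s \<and> v (y \<ominus> r) = v (term_at y [\<one>, \<ominus> r] s)"
  proof (cases "v r < v y")
    case True
    then show ?thesis using dominant_linear(3)[OF rL y(1,3) True] y_minus(1)[OF linear(1)] y(2) term_at_linear[OF rL y(1)] rL
      by (intro exI[of _ 0]) simp
  next
    case False
    then show ?thesis using dominant_linear(4)[OF rL y(1,3)] y_minus(2)[OF linear(1)] y(2) term_at_linear[OF rL y(1)]
      by (intro exI[of _ 1]) simp
  qed
  then obtain s where s: "dominant (>) y [\<one>, \<ominus> r] s" "v (y \<ominus> r) = v (term_at y [\<one>, \<ominus> r] s)" by blast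
  have "v (eval ([\<one>, \<ominus> r] \<otimes>\<^bsub>poly_ring L\<^esub> q) y) = v (y \<ominus> r) + v (eval q y)"
    using eval_mult[OF lp qL y(1)] eval_linear[OF rL y(1)] v_mult eval_closed[OF qL y(1)] rL y(1) by simp
  also have "\<dots> = v (term_at y [\<one>, \<ominus> r] s \<otimes> term_at y q t)"
    using s t v_mult term_at_closed[OF lp y(1)] term_at_closed[OF qL y(1)] by simp
  finally show ?case using mult_gt[OF lp s(1) qL t(1)] by metis
qed

lemma gauss:
  assumes "p \<in> carrier (N[X])" "dominant (>) y p s" shows "v (eval p y) = v (term_at y p s)"
proof -
  have "p \<noteq> []" using assms(2) y by (auto simp: dominant_def term_at_def)
  then obtain t where t: "dominant (>) y p t" "v (eval p y) = v (term_at y p t)" using gauss_exists[OF assms(1)] by blast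
  have "v (term_at y p t) = v (term_at y p s)" using t(1) assms(2) by (intro antisym) (auto simp: dominant_def)
  then show ?thesis using t(2) by simp
qed

lemma top_carrier: "top z s \<Longrightarrow> z \<in> carrier L \<and> z \<noteq> \<zero>"
proof -
  assume "top z s"
  then obtain p where p: "p \<in> carrier (N[X])" "z = eval p y" "dominant (>) y p s" by (auto simp: top_def)
  have pL: "p \<in> carrier (poly_ring L)" using subfield_polyE(3)[OF N(1) p(1)] .
  have "v z < Pinf" unfolding p(2) gauss[OF p(1,3)] using v_less_Pinf[OF term_at_closed[OF pL y(1)]] p(3) by (simp add: dominant_def)
  then show ?thesis using eval_closed[OF pL y(1)] p(2) by auto
qed

lemma top_mult: assumes "top z s" "top w t" shows "top (z \<otimes> w) (s + t)"
proof -
  obtain p where p: "p \<in> carrier (N[X])" "z = eval p y" "dominant (>) y p s" using assms by (auto simp: top_def)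
  obtain q where q: "q \<in> carrier (N[X])" "w = eval q y" "dominant (>) y q t" using assms by (auto simp: top_def)
  have "dominant (>) y (p \<otimes>\<^bsub>N[X]\<^esub> q) (s + t)"
    using mult_gt(1)[OF subfield_polyE(3)[OF N(1) p(1)] p(3) subfield_polyE(3)[OF N(1) q(1)] q(3)] poly_mult_shell[where M = N] by simp
  moreover have "z \<otimes> w = eval (p \<otimes>\<^bsub>N[X]\<^esub> q) y" using MX_eval(1)[OF N(1) p(1) q(1) y(1)] p(2) q(2) by simp
  ultimately show ?thesis unfolding top_def using MX_closed(1)[OF N(1) p(1) q(1)] by blast
qed

lemma top_const: "c \<in> N \<Longrightarrow> c \<noteq> \<zero> \<Longrightarrow> top c 0"
  unfolding top_def using N_carrier[of c] y dominant_const(2)[of c y]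
  by (intro bexI[of _ "[c]"]) (auto simp: univ_poly_carrier[symmetric] polynomial_def)

lemma N_linear: "r \<in> N \<Longrightarrow> [\<one>, \<ominus> r] \<in> carrier (N[X])"
  using subringE(3,5)[OF subfieldE(1)[OF N(1)]] by (auto simp: univ_poly_carrier[symmetric] polynomial_def)

lemma top_y_power: "top (y [^] (n::nat)) n"
proof (induct n)
  case 0 show ?case using top_const subringE(3)[OF subfieldE(1)[OF N(1)]] by simp
next
  case (Suc n)
  have z: "\<zero> \<in> N" using subringE(2)[OF subfieldE(1)[OF N(1)]] .
  have "eval [\<one>, \<ominus> \<zero>] y = y" "dominant (>) y [\<one>, \<ominus> \<zero>] 1"
    using y eval_linear[of \<zero> y] dominant_linear(4)[of \<zero> y] by (auto simp: minus_eq)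
  then have "top y 1" unfolding top_def using N_linear[OF z] by metis
  then have "top (y [^] n \<otimes> y) (n + 1)" using top_mult[OF Suc] by blast
  then show ?case by simp
qed

lemma top_add:
  assumes "top z s" "top w t" "v z < v w \<or> v z = v w \<and> t < s"
  shows "top (z \<oplus> w) s" "v (z \<oplus> w) = v z"
proof -
  obtain p where p: "p \<in> carrier (N[X])" "z = eval p y" "dominant (>) y p s" using assms by (auto simp: top_def)
  obtain q where q: "q \<in> carrier (N[X])" "w = eval q y" "dominant (>) y q t" using assms by (auto simp: top_def)
  have pqL: "p \<in> carrier (poly_ring L)" "q \<in> carrier (poly_ring L)" using subfield_polyE(3)[OF N(1)] p q by auto
  let ?h = "p \<oplus>\<^bsub>N[X]\<^esub> q"
  have h: "?h \<in> carrier (N[X])" "eval ?h y = z \<oplus> w"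
    using MX_closed(2)[OF N(1) p(1) q(1)] MX_eval(2)[OF N(1) p(1) q(1) y(1)] p q by auto
  note pc = term_at_closed[OF pqL(1) y(1)] and qc = term_at_closed[OF pqL(2) y(1)]
  have th: "term_at y ?h i = term_at y p i \<oplus> term_at y q i" for i
    unfolding term_at_def univ_poly_add using poly_add_coeff subfield_polyE(2)[OF N(1)] p q
      coeff_closed[OF pqL(1)] coeff_closed[OF pqL(2)] y(1) by (simp add: l_distr)
  have vz: "v z = v (term_at y p s)" and vw: "v w = v (term_at y q t)" using gauss p q by auto
  have pd: "v z \<le> v (term_at y p i)" "i > s \<Longrightarrow> v z < v (term_at y p i)" for i using p(3) unfolding vz dominant_def by auto
  have qd: "v w \<le> v (term_at y q i)" "i > t \<Longrightarrow> v w < v (term_at y q i)" for i using q(3) unfolding vw dominant_def by auto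
  have q2: "v z \<le> v (term_at y q i)" "i \<ge> s \<Longrightarrow> v z < v (term_at y q i)" for i
    using assms(3) qd(1)[of i] qd(2)[of i] by auto
  have s: "v (term_at y ?h s) = v z" unfolding th using v_add_eq[OF pc qc, of s s] q2(2)[of s] vz by simp
  have "dominant (>) y ?h s"
    unfolding dominant_def s
  proof (intro conjI allI impI)
    show "term_at y ?h s \<noteq> \<zero>" using s top_carrier[OF assms(1)] v_less_Pinf by fastforce
    show "v z \<le> v (term_at y ?h i)" for i unfolding th using v_add_ge pc qc pd(1) q2(1) by blast
    show "v z < v (term_at y ?h i)" if "i > s" for i unfolding th using v_add_gt pc qc pd(2)[OF that] q2(2)[of i] that by simp
  qed
  then show "top (z \<oplus> w) s" "v (z \<oplus> w) = v z" using h gauss[OF h(1)] s unfolding top_def by metis+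
qed

lemma top_add_distinct:
  assumes "top z s" "top w t" "s \<noteq> t"
  shows "top (z \<oplus> w) s \<or> top (z \<oplus> w) t" "v (z \<oplus> w) \<le> v z" "v (z \<oplus> w) \<le> v w"
proof -
  have c: "z \<in> carrier L" "w \<in> carrier L" using top_carrier assms by auto
  have e: "z \<oplus> w = w \<oplus> z" using c a_comm by simp
  consider "v z < v w \<or> v z = v w \<and> t < s" | "v w < v z \<or> v w = v z \<and> s < t" using assms(3) by fastforce
  then have "(top (z \<oplus> w) s \<or> top (z \<oplus> w) t) \<and> v (z \<oplus> w) \<le> v z \<and> v (z \<oplus> w) \<le> v w"
  proof cases
    case 1
    then show ?thesis using top_add[OF assms(1,2) 1] by auto
  next
    case 2
    then show ?thesis unfolding e using top_add[OF assms(2,1) 2] by auto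
  qed
  then show "top (z \<oplus> w) s \<or> top (z \<oplus> w) t" "v (z \<oplus> w) \<le> v z" "v (z \<oplus> w) \<le> v w" by auto
qed

text \<open>The factor \<open>T - r = y - (r - a)\<close> has top \<open>1\<close> if \<open>r\<close> is close to \<open>a\<close> and top \<open>0\<close> otherwise, and tops add up.\<close>

lemma top_roots:
  assumes "p \<in> carrier (N[X])" "p \<noteq> []"
  shows "top (eval p T) (size (filter_mset close (roots p)))"
  using K assms
proof (induction p rule: linear_factor_induct_alg_cl)
  case (const c)
  then have "c \<in> carrier L" using N by blast
  moreover have "roots [c] = {#}" using degree_zero_imp_empty_roots[of "[c]"] const \<open>c \<in> carrier L\<close>
    by (auto simp: univ_poly_carrier[symmetric] polynomial_def)
  ultimately show ?case using top_const[OF const] T by simp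
next
  case (linear r q)
  have rL: "r \<in> carrier L" using N_carrier[OF linear(1)] .
  have qL: "q \<in> carrier (poly_ring L)" using subfield_polyE(3)[OF N(1) linear(2)] .
  have ra: "r \<ominus> a \<in> N" "r \<ominus> a \<in> carrier L" using linear(1) a rL subringE(5,7)[OF subfieldE(1)[OF N(1)]] by (auto simp: minus_eq)
  have e: "T \<ominus> r = eval [\<one>, \<ominus> (r \<ominus> a)] y"
    unfolding eval_linear[OF ra(2) y(1)] unfolding y_def using T a rL by algebra
  have vr: "v (r \<ominus> a) = v (a \<ominus> r)" using v_minus_commute rL a by blast
  have "top (T \<ominus> r) (if close r then 1 else 0)"
    unfolding top_def e
  proof (rule bexI[OF _ N_linear[OF ra(1)]], rule conjI[OF refl])
    show "dominant (>) y [\<one>, \<ominus> (r \<ominus> a)] (if close r then 1 else 0)"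
      using dominant_linear(3,4)[OF ra(2) y(1,3)] vr y(2) by (auto simp: close_def not_le)
  qed
  then have "top ((T \<ominus> r) \<otimes> eval q T) ((if close r then 1 else 0) + size (filter_mset close (roots q)))"
    using top_mult linear.IH by blast
  moreover have "eval ([\<one>, \<ominus> r] \<otimes>\<^bsub>poly_ring L\<^esub> q) T = (T \<ominus> r) \<otimes> eval q T"
    using eval_mult[OF linear_poly[OF rL] qL T] eval_linear[OF rL T] by simp
  moreover have "roots ([\<one>, \<ominus> r] \<otimes>\<^bsub>poly_ring L\<^esub> q) = add_mset r (roots q)"
    using poly_mult_degree_one_monic_imp_same_roots[OF rL qL linear(3)] .
  ultimately show ?case by (cases "close r") (simp_all del: eval.simps)
qed

abbreviation "j \<equiv> num_close_conjugates L v K a \<gamma>"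

lemma j_eq: "j = size (filter_mset close (roots (Irr K a)))"
  by (simp add: num_close_conjugates_def close_def[abs_def])

lemma j_pos: "j > 0"
proof -
  note I = Irr_props[OF K a(2,3)]
  have "a \<in># roots (Irr K a)" using roots_mem_iff_is_root[OF I(2)] I(3,4) a by (simp add: is_root_def)
  then have "a \<in># filter_mset close (roots (Irr K a))" using close_a by simp
  then show ?thesis unfolding j_eq by (metis gr0I size_eq_0_iff_empty empty_not_add_mset multi_member_split)
qed

text \<open>Expand a polynomial over \<open>K\<close> in powers of the minimal polynomial of \<open>a\<close>. The coefficients of the expansion have
  degree less than that of \<open>a\<close>, so by minimality none of their roots is close to \<open>a\<close>, and their top is \<open>0\<close>; the minimal
  polynomial itself has top \<open>j\<close>.\<close>

lemma top_dvd:
  assumes "g \<in> carrier (K[X])" "g \<noteq> []"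
  shows "\<exists>s. top (eval g T) s \<and> j dvd s"
  using assms
proof (induction "degree g" arbitrary: g rule: less_induct)
  case less
  let ?Q = "Irr K a"
  note I = Irr_props[OF K a(2,3)]
  have KN: "p \<in> carrier (N[X])" if "p \<in> carrier (K[X])" for p
    using that N(2) by (auto simp: univ_poly_carrier[symmetric] polynomial_def)
  have topQ: "top (eval ?Q T) j" using top_roots[OF KN[OF I(1)] I(3)] unfolding j_eq .
  have top0: "top (eval r T) 0" if r: "r \<in> carrier (K[X])" "r \<noteq> []" "degree r < degree ?Q" for r
  proof -
    have rL: "r \<in> carrier (poly_ring L)" using subfield_polyE(3)[OF K r(1)] .
    have "\<not> close c" if c: "c \<in># roots r" for c
    proof
      assume cl: "close c"
      have cc: "c \<in> carrier L" "eval r c = \<zero>" using c roots_mem_iff_is_root[OF rL] by (auto simp: is_root_def)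
      note d = degree_Irr_le[OF K cc(1) r(1,2) cc(2)]
      have "c \<in> N" using d(1) cc by (simp add: alg_cl_iff)
      then show False using degree_close[OF _ cl] d(2) r(3) by simp
    qed
    then have "filter_mset close (roots r) = {#}" by (induct "roots r") auto
    then show ?thesis using top_roots[OF KN[OF r(1)] r(2)] by (metis size_empty)
  qed
  obtain q r where qr: "q \<in> carrier (K[X])" "r \<in> carrier (K[X])" "g = (?Q \<otimes>\<^bsub>K[X]\<^esub> q) \<oplus>\<^bsub>K[X]\<^esub> r"
    "r = [] \<or> degree r < degree ?Q"
    using field_long_division_theorem_shell[OF K less.prems(1) I(1)] I(3) by (auto simp: univ_poly_zero)
  have Qq: "?Q \<otimes>\<^bsub>K[X]\<^esub> q \<in> carrier (K[X])" using MX_closed(1)[OF K I(1) qr(1)] .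
  have ev: "eval g T = (eval ?Q T \<otimes> eval q T) \<oplus> eval r T"
    unfolding qr(3) using MX_eval(2)[OF K Qq qr(2) T] MX_eval(1)[OF K I(1) qr(1) T] by simp
  have ec: "eval ?Q T \<in> carrier L" "eval q T \<in> carrier L" "eval r T \<in> carrier L"
    using MX_eval(4)[OF K _ _ T] I(1) qr by auto
  show ?case
  proof (cases "q = []")
    case True
    then have "eval g T = eval r T" using ev ec by simp
    moreover have "r \<noteq> []"
    proof
      assume "r = []"
      interpret KX: ring "K[X]" using univ_poly_is_ring[OF subfieldE(1)[OF K]] .
      have "g = ?Q \<otimes>\<^bsub>K[X]\<^esub> \<zero>\<^bsub>K[X]\<^esub> \<oplus>\<^bsub>K[X]\<^esub> \<zero>\<^bsub>K[X]\<^esub>"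
        using qr(3) True \<open>r = []\<close> unfolding univ_poly_zero by blast
      then have "g = \<zero>\<^bsub>K[X]\<^esub>" using KX.r_null[OF I(1)] by (metis KX.r_zero KX.zero_closed)
      then have "g = []" by (simp add: univ_poly_zero)
      then show False using less.prems by simp
    qed
    ultimately show ?thesis using top0[OF qr(2)] qr(4) by (intro exI[of _ 0]) simp
  next
    case False
    have dQq: "degree (?Q \<otimes>\<^bsub>K[X]\<^esub> q) = degree ?Q + degree q"
      using poly_mult_degree_eq[OF subfieldE(1)[OF K], of ?Q q] I(1,3) qr(1) False by (simp add: univ_poly_mult univ_poly_carrier)
    have "degree g = degree ?Q + degree q"
    proof (cases "r = []")
      case True
      interpret KX: ring "K[X]" using univ_poly_is_ring[OF subfieldE(1)[OF K]] .
      have "g = ?Q \<otimes>\<^bsub>K[X]\<^esub> q" using qr(3) True KX.r_zero[OF Qq] by (simp add: univ_poly_zero)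
      then show ?thesis using dQq by simp
    next
      case r: False
      have "degree (?Q \<otimes>\<^bsub>K[X]\<^esub> q) \<noteq> degree r" using dQq qr(4) r by simp
      then have "degree g = max (degree (?Q \<otimes>\<^bsub>K[X]\<^esub> q)) (degree r)"
        unfolding qr(3) univ_poly_add using poly_add_degree_eq[OF subfieldE(1)[OF K]] Qq qr(2) univ_poly_carrier by blast
      then show ?thesis using dQq qr(4) r by simp
    qed
    then have "degree q < degree g" using I(5) by simp
    then obtain s where s: "top (eval q T) s" "j dvd s" using less.hyps[OF _ qr(1) False] by blast
    have t: "top (eval ?Q T \<otimes> eval q T) (j + s)" using top_mult[OF topQ s(1)] .
    show ?thesis
    proof (cases "r = []")
      case True
      then have "eval g T = eval ?Q T \<otimes> eval q T" using ev ec by simp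
      then show ?thesis using t s(2) by (intro exI[of _ "j + s"]) simp
    next
      case r: False
      have "top (eval g T) (j + s) \<or> top (eval g T) 0"
        unfolding ev using top_add_distinct(1)[OF t top0[OF qr(2) r]] qr(4) r j_pos by simp
      then show ?thesis using s(2) by (meson dvd_0_right dvd_add dvd_refl)
    qed
  qed
qed

text \<open>So the products \<open>g\<^sub>i(T) y\<^sup>i\<close> with \<open>i < j\<close> have distinct tops modulo \<open>j\<close>, and no cancellation occurs between them.\<close>

lemma independent_over_polynomials:
  assumes g: "\<And>i. i < j \<Longrightarrow> g i \<in> carrier (K[X])" and m: "m \<le> j"
  defines "S \<equiv> \<lambda>m. \<Oplus>i\<in>{..<m}. eval (g i) T \<otimes> y [^] i"
  shows "(\<forall>i<m. v (S m) \<le> v (eval (g i) T \<otimes> y [^] i)) \<and> (S m = \<zero> \<or> (\<exists>s. top (S m) s \<and> s mod j < m))"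
  using m
proof (induct m)
  case 0 show ?case by (simp add: S_def)
next
  case (Suc m)
  let ?t = "\<lambda>i. eval (g i) T \<otimes> y [^] i"
  have gc: "eval (g i) T \<in> carrier L" if "i < j" for i using MX_eval(4)[OF K g[OF that] g[OF that] T] .
  have tc: "?t i \<in> carrier L" if "i < j" for i using gc[OF that] y by simp
  have IH: "\<forall>i<m. v (S m) \<le> v (?t i)" "S m = \<zero> \<or> (\<exists>s. top (S m) s \<and> s mod j < m)" using Suc by auto
  have Sc: "S m \<in> carrier L" unfolding S_def using tc Suc.prems by (intro finsum_closed) auto
  have mj: "m < j" using Suc.prems by simp
  have e: "S (Suc m) = S m \<oplus> ?t m"
    unfolding S_def lessThan_Suc using tc Suc.prems Sc[unfolded S_def] by (subst finsum_insert) (auto simp: a_comm)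
  show ?case
  proof (cases "g m = []")
    case True
    then have "?t m = \<zero>" using y by simp
    then show ?thesis unfolding e using IH Sc by (auto simp: less_Suc_eq)
  next
    case False
    obtain s where s: "top (eval (g m) T) s" "j dvd s" using top_dvd[OF g[OF mj] False] by blast
    have tm: "top (?t m) (s + m)" using top_mult[OF s(1) top_y_power] .
    have mod: "(s + m) mod j = m" using s(2) mj by auto
    show ?thesis
    proof (cases "S m = \<zero>")
      case True
      then have "v (?t i) = Pinf" if "i < m" for i using IH(1) that by simp
      moreover have "S (Suc m) = ?t m" unfolding e True using tc[OF mj] by simp
      ultimately show ?thesis using tm mod by (auto simp: less_Suc_eq intro!: exI[of _ "s + m"])
    next
      case False
      then obtain s' where s': "top (S m) s'" "s' mod j < m" using IH(2) by blast
      have "s' \<noteq> s + m" using s'(2) mod by auto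
      note A = top_add_distinct[OF s'(1) tm this]
      have "v (S m \<oplus> ?t m) \<le> v (?t i)" if "i < Suc m" for i
      proof (cases "i = m")
        case False
        then have "i < m" using that by simp
        then show ?thesis using IH(1) order_trans[OF A(2)] by blast
      qed (use A(3) in simp)
      moreover have "\<exists>s. top (S m \<oplus> ?t m) s \<and> s mod j < Suc m" using A(1) less_SucI[OF s'(2)] mod lessI[of m] by metis
      ultimately show ?thesis unfolding e by blast
    qed
  qed
qed

lemma common_denominator:
  assumes "\<And>i. i < m \<Longrightarrow> f i \<in> F"
  shows "\<exists>h\<in>carrier (K[X]). eval h T \<noteq> \<zero> \<and> (\<forall>i<(m::nat). \<exists>g\<in>carrier (K[X]). eval h T \<otimes> f i = eval g T)"
  using assms
proof (induct m)
  case 0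
  have "[\<one>] \<in> carrier (K[X])"
    using subringE(3)[OF subfieldE(1)[OF K]] by (auto simp: univ_poly_carrier[symmetric] polynomial_def)
  moreover have "eval [\<one>] T \<noteq> \<zero>" using T by simp
  ultimately show ?case by blast
next
  case (Suc m)
  then obtain h where h: "h \<in> carrier (K[X])" "eval h T \<noteq> \<zero>" "\<And>i. i < m \<Longrightarrow> \<exists>g\<in>carrier (K[X]). eval h T \<otimes> f i = eval g T" by auto
  obtain p q where pq: "f m = eval p T \<otimes> inv (eval q T)" "p \<in> carrier (K[X])" "q \<in> carrier (K[X])" "eval q T \<noteq> \<zero>"
    using Suc.prems[of m] unfolding adjoin_fractions[OF K T] by blast
  have ec: "eval w T \<in> carrier L" if "w \<in> carrier (K[X])" for w using MX_eval(4)[OF K that that T] .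
  have em: "eval (u \<otimes>\<^bsub>K[X]\<^esub> w) T = eval u T \<otimes> eval w T" if "u \<in> carrier (K[X])" "w \<in> carrier (K[X])" for u w
    using MX_eval(1)[OF K that T] .
  let ?h = "q \<otimes>\<^bsub>K[X]\<^esub> h"
  have hh: "?h \<in> carrier (K[X])" using MX_closed(1)[OF K pq(3) h(1)] .
  have "eval ?h T \<noteq> \<zero>" using em[OF pq(3) h(1)] nonzero_mult ec pq h by simp
  moreover have "\<exists>g\<in>carrier (K[X]). eval ?h T \<otimes> f i = eval g T" if i: "i < Suc m" for i
  proof (cases "i = m")
    case True
    have "eval ?h T \<otimes> f m = eval h T \<otimes> eval p T \<otimes> (eval q T \<otimes> inv (eval q T))"
      unfolding em[OF pq(3) h(1)] pq(1) using ec[OF h(1)] ec[OF pq(2)] ec[OF pq(3)] inv_simps(1)[OF ec[OF pq(3)] pq(4)] by (simp add: m_ac)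
    also have "\<dots> = eval (h \<otimes>\<^bsub>K[X]\<^esub> p) T" using inv_simps(2)[OF ec[OF pq(3)] pq(4)] em[OF h(1) pq(2)] ec h pq by simp
    finally show ?thesis using True MX_closed(1)[OF K h(1) pq(2)] by blast
  next
    case False
    then obtain g where g: "g \<in> carrier (K[X])" "eval h T \<otimes> f i = eval g T" using h(3) i by (metis less_antisym)
    have fi: "f i \<in> carrier L" using Suc.prems[OF i] F(4) by blast
    have "eval ?h T \<otimes> f i = eval (q \<otimes>\<^bsub>K[X]\<^esub> g) T"
      unfolding em[OF pq(3) h(1)] em[OF pq(3) g(1)] g(2)[symmetric] using ec h pq fi by (simp add: m_assoc)
    then show ?thesis using MX_closed(1)[OF K pq(3) g(1)] by blast
  qed
  ultimately show ?case using hh by blast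
qed

lemma independent_over_F:
  assumes f: "\<And>i. i < j \<Longrightarrow> f i \<in> F" and i: "i < j"
  shows "v (\<Oplus>i\<in>{..<j}. f i \<otimes> y [^] i) \<le> v (f i \<otimes> y [^] i)"
proof -
  obtain h where h: "h \<in> carrier (K[X])" "eval h T \<noteq> \<zero>" "\<forall>i<j. \<exists>g\<in>carrier (K[X]). eval h T \<otimes> f i = eval g T"
    using common_denominator[of j f] f by blast
  then obtain g where g: "\<And>i. i < j \<Longrightarrow> g i \<in> carrier (K[X])" "\<And>i. i < j \<Longrightarrow> eval h T \<otimes> f i = eval (g i) T" by metis
  have hc: "eval h T \<in> carrier L" using MX_eval(4)[OF K h(1,1) T] .
  have fc: "f i \<in> carrier L" if "i < j" for i using f[OF that] F(4) by blast
  have t: "eval (g i) T \<otimes> y [^] i = eval h T \<otimes> (f i \<otimes> y [^] i)" if "i < j" for i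
    unfolding g(2)[OF that, symmetric] using hc fc[OF that] y by (simp add: m_assoc)
  have c: "f i \<otimes> y [^] i \<in> carrier L" if "i < j" for i using fc[OF that] y by simp
  have "(\<Oplus>i\<in>{..<j}. eval (g i) T \<otimes> y [^] i) = (\<Oplus>i\<in>{..<j}. eval h T \<otimes> (f i \<otimes> y [^] i))"
    using t hc c by (intro finsum_cong') auto
  also have "\<dots> = eval h T \<otimes> (\<Oplus>i\<in>{..<j}. f i \<otimes> y [^] i)" using hc c by (subst finsum_rdistr) auto
  finally have e: "(\<Oplus>i\<in>{..<j}. eval (g i) T \<otimes> y [^] i) = eval h T \<otimes> (\<Oplus>i\<in>{..<j}. f i \<otimes> y [^] i)" .
  have "v (eval h T \<otimes> (\<Oplus>i\<in>{..<j}. f i \<otimes> y [^] i)) \<le> v (eval h T \<otimes> (f i \<otimes> y [^] i))"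
    using independent_over_polynomials[of g j, OF g(1) order_refl] i unfolding e t[OF i, symmetric] by blast
  then show ?thesis using v_mult_cancel(3)[OF _ c[OF i] hc h(2)] c by (simp add: finsum_closed Pi_def)
qed

text \<open>Immediacy carries the independence over to the henselization: replace each coefficient by an approximation.\<close>

lemma independent_over_hens:
  assumes c: "\<And>i. i < j \<Longrightarrow> c i \<in> hens F" and i: "i < j"
  shows "v (\<Oplus>i\<in>{..<j}. c i \<otimes> y [^] i) \<le> v (c i \<otimes> y [^] i)"
proof (cases "\<forall>i<j. c i = \<zero>")
  case True
  then show ?thesis using i y by simp
next
  case False
  have cc: "c i \<in> carrier L" if "i < j" for i using c[OF that] subfieldE(3)[OF hens_subfield(1)[OF F(1)]] by blast
  have "\<forall>i<j. \<exists>u\<in>F. if c i = \<zero> then u = \<zero> else v (c i) < v (c i \<ominus> u)"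
    using hens_immediate[OF F(1)] c subringE(2)[OF subfieldE(1)[OF F(1)]] by (auto split: if_splits)
  then obtain u where u: "\<And>i. i < j \<Longrightarrow> u i \<in> F" "\<And>i. i < j \<Longrightarrow> if c i = \<zero> then u i = \<zero> else v (c i) < v (c i \<ominus> u i)" by metis
  have uc: "u i \<in> carrier L" if "i < j" for i using u(1)[OF that] F(4) by blast
  have yc: "y [^] (i::nat) \<in> carrier L" "y [^] i \<noteq> \<zero>" for i using y nonzero_pow by auto
  have vu: "v (u i \<otimes> y [^] i) = v (c i \<otimes> y [^] i)" if "i < j" for i
    using v_close_eq[OF cc[OF that] uc[OF that]] u(2)[OF that] v_mult[OF uc[OF that] yc(1)] v_mult[OF cc[OF that] yc(1)] by (auto split: if_splits)
  let ?C = "\<Oplus>i\<in>{..<j}. c i \<otimes> y [^] i" and ?U = "\<Oplus>i\<in>{..<j}. u i \<otimes> y [^] i" and ?D = "\<Oplus>i\<in>{..<j}. (c i \<ominus> u i) \<otimes> y [^] i"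
  have Uc: "?U \<in> carrier L" "?D \<in> carrier L" using uc cc yc by (auto intro!: finsum_closed)
  have "?U \<oplus> ?D = (\<Oplus>i\<in>{..<j}. u i \<otimes> y [^] i \<oplus> (c i \<ominus> u i) \<otimes> y [^] i)"
    using uc cc yc by (subst finsum_addf) auto
  also have "\<dots> = ?C"
  proof (rule finsum_cong')
    fix i assume "i \<in> {..<j}"
    then have k: "u i \<in> carrier L" "c i \<in> carrier L" using uc cc by auto
    show "u i \<otimes> y [^] i \<oplus> (c i \<ominus> u i) \<otimes> y [^] i = c i \<otimes> y [^] i" using k yc(1)[of i] by algebra
  qed (use cc yc in auto)
  finally have sum: "?U \<oplus> ?D = ?C" .
  obtain k where k: "k < j" "\<And>i. i < j \<Longrightarrow> v (c k \<otimes> y [^] k) \<le> v (c i \<otimes> y [^] i)"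
    using ex_is_arg_min_if_finite[of "{..<j}" "\<lambda>i. v (c i \<otimes> y [^] i)"] j_pos
    unfolding is_arg_min_def by (metis empty_iff finite_lessThan lessThan_iff not_less)
  have UC: "v ?U \<le> v (c i \<otimes> y [^] i)" if "i < j" for i using independent_over_F[of u, OF u(1) that] vu[OF that] by simp
  have kz: "c k \<otimes> y [^] k \<noteq> \<zero>"
  proof
    assume z: "c k \<otimes> y [^] k = \<zero>"
    obtain i where i: "i < j" "c i \<noteq> \<zero>" using False by blast
    then have "c i \<otimes> y [^] i \<noteq> \<zero>" using nonzero_mult cc yc by blast
    moreover have "v (c i \<otimes> y [^] i) = Pinf" using k(2)[OF i(1)] z by simp
    ultimately show False using v_zero_iff[of "c i \<otimes> y [^] i"] cc[OF i(1)] yc by simp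
  qed
  have kP: "v (c k \<otimes> y [^] k) < Pinf" using v_less_Pinf[OF _ kz] cc[OF k(1)] yc by simp
  have "v (c k \<otimes> y [^] k) < v ?D"
  proof (rule v_finsum_gt[OF _ _ kP])
    fix i assume "i \<in> {..<j}"
    then have i: "i < j" by simp
    show "(c i \<ominus> u i) \<otimes> y [^] i \<in> carrier L" using cc[OF i] uc[OF i] yc by simp
    show "v (c k \<otimes> y [^] k) < v ((c i \<ominus> u i) \<otimes> y [^] i)"
    proof (cases "c i = \<zero>")
      case True
      then have "(c i \<ominus> u i) \<otimes> y [^] i = \<zero>" using u(2)[OF i] yc by (simp add: minus_eq)
      then show ?thesis using kP by simp
    next
      case False
      then have "v (c i) < v (c i \<ominus> u i)" using u(2)[OF i] by simp
      then have "v (c i \<otimes> y [^] i) < v ((c i \<ominus> u i) \<otimes> y [^] i)"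
        using v_mult_cancel(2)[of "c i" "c i \<ominus> u i" "y [^] i"] cc[OF i] uc[OF i] yc m_comm by simp
      then show ?thesis using k(2)[OF i] by simp
    qed
  qed
  then have "v ?U < v ?D" using UC[OF k(1)] by simp
  then have "v ?C = v ?U" unfolding sum[symmetric] using v_add_eq Uc by blast
  then show ?thesis using UC[OF i] by simp
qed

end

section \<open>Valuation bases\<close>

context valued_field
begin

abbreviation "valuation_ring \<equiv> {x \<in> carrier L. v x \<ge> 0}"
abbreviation "valuation_ring_struct \<equiv> L\<lparr>carrier := valuation_ring\<rparr>"
abbreviation "residue_field \<equiv> residue_ring_of L v"
abbreviation "residue x \<equiv> maximal_ideal L v +>\<^bsub>L\<^esub> x"

lemma v_inv_nonneg: "x \<in> carrier L \<Longrightarrow> v x = 0 \<Longrightarrow> inv x \<in> carrier L \<and> v (inv x) = 0 \<and> x \<noteq> \<zero>"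
proof -
  assume x: "x \<in> carrier L" "v x = 0"
  then have "x \<noteq> \<zero>" by (auto simp: zero_extended_def)
  then show ?thesis using v_inv[of x 0] inv_simps[of x] x by (auto simp: zero_extended_def)
qed

lemma valuation_ring_subring: "subring valuation_ring L"
proof (rule subringI)
  show "\<one> \<in> valuation_ring" by (simp add: zero_extended_def)
  fix x y assume xy: "x \<in> valuation_ring" "y \<in> valuation_ring"
  show "\<ominus> x \<in> valuation_ring" using xy by simp
  show "x \<oplus> y \<in> valuation_ring" using xy v_add_ge by simp
  show "x \<otimes> y \<in> valuation_ring" using xy v_mult_mono[of x y \<one> \<one>] by (simp add: zero_extended_def)
qed auto

lemma valuation_ring_cring: "cring valuation_ring_struct"
  using subcring_iff[of valuation_ring] subcringI'[OF valuation_ring_subring] by auto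

lemma maximal_ideal_ideal: "ideal (maximal_ideal L v) valuation_ring_struct"
proof -
  interpret O: cring valuation_ring_struct using valuation_ring_cring .
  have neg: "\<ominus>\<^bsub>valuation_ring_struct\<^esub> x = \<ominus> x" if "x \<in> valuation_ring" for x
  proof -
    have "\<ominus> x \<in> valuation_ring" using that by simp
    moreover have "\<ominus> x \<oplus> x = \<zero>" using that by (simp add: l_neg)
    ultimately show ?thesis using O.minus_equality[of "\<ominus> x" x] that by simp
  qed
  show ?thesis
  proof (rule idealI[OF O.ring_axioms])
    show "subgroup (maximal_ideal L v) (add_monoid valuation_ring_struct)"
    proof (rule O.add.subgroupI)
      show "maximal_ideal L v \<subseteq> carrier valuation_ring_struct" by (auto simp: maximal_ideal_def)
      have "\<zero> \<in> maximal_ideal L v" by (simp add: maximal_ideal_def zero_extended_def)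
      then show "maximal_ideal L v \<noteq> {}" by blast
      fix x assume x: "x \<in> maximal_ideal L v"
      then have "x \<in> valuation_ring" by (auto simp: maximal_ideal_def)
      then have e: "\<ominus>\<^bsub>valuation_ring_struct\<^esub> x = \<ominus> x" by (rule neg)
      show "\<ominus>\<^bsub>valuation_ring_struct\<^esub> x \<in> maximal_ideal L v"
        unfolding e using x by (simp add: maximal_ideal_def)
      fix y assume "y \<in> maximal_ideal L v"
      then show "x \<oplus>\<^bsub>valuation_ring_struct\<^esub> y \<in> maximal_ideal L v"
        using x v_add_gt by (simp add: maximal_ideal_def)
    qed
    fix x r assume xr: "x \<in> maximal_ideal L v" "r \<in> carrier valuation_ring_struct"
    then have "0 < v (x \<otimes> r)"
      using v_mult_strict_mono[of x r \<one> \<one>] by (simp add: maximal_ideal_def zero_extended_def)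
    then show "x \<otimes>\<^bsub>valuation_ring_struct\<^esub> r \<in> maximal_ideal L v" "r \<otimes>\<^bsub>valuation_ring_struct\<^esub> x \<in> maximal_ideal L v"
      using xr m_comm[of r x] by (simp_all add: maximal_ideal_def)
  qed
qed

lemma residue_alt: "maximal_ideal L v +>\<^bsub>valuation_ring_struct\<^esub> x = residue x"
  by (simp add: a_r_coset_def r_coset_def)

lemma residue_hom: "residue \<in> ring_hom valuation_ring_struct residue_field"
  using ideal.rcos_ring_hom[OF maximal_ideal_ideal] unfolding residue_ring_of_def
  by (simp add: residue_alt[abs_def])

lemma residue_eq_iff:
  assumes "x \<in> valuation_ring" "x' \<in> valuation_ring" shows "residue x = residue x' \<longleftrightarrow> 0 < v (x \<ominus> x')"
proof -
  interpret O: cring valuation_ring_struct using valuation_ring_cring .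
  have e: "x \<ominus>\<^bsub>valuation_ring_struct\<^esub> x' = x \<ominus> x'"
  proof -
    have "\<ominus>\<^bsub>valuation_ring_struct\<^esub> x' = \<ominus> x'"
      using O.minus_equality[of "\<ominus> x'" x'] assms(2) by (simp add: l_neg)
    then show ?thesis unfolding a_minus_def by simp
  qed
  have "x \<ominus> x' \<in> maximal_ideal L v \<longleftrightarrow> residue x = residue x'"
    using O.quotient_eq_iff_same_a_r_cos[OF maximal_ideal_ideal, of x x'] assms unfolding e residue_alt by simp
  then show ?thesis using assms by (auto simp: maximal_ideal_def)
qed

lemma residue_carrier: "carrier residue_field = residue ` valuation_ring"
  unfolding residue_ring_of_def FactRing_def A_RCOSETS_def' residue_alt by auto

lemma residue_zero: "\<zero>\<^bsub>residue_field\<^esub> = residue \<zero>"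
proof -
  interpret h: ring_hom_ring valuation_ring_struct residue_field residue
    using ideal.rcos_ring_hom_ring[OF maximal_ideal_ideal] unfolding residue_ring_of_def
    by (simp add: residue_alt[abs_def])
  show ?thesis using h.hom_zero by simp
qed

lemma residue_zero_iff: "x \<in> valuation_ring \<Longrightarrow> residue x = \<zero>\<^bsub>residue_field\<^esub> \<longleftrightarrow> 0 < v x"
  using residue_eq_iff[of x \<zero>] unfolding residue_zero by (auto simp: zero_extended_def minus_eq)

lemma residue_field_field: "field residue_field"
proof -
  interpret R: cring residue_field
    unfolding residue_ring_of_def using ideal.quotient_is_cring[OF maximal_ideal_ideal valuation_ring_cring] .
  note h = ring_hom_memE[OF residue_hom]
  show ?thesis
  proof (rule R.cring_fieldI, intro equalityI subsetI)
    fix z assume z: "z \<in> Units residue_field"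
    have "residue \<one> \<noteq> \<zero>\<^bsub>residue_field\<^esub>" using residue_zero_iff[of \<one>] by (simp add: zero_extended_def)
    then have "\<one>\<^bsub>residue_field\<^esub> \<noteq> \<zero>\<^bsub>residue_field\<^esub>" using h(4) by simp
    moreover obtain w where "w \<in> carrier residue_field" "z \<otimes>\<^bsub>residue_field\<^esub> w = \<one>\<^bsub>residue_field\<^esub>"
      using R.Units_r_inv_ex[OF z] by blast
    ultimately have "z \<noteq> \<zero>\<^bsub>residue_field\<^esub>" using R.l_null by metis
    then show "z \<in> carrier residue_field - {\<zero>\<^bsub>residue_field\<^esub>}" using R.Units_closed[OF z] by blast
  next
    fix z assume z: "z \<in> carrier residue_field - {\<zero>\<^bsub>residue_field\<^esub>}"
    then obtain x where x: "x \<in> valuation_ring" "z = residue x" unfolding residue_carrier by blast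
    then have vx: "v x = 0" using z residue_zero_iff[OF x(1)] by auto
    then have i: "inv x \<in> valuation_ring" "x \<otimes> inv x = \<one>" using v_inv_nonneg[of x] x inv_simps(2)[of x] by auto
    have "z \<otimes>\<^bsub>residue_field\<^esub> residue (inv x) = \<one>\<^bsub>residue_field\<^esub>"
      using h(2)[of x "inv x"] h(4) x i by simp
    moreover have "residue (inv x) \<in> carrier residue_field" using i(1) unfolding residue_carrier by blast
    ultimately show "z \<in> Units residue_field" using z R.m_comm[of z "residue (inv x)"] unfolding Units_def by blast
  qed
qed

lemma residues_subfield:
  assumes F: "subfield F L" shows "subfield (residues L v F) residue_field"
proof -
  interpret R: field residue_field using residue_field_field .
  note h = ring_hom_memE[OF residue_hom]
  note S = subringE[OF subfieldE(1)[OF F]] and V = subringE[OF valuation_ring_subring]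
  interpret hh: ring_hom_ring valuation_ring_struct residue_field residue
    using ideal.rcos_ring_hom_ring[OF maximal_ideal_ideal] unfolding residue_ring_of_def
    by (simp add: residue_alt[abs_def])
  have FL: "F \<subseteq> carrier L" using subfieldE(3)[OF F] .
  have "subring {x \<in> F. 0 \<le> v x} valuation_ring_struct"
  proof (rule ring.subringI)
    show "ring valuation_ring_struct" using valuation_ring_cring cring.axioms(1) by blast
    show "{x \<in> F. 0 \<le> v x} \<subseteq> carrier valuation_ring_struct" using FL by auto
    show "\<one>\<^bsub>valuation_ring_struct\<^esub> \<in> {x \<in> F. 0 \<le> v x}" using S(3) V(3) by simp
    fix x assume x: "x \<in> {x \<in> F. 0 \<le> v x}"
    then have xL: "x \<in> carrier L" using FL by blast
    have "\<ominus>\<^bsub>valuation_ring_struct\<^esub> x = \<ominus> x"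
      using hh.R.minus_equality[of "\<ominus> x" x] x xL by (simp add: l_neg)
    then show "\<ominus>\<^bsub>valuation_ring_struct\<^esub> x \<in> {x \<in> F. 0 \<le> v x}" using x xL S(5) by simp
    fix y assume y: "y \<in> {x \<in> F. 0 \<le> v x}"
    then have yL: "y \<in> carrier L" using FL by blast
    show "x \<otimes>\<^bsub>valuation_ring_struct\<^esub> y \<in> {x \<in> F. 0 \<le> v x}" using x y xL yL S(6) V(6)[of x y] by simp
    show "x \<oplus>\<^bsub>valuation_ring_struct\<^esub> y \<in> {x \<in> F. 0 \<le> v x}" using x y xL yL S(7) V(7)[of x y] by simp
  qed
  then have sr: "subring (residues L v F) residue_field" unfolding residues_def by (rule hh.img_is_subring)
  show ?thesis
  proof (rule R.subfieldI'[OF sr])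
    fix z assume z: "z \<in> residues L v F - {\<zero>\<^bsub>residue_field\<^esub>}"
    then obtain x where x: "x \<in> F" "0 \<le> v x" "z = residue x" unfolding residues_def by blast
    have xV: "x \<in> valuation_ring" using x FL by auto
    have vx: "v x = 0" using z residue_zero_iff[OF xV] x by auto
    have i: "inv x \<in> valuation_ring" "x \<otimes> inv x = \<one>" "x \<noteq> \<zero>" using v_inv_nonneg[of x] vx xV inv_simps(2)[of x] by auto
    have iF: "inv x \<in> F" using subfield_m_inv(1)[OF F, of x] x i by blast
    have "z \<otimes>\<^bsub>residue_field\<^esub> residue (inv x) = \<one>\<^bsub>residue_field\<^esub>"
      using h(2)[of x "inv x"] h(4) x xV i by simp
    moreover have "residue (inv x) \<in> carrier residue_field" "z \<in> carrier residue_field"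
      using i(1) xV x unfolding residue_carrier by blast+
    ultimately have "inv\<^bsub>residue_field\<^esub> z = residue (inv x)" using R.comm_inv_char by blast
    then show "inv\<^bsub>residue_field\<^esub> z \<in> residues L v F" unfolding residues_def using iF i(1) by auto
  qed
qed

lemma residue_combine:
  assumes "set cs \<subseteq> valuation_ring" "set us \<subseteq> valuation_ring"
  shows "ring.combine residue_field (map residue cs) (map residue us) = residue (combine cs us)" "combine cs us \<in> valuation_ring"
proof -
  interpret R: field residue_field using residue_field_field .
  note h = ring_hom_memE[OF residue_hom]
  note V = subringE[OF valuation_ring_subring]
  have "R.combine (map residue cs) (map residue us) = residue (combine cs us) \<and> combine cs us \<in> valuation_ring"
    using assms
  proof (induct cs us rule: combine.induct)
    case (1 k Ks u Us)
    then have IH: "R.combine (map residue Ks) (map residue Us) = residue (combine Ks Us)" "combine Ks Us \<in> valuation_ring" by auto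
    have ku: "k \<otimes> u \<in> valuation_ring" using 1 V(6)[of k u] by simp
    have "residue (k \<otimes> u \<oplus> combine Ks Us) = residue (k \<otimes> u) \<oplus>\<^bsub>residue_field\<^esub> residue (combine Ks Us)"
      using h(3)[of "k \<otimes> u" "combine Ks Us"] ku IH(2) by simp
    moreover have "residue (k \<otimes> u) = residue k \<otimes>\<^bsub>residue_field\<^esub> residue u" using h(2)[of k u] 1 by simp
    ultimately show ?case using IH V(7)[OF ku IH(2)] by simp
  qed (auto simp: residue_zero zero_extended_def)
  then show "ring.combine residue_field (map residue cs) (map residue us) = residue (combine cs us)" "combine cs us \<in> valuation_ring" by auto
qed

lemma residues_lift:
  assumes "set Ks \<subseteq> residues L v F"
  obtains cs where "Ks = map residue cs" "set cs \<subseteq> {x \<in> F. 0 \<le> v x}" "length cs = length Ks"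
proof -
  have "\<forall>k\<in>set Ks. \<exists>c. c \<in> F \<and> 0 \<le> v c \<and> k = residue c" using assms unfolding residues_def by blast
  then obtain f where f: "\<And>k. k \<in> set Ks \<Longrightarrow> f k \<in> F \<and> 0 \<le> v (f k) \<and> k = residue (f k)" by metis
  show thesis
  proof (rule that[of "map f Ks"])
    show "Ks = map residue (map f Ks)" using f by (simp add: map_idI[symmetric])
  qed (use f in auto)
qed

text \<open>A residue basis can be recognised from representatives: the combinations of \<open>us\<close> with integral coefficients
  may vanish modulo the maximal ideal only if all coefficients do, and must reach everything modulo it.\<close>

lemma residues_dimension:
  assumes F: "subfield F L" and E: "E \<subseteq> carrier L" and us: "set us \<subseteq> {x \<in> E. 0 \<le> v x}"
    and E_closed: "\<And>cs. set cs \<subseteq> {x \<in> F. 0 \<le> v x} \<Longrightarrow> combine cs us \<in> E"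
    and indep: "\<And>cs. set cs \<subseteq> {x \<in> F. 0 \<le> v x} \<Longrightarrow> length cs = length us \<Longrightarrow> 0 < v (combine cs us) \<Longrightarrow> \<forall>c\<in>set cs. 0 < v c"
    and span: "\<And>z. z \<in> E \<Longrightarrow> 0 \<le> v z \<Longrightarrow> \<exists>cs. set cs \<subseteq> {x \<in> F. 0 \<le> v x} \<and> length cs = length us \<and> 0 < v (z \<ominus> combine cs us)"
  shows "ring.dimension residue_field (length us) (residues L v F) (residues L v E)"
proof -
  interpret R: field residue_field using residue_field_field .
  note k = residues_subfield[OF F]
  let ?k = "residues L v F" and ?us = "map residue us"
  have usV: "set us \<subseteq> valuation_ring" using us E by blast
  have FV: "{x \<in> F. 0 \<le> v x} \<subseteq> valuation_ring" using subfieldE(3)[OF F] by blast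
  have usR: "set ?us \<subseteq> carrier residue_field" using usV unfolding residue_carrier by auto
  have ind: "R.independent ?k ?us"
  proof (cases "us = []")
    case False
    show ?thesis
    proof (rule ccontr)
      assume "\<not> R.independent ?k ?us"
      then obtain Ks where Ks: "length Ks = length ?us" "R.combine Ks ?us = \<zero>\<^bsub>residue_field\<^esub>" "set Ks \<subseteq> ?k" "set Ks \<noteq> {\<zero>\<^bsub>residue_field\<^esub>}"
        using R.dependent_imp_non_trivial_combine[OF k usR] by metis
      obtain cs where cs: "Ks = map residue cs" "set cs \<subseteq> {x \<in> F. 0 \<le> v x}" "length cs = length Ks"
        using residues_lift[OF Ks(3)] by metis
      have csV: "set cs \<subseteq> valuation_ring" using cs(2) FV by blast
      have "residue (combine cs us) = \<zero>\<^bsub>residue_field\<^esub>" using residue_combine(1)[OF csV usV] Ks(2) cs(1) by simp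
      then have "0 < v (combine cs us)" using residue_zero_iff[OF residue_combine(2)[OF csV usV]] by simp
      then have "\<forall>c\<in>set cs. 0 < v c" using indep[OF cs(2)] cs(3) Ks(1) by simp
      then have "set Ks \<subseteq> {\<zero>\<^bsub>residue_field\<^esub>}" using residue_zero_iff csV unfolding cs(1) by auto
      moreover have "Ks \<noteq> []" using Ks(1) False by auto
      ultimately show False using Ks(4) by (cases Ks) auto
    qed
  qed simp
  have "R.Span ?k ?us = residues L v E"
  proof (intro equalityI subsetI)
    fix z assume "z \<in> R.Span ?k ?us"
    then obtain Ks where Ks: "set Ks \<subseteq> ?k" "length Ks = length ?us" "z = R.combine Ks ?us"
      using R.Span_mem_iff_length_version[OF k usR] by blast
    obtain cs where cs: "Ks = map residue cs" "set cs \<subseteq> {x \<in> F. 0 \<le> v x}"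
      using residues_lift[OF Ks(1)] by metis
    have csV: "set cs \<subseteq> valuation_ring" using cs(2) FV by blast
    show "z \<in> residues L v E"
      unfolding Ks(3) cs(1) residue_combine(1)[OF csV usV] residues_def
      using E_closed[OF cs(2)] residue_combine(2)[OF csV usV] by blast
  next
    fix z assume "z \<in> residues L v E"
    then obtain x where x: "x \<in> E" "0 \<le> v x" "z = residue x" unfolding residues_def by blast
    obtain cs where cs: "set cs \<subseteq> {x \<in> F. 0 \<le> v x}" "length cs = length us" "0 < v (x \<ominus> combine cs us)"
      using span[OF x(1,2)] by blast
    have csV: "set cs \<subseteq> valuation_ring" using cs(1) FV by blast
    have "z = residue (combine cs us)"
      unfolding x(3) using residue_eq_iff[of x "combine cs us"] cs(3) x E residue_combine(2)[OF csV usV] by blast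
    also have "\<dots> = R.combine (map residue cs) ?us" using residue_combine(1)[OF csV usV] by simp
    finally have "z = R.combine (map residue cs) ?us" .
    moreover have "set (map residue cs) \<subseteq> ?k" using cs(1) unfolding residues_def by auto
    ultimately show "z \<in> R.Span ?k ?us"
      using R.Span_mem_iff_length_version[OF k usR, of z] cs(2) by (metis length_map)
  qed
  then show ?thesis using R.dimensionI[OF k ind] by simp
qed

lemma combine_as_sum:
  assumes "distinct xs" "\<And>i. i \<in> set xs \<Longrightarrow> c i \<in> carrier L" "\<And>i. i \<in> set xs \<Longrightarrow> u i \<in> carrier L"
  shows "combine (map c xs) (map u xs) = (\<Oplus>i\<in>set xs. c i \<otimes> u i)"
  using assms by (induct xs) (auto simp: Pi_def)

text \<open>Let \<open>b\<^sub>0, \<dots>, b\<^sub>n\<^sub>-\<^sub>1\<close> be a basis of \<open>E\<close> over \<open>F\<close> such that no cancellation occurs in linear combinations. Each coset of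
  the value group of \<open>F\<close> in that of \<open>E\<close> contains the value of some \<open>b\<^sub>i\<close>, and the \<open>b\<^sub>i\<close> with value in a given coset, moved to value
  zero, represent a basis of the residue field extension. So all cosets contain equally many of the values, and \<open>n = e f\<close>.\<close>

lemma residues_dimension_coset:
  assumes F: "subfield F L" and E: "subfield E L" "F \<subseteq> E"
    and b: "\<And>i. i < n \<Longrightarrow> b i \<in> E" "\<And>i. i < n \<Longrightarrow> b i \<noteq> \<zero>"
    and span: "\<And>z. z \<in> E \<Longrightarrow> \<exists>c. (\<forall>i<n. c i \<in> F) \<and> z = (\<Oplus>i\<in>{..<n}. c i \<otimes> b i)"
    and indep: "\<And>c i. (\<And>i. i < n \<Longrightarrow> c i \<in> F) \<Longrightarrow> i < n \<Longrightarrow> v (\<Oplus>i\<in>{..<n}. c i \<otimes> b i) \<le> v (c i \<otimes> b i)"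
    and k: "k < (n::nat)"
  shows "ring.dimension residue_field (card {i. i < n \<and> (\<exists>h\<in>F. v (h \<otimes> b i) = v (b k))}) (residues L v F) (residues L v E)"
proof -
  define J where "J = {i. i < n \<and> (\<exists>h\<in>F. v (h \<otimes> b i) = v (b k))}"
  have FL: "F \<subseteq> carrier L" and EL: "E \<subseteq> carrier L" using subfieldE(3) F E(1) by blast+
  have bL: "b i \<in> carrier L" if "i < n" for i using b(1)[OF that] EL by blast
  note Fr = subringE[OF subfieldE(1)[OF F]] and Er = subringE[OF subfieldE(1)[OF E(1)]]
  have Jn: "J \<subseteq> {..<n}" "finite J" unfolding J_def by auto
  have "\<forall>i\<in>J. \<exists>h\<in>F. v (h \<otimes> b i) = v (b k)" unfolding J_def by blast
  then obtain h where h: "\<And>i. i \<in> J \<Longrightarrow> h i \<in> F" "\<And>i. i \<in> J \<Longrightarrow> v (h i \<otimes> b i) = v (b k)" by metis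
  have hL: "h i \<in> carrier L" if "i \<in> J" for i using h(1)[OF that] FL by blast
  have bk: "b k \<in> carrier L" "b k \<noteq> \<zero>" "b k \<in> E" using bL b k by auto
  have bkP: "v (b k) < Pinf" using v_less_Pinf[OF bk(1,2)] .
  note ik = inv_simps[OF bk(1,2)]
  have hz: "h i \<noteq> \<zero>" if "i \<in> J" for i
  proof
    assume "h i = \<zero>"
    then have "v (b k) = Pinf" using h(2)[OF that] bL that Jn(1) by auto
    then show False using bkP by simp
  qed
  define u where "u i = h i \<otimes> b i \<otimes> inv (b k)" for i
  have iE: "inv (b k) \<in> E" using subfield_m_inv(1)[OF E(1), of "b k"] bk by blast
  have uE: "u i \<in> E" if "i \<in> J" for i
    unfolding u_def using h(1)[OF that] E(2) b(1) Jn(1) that iE Er(6) by (metis lessThan_iff subsetD)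
  have uL: "u i \<in> carrier L" if "i \<in> J" for i using uE[OF that] EL by blast
  have ubk: "b k \<otimes> u i = h i \<otimes> b i" if "i \<in> J" for i
  proof -
    have "b i \<in> carrier L" using bL that Jn(1) by auto
    then have "b k \<otimes> u i = h i \<otimes> b i \<otimes> (b k \<otimes> inv (b k))" unfolding u_def using hL[OF that] bk ik(1) by (simp add: m_ac)
    then show ?thesis using ik(2) hL[OF that] \<open>b i \<in> carrier L\<close> by simp
  qed
  have vu: "v (u i) = 0" if "i \<in> J" for i
  proof -
    have "v (b k \<otimes> u i) = v (b k \<otimes> \<one>)" using ubk[OF that] h(2)[OF that] bk by simp
    then show ?thesis using v_mult_cancel(1)[OF uL[OF that] one_closed bk(1,2)] by (simp add: zero_extended_def)
  qed
  define xs where "xs = sorted_list_of_set J"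
  have xs: "distinct xs" "set xs = J" "length xs = card J" using Jn(2) by (auto simp: xs_def)
  have lift: "\<exists>c. cs = map c xs" if "length cs = length xs" for cs :: "'a list"
  proof (intro exI)
    show "cs = map (\<lambda>i. the (map_of (zip xs cs) i)) xs"
      using that xs(1) by (intro nth_equalityI) (auto simp: map_of_zip_nth)
  qed
  \<comment> \<open>multiplication by \<open>b\<^sub>k\<close> turns combinations of the \<open>u\<^sub>i\<close> into combinations of the given basis\<close>
  have sum_u: "b k \<otimes> (\<Oplus>i\<in>J. c i \<otimes> u i) = (\<Oplus>i\<in>{..<n}. (if i \<in> J then c i \<otimes> h i else \<zero>) \<otimes> b i)"
    if c: "\<And>i. i \<in> J \<Longrightarrow> c i \<in> F" for c
  proof -
    have cL: "c i \<in> carrier L" if "i \<in> J" for i using c[OF that] FL by blast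
    have "b k \<otimes> (\<Oplus>i\<in>J. c i \<otimes> u i) = (\<Oplus>i\<in>J. b k \<otimes> (c i \<otimes> u i))"
      using Jn(2) bk cL uL by (subst finsum_rdistr) auto
    also have "\<dots> = (\<Oplus>i\<in>J. (if i \<in> J then c i \<otimes> h i else \<zero>) \<otimes> b i)"
    proof (rule finsum_cong')
      fix i assume i: "i \<in> J"
      have bi: "b i \<in> carrier L" using bL i Jn(1) by auto
      have "b k \<otimes> (c i \<otimes> u i) = c i \<otimes> (b k \<otimes> u i)" using bk cL[OF i] uL[OF i] by (simp add: m_lcomm)
      then show "b k \<otimes> (c i \<otimes> u i) = (if i \<in> J then c i \<otimes> h i else \<zero>) \<otimes> b i"
        using ubk[OF i] i cL[OF i] hL[OF i] bi by (simp add: m_assoc)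
    qed (use cL hL bL Jn(1) in auto)
    also have "\<dots> = (\<Oplus>i\<in>{..<n}. (if i \<in> J then c i \<otimes> h i else \<zero>) \<otimes> b i)"
      using Jn(1) cL hL bL by (intro add.finprod_mono_neutral_cong_left) auto
    finally show ?thesis .
  qed
  have comb: "combine (map c xs) (map u xs) = (\<Oplus>i\<in>J. c i \<otimes> u i)" if "\<And>i. i \<in> J \<Longrightarrow> c i \<in> F" for c
    using combine_as_sum[OF xs(1), of c u] that FL uL unfolding xs(2) by blast
  have sc: "(\<Oplus>i\<in>J. c i \<otimes> u i) \<in> carrier L" if "\<And>i. i \<in> J \<Longrightarrow> c i \<in> F" for c
    using that FL uL by (intro finsum_closed) auto
  have "ring.dimension residue_field (length (map u xs)) (residues L v F) (residues L v E)"
  proof (rule residues_dimension[OF F EL])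
    show "set (map u xs) \<subseteq> {x \<in> E. 0 \<le> v x}" using uE vu unfolding set_map xs(2) by auto
    show "combine cs (map u xs) \<in> E" if "set cs \<subseteq> {x \<in> F. 0 \<le> v x}" for cs
    proof -
      have "set us \<subseteq> E \<Longrightarrow> set cs \<subseteq> E \<Longrightarrow> combine cs us \<in> E" for us
        using Er(2,6,7) by (induct cs us rule: combine.induct) auto
      moreover have "set (map u xs) \<subseteq> E" using uE unfolding set_map xs(2) by blast
      moreover have "set cs \<subseteq> E" using that E(2) by blast
      ultimately show ?thesis by blast
    qed
    show "\<forall>c\<in>set cs. 0 < v c"
      if cs: "set cs \<subseteq> {x \<in> F. 0 \<le> v x}" "length cs = length (map u xs)" "0 < v (combine cs (map u xs))" for cs
    proof -
      obtain c where c: "cs = map c xs" using lift cs(2) by auto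
      have cF: "c i \<in> F" if "i \<in> J" for i using cs(1) that unfolding c set_map xs(2) by blast
      let ?c = "\<lambda>i. if i \<in> J then c i \<otimes> h i else \<zero>"
      have lin: "combine (map c xs) (map u xs) = (\<Oplus>i\<in>J. c i \<otimes> u i)" by (rule comb) (rule cF)
      have sum: "b k \<otimes> (\<Oplus>i\<in>J. c i \<otimes> u i) = (\<Oplus>i\<in>{..<n}. ?c i \<otimes> b i)" by (rule sum_u) (rule cF)
      have closed: "(\<Oplus>i\<in>J. c i \<otimes> u i) \<in> carrier L" by (rule sc) (rule cF)
      have c'F: "?c i \<in> F" for i using cF h(1) Fr(2,6) by simp
      have "v (b k \<otimes> \<one>) < v (b k \<otimes> (\<Oplus>i\<in>J. c i \<otimes> u i))"
        using cs(3) unfolding c lin v_mult_cancel(2)[OF one_closed closed bk(1,2)] by (simp add: zero_extended_def)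
      then have gt: "v (b k) < v (\<Oplus>i\<in>{..<n}. ?c i \<otimes> b i)" unfolding sum using bk by simp
      have "0 < v (c i)" if i: "i \<in> J" for i
      proof -
        have bi: "b i \<in> carrier L" "i < n" using bL i Jn(1) by auto
        have cL: "c i \<in> carrier L" using cF[OF i] FL by blast
        have "v (b k) < v (?c i \<otimes> b i)" using gt indep[of ?c, OF c'F bi(2)] by (rule less_le_trans)
        also have "?c i \<otimes> b i = (h i \<otimes> b i) \<otimes> c i" using i cL hL[OF i] bi(1) by (simp add: m_ac)
        finally have "v ((h i \<otimes> b i) \<otimes> \<one>) < v ((h i \<otimes> b i) \<otimes> c i)" using h(2)[OF i] hL[OF i] bi by simp
        then show ?thesis
          using v_mult_cancel(2)[OF one_closed cL, of "h i \<otimes> b i"] nonzero_mult[OF hL[OF i] bi(1) hz[OF i] b(2)[OF bi(2)]] hL[OF i] bi(1)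
          by (simp add: zero_extended_def)
      qed
      then show ?thesis unfolding c set_map xs(2) by blast
    qed
    show "\<exists>cs. set cs \<subseteq> {x \<in> F. 0 \<le> v x} \<and> length cs = length (map u xs) \<and> 0 < v (z \<ominus> combine cs (map u xs))"
      if z: "z \<in> E" "0 \<le> v z" for z
    proof -
      have zL: "z \<in> carrier L" using z EL by blast
      have "z \<otimes> b k \<in> E" using z bk Er(6) by blast
      then obtain g where g: "\<And>i. i < n \<Longrightarrow> g i \<in> F" "z \<otimes> b k = (\<Oplus>i\<in>{..<n}. g i \<otimes> b i)" using span by metis
      have gL: "g i \<in> carrier L" if "i < n" for i using g(1)[OF that] FL by blast
      have "v (\<one> \<otimes> b k) \<le> v (z \<otimes> b k)" using v_mult_mono[of z "b k" \<one> "b k"] z zL bk by (simp add: zero_extended_def)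
      then have zk: "v (b k) \<le> v (z \<otimes> b k)" using bk by simp
      have gb: "v (b k) \<le> v (g i \<otimes> b i)" if "i < n" for i
        using order_trans[OF zk] indep[of g, OF g(1) that] g(2) by simp
      define c where "c i = g i \<otimes> inv (h i)" for i
      have cF: "c i \<in> F" if "i \<in> J" for i
        unfolding c_def using g(1)[of i] subfield_m_inv(1)[OF F, of "h i"] h(1)[OF that] hz[OF that] Fr(6) that Jn(1) by auto
      have cL: "c i \<in> carrier L" if "i \<in> J" for i using cF[OF that] FL by blast
      have ch: "c i \<otimes> h i = g i" if "i \<in> J" for i
      proof -
        have "g i \<in> carrier L" using gL that Jn(1) by auto
        then show ?thesis unfolding c_def using hL[OF that] hz[OF that] inv_simps[OF hL[OF that] hz[OF that]] by (simp add: m_assoc)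
      qed
      have vc: "0 \<le> v (c i)" if i: "i \<in> J" for i
      proof -
        have bi: "b i \<in> carrier L" "i < n" using bL i Jn(1) by auto
        have "(h i \<otimes> b i) \<otimes> c i = (c i \<otimes> h i) \<otimes> b i" using cL[OF i] hL[OF i] bi(1) by (simp add: m_ac)
        then have "v ((h i \<otimes> b i) \<otimes> \<one>) \<le> v ((h i \<otimes> b i) \<otimes> c i)"
          using gb[OF bi(2)] h(2)[OF i] hL[OF i] bi(1) ch[OF i] by simp
        then show ?thesis
          using v_mult_cancel(3)[OF one_closed cL[OF i], of "h i \<otimes> b i"] nonzero_mult[OF hL[OF i] bi(1) hz[OF i] b(2)[OF bi(2)]] hL[OF i] bi(1)
          by (simp add: zero_extended_def)
      qed
      have gbL: "g i \<otimes> b i \<in> carrier L" if "i < n" for i using gL[OF that] bL[OF that] by simp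
      have bs: "b k \<otimes> (\<Oplus>i\<in>J. c i \<otimes> u i) = (\<Oplus>i\<in>J. g i \<otimes> b i)"
      proof -
        have "b k \<otimes> (\<Oplus>i\<in>J. c i \<otimes> u i) = (\<Oplus>i\<in>{..<n}. (if i \<in> J then c i \<otimes> h i else \<zero>) \<otimes> b i)" by (rule sum_u[of c, OF cF])
        also have "\<dots> = (\<Oplus>i\<in>J. g i \<otimes> b i)"
          using Jn(1) gbL gL bL ch by (intro add.finprod_mono_neutral_cong_right) auto
        finally show ?thesis .
      qed
      have JU: "{..<n} = J \<union> ({..<n} - J)" using Jn(1) by blast
      have split: "(\<Oplus>i\<in>{..<n}. g i \<otimes> b i) = (\<Oplus>i\<in>J. g i \<otimes> b i) \<oplus> (\<Oplus>i\<in>{..<n} - J. g i \<otimes> b i)"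
        using Jn gbL by (subst JU, subst finsum_Un_disjoint) auto
      have JL: "(\<Oplus>i\<in>J. g i \<otimes> b i) \<in> carrier L" "(\<Oplus>i\<in>{..<n} - J. g i \<otimes> b i) \<in> carrier L"
        using Jn(1) gbL by (auto intro!: finsum_closed)
      have "b k \<otimes> (z \<ominus> (\<Oplus>i\<in>J. c i \<otimes> u i)) = z \<otimes> b k \<ominus> b k \<otimes> (\<Oplus>i\<in>J. c i \<otimes> u i)"
      proof -
        have "x \<otimes> (z \<ominus> s) = z \<otimes> x \<ominus> x \<otimes> s" if "x \<in> carrier L" "s \<in> carrier L" for x s using that zL by algebra
        then show ?thesis using bk(1) sc[of c, OF cF] by blast
      qed
      also have "\<dots> = (\<Oplus>i\<in>{..<n} - J. g i \<otimes> b i)"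
      proof -
        have "(s \<oplus> r) \<ominus> s = r" if "s \<in> carrier L" "r \<in> carrier L" for s r using that by algebra
        then show ?thesis unfolding g(2) bs split using JL by blast
      qed
      finally have e: "b k \<otimes> (z \<ominus> (\<Oplus>i\<in>J. c i \<otimes> u i)) = (\<Oplus>i\<in>{..<n} - J. g i \<otimes> b i)" .
      have "v (b k) < v (\<Oplus>i\<in>{..<n} - J. g i \<otimes> b i)"
      proof (rule v_finsum_gt[OF _ _ bkP])
        fix i assume i: "i \<in> {..<n} - J"
        then show "g i \<otimes> b i \<in> carrier L" using gbL by simp
        have "v (g i \<otimes> b i) \<noteq> v (b k)" using i g(1)[of i] unfolding J_def by auto
        then show "v (b k) < v (g i \<otimes> b i)" using gb[of i] i by (simp add: order_less_le)
      qed
      then have "v (b k \<otimes> \<one>) < v (b k \<otimes> (z \<ominus> (\<Oplus>i\<in>J. c i \<otimes> u i)))" unfolding e using bk by simp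
      then have "0 < v (z \<ominus> (\<Oplus>i\<in>J. c i \<otimes> u i))"
        using v_mult_cancel(2)[OF one_closed _ bk(1,2), of "z \<ominus> (\<Oplus>i\<in>J. c i \<otimes> u i)"] zL sc[of c, OF cF] by (simp add: zero_extended_def)
      moreover have "set (map c xs) \<subseteq> {x \<in> F. 0 \<le> v x}" using cF vc unfolding set_map xs(2) by blast
      ultimately show ?thesis using comb[of c, OF cF] by (intro exI[of _ "map c xs"]) simp
    qed
  qed
  then show ?thesis using xs(3) by (simp add: J_def)
qed

lemma valuation_basis_defectless:
  assumes F: "subfield F L" and E: "subfield E L" "F \<subseteq> E"
    and b: "\<And>i. i < n \<Longrightarrow> b i \<in> E" "\<And>i. i < n \<Longrightarrow> b i \<noteq> \<zero>"
    and span: "\<And>z. z \<in> E \<Longrightarrow> \<exists>c. (\<forall>i<n. c i \<in> F) \<and> z = (\<Oplus>i\<in>{..<n}. c i \<otimes> b i)"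
    and indep: "\<And>c i. (\<And>i. i < n \<Longrightarrow> c i \<in> F) \<Longrightarrow> i < n \<Longrightarrow> v (\<Oplus>i\<in>{..<n}. c i \<otimes> b i) \<le> v (c i \<otimes> b i)"
    and n: "0 < (n::nat)"
  shows "n = order (value_quotient v F E) * ring.dim residue_field (residues L v F) (residues L v E)"
proof -
  interpret R: field residue_field using residue_field_field .
  have FL: "F \<subseteq> carrier L" and EL: "E \<subseteq> carrier L" using subfieldE(3) F E(1) by blast+
  have bL: "b i \<in> carrier L" if "i < n" for i using b(1)[OF that] EL by blast
  note Fr = subringE[OF subfieldE(1)[OF F]]
  define H where "H = {g. \<exists>x\<in>F. v x = Fin g}"
  define w where "w i = (SOME g. v (b i) = Fin g)" for i
  have w: "v (b i) = Fin (w i)" if "i < n" for i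
    unfolding w_def using v_finE[OF bL[OF that] b(2)[OF that]] by (metis (mono_tags, lifting) someI)
  define C where "C i = (\<Union>h\<in>H. {h + w i})" for i
  have H0: "0 \<in> H" unfolding H_def using Fr(3) v_one by blast
  have Hadd: "g + h \<in> H" if gh: "g \<in> H" "h \<in> H" for g h
  proof -
    obtain x y where xy: "x \<in> F" "v x = Fin g" "y \<in> F" "v y = Fin h" using gh unfolding H_def by blast
    then have "v (x \<otimes> y) = Fin (g + h)" using v_mult[of x y] FL by auto
    then show ?thesis unfolding H_def using Fr(6) xy by blast
  qed
  have Hneg: "- g \<in> H" if gH: "g \<in> H" for g
  proof -
    obtain x where x: "x \<in> F" "v x = Fin g" using gH unfolding H_def by blast
    then have "x \<noteq> \<zero>" by auto
    then have "v (inv x) = Fin (- g)" "inv x \<in> F" using v_inv[of x g] x FL subfield_m_inv(1)[OF F, of x] by auto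
    then show ?thesis unfolding H_def by blast
  qed
  have coset_eq: "(\<Union>h\<in>H. {h + (g + s)}) = (\<Union>h\<in>H. {h + s})" if g: "g \<in> H" for g s
  proof (intro equalityI subsetI)
    fix z assume "z \<in> (\<Union>h\<in>H. {h + (g + s)})"
    then obtain h where "h \<in> H" "z = (h + g) + s" by (auto simp: add.assoc)
    then show "z \<in> (\<Union>h\<in>H. {h + s})" using Hadd[OF _ g] by blast
  next
    fix z assume "z \<in> (\<Union>h\<in>H. {h + s})"
    then obtain h where "h \<in> H" "z = (h + - g) + (g + s)" by (auto simp: add.assoc)
    then show "z \<in> (\<Union>h\<in>H. {h + (g + s)})" using Hadd[OF _ Hneg[OF g]] by blast
  qed
  have prod_v: "v (h \<otimes> b i) = Fin (g + w i)" if "i < n" "h \<in> F" "v h = Fin g" for h i g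
    using v_mult[of h "b i"] w[OF that(1)] that FL bL[OF that(1)] by auto
  have C_iff: "C i = C k \<longleftrightarrow> (\<exists>h\<in>F. v (h \<otimes> b i) = v (b k))" if i: "i < n" and k: "k < n" for i k
  proof
    assume "C i = C k"
    moreover have "w k \<in> C k" unfolding C_def using H0 by force
    ultimately obtain g where g: "g \<in> H" "w k = g + w i" unfolding C_def by blast
    then obtain h where "h \<in> F" "v h = Fin g" unfolding H_def by blast
    then show "\<exists>h\<in>F. v (h \<otimes> b i) = v (b k)" using prod_v[OF i] w[OF k] g(2) by metis
  next
    assume "\<exists>h\<in>F. v (h \<otimes> b i) = v (b k)"
    then obtain h where h: "h \<in> F" "v (h \<otimes> b i) = v (b k)" by blast
    have "h \<noteq> \<zero>"
    proof
      assume "h = \<zero>" then show False using h(2) w[OF k] bL[OF i] by simp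
    qed
    then obtain g where g: "v h = Fin g" using v_finE[of h] h(1) FL by blast
    have "w k = g + w i" using prod_v[OF i h(1) g] h(2) w[OF k] by simp
    moreover have "g \<in> H" using g h(1) unfolding H_def by blast
    ultimately show "C i = C k" unfolding C_def using coset_eq[of g "w i"] by simp
  qed
  have car: "carrier (value_quotient v F E) = C ` {..<n}"
  proof -
    have "carrier (value_quotient v F E) = (\<lambda>s. \<Union>h\<in>H. {h + s}) ` {g. \<exists>x\<in>E. v x = Fin g}"
      unfolding value_quotient_def value_group_def FactGroup_def RCOSETS_def r_coset_def H_def by auto
    also have "\<dots> = C ` {..<n}"
    proof (intro equalityI subsetI)
      fix z assume "z \<in> C ` {..<n}"
      then show "z \<in> (\<lambda>s. \<Union>h\<in>H. {h + s}) ` {g. \<exists>x\<in>E. v x = Fin g}" unfolding C_def using w b(1) by blast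
    next
      fix z assume "z \<in> (\<lambda>s. \<Union>h\<in>H. {h + s}) ` {g. \<exists>x\<in>E. v x = Fin g}"
      then obtain s x where sx: "z = (\<Union>h\<in>H. {h + s})" "x \<in> E" "v x = Fin s" by blast
      obtain c where c: "\<And>i. i < n \<Longrightarrow> c i \<in> F" "x = (\<Oplus>i\<in>{..<n}. c i \<otimes> b i)" using span[OF sx(2)] by metis
      have cL: "c i \<in> carrier L" if "i < n" for i using c(1)[OF that] FL by blast
      have "\<exists>i<n. v (c i \<otimes> b i) \<le> v x"
      proof (rule ccontr)
        assume no: "\<not> (\<exists>i<n. v (c i \<otimes> b i) \<le> v x)"
        have "v x < v (\<Oplus>i\<in>{..<n}. c i \<otimes> b i)"
          using no cL bL sx(3) by (intro v_finsum_gt) (auto simp: not_le)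
        then show False using c(2) by simp
      qed
      then obtain i where i: "i < n" "v (c i \<otimes> b i) \<le> v x" by blast
      then have e: "v (c i \<otimes> b i) = Fin s" using indep[of c i, OF c(1) i(1)] c(2) sx(3) by simp
      have "c i \<noteq> \<zero>"
      proof
        assume "c i = \<zero>" then show False using e bL[OF i(1)] by simp
      qed
      then obtain g where g: "v (c i) = Fin g" using v_finE[OF cL[OF i(1)]] by blast
      have "s = g + w i" using prod_v[OF i(1) c(1)[OF i(1)] g] e by simp
      moreover have "g \<in> H" using g c(1)[OF i(1)] unfolding H_def by blast
      ultimately have "z = C i" unfolding sx(1) C_def using coset_eq[of g "w i"] by simp
      then show "z \<in> C ` {..<n}" using i(1) by blast
    qed
    finally show ?thesis .
  qed
  let ?f = "ring.dim residue_field (residues L v F) (residues L v E)"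
  have fib: "card {i. i \<in> {..<n} \<and> C i = c} = ?f" if c: "c \<in> C ` {..<n}" for c
  proof -
    obtain k where k: "k < n" "c = C k" using c by blast
    have "{i. i \<in> {..<n} \<and> C i = c} = {i. i < n \<and> (\<exists>h\<in>F. v (h \<otimes> b i) = v (b k))}"
      using C_iff[OF _ k(1)] k(2) by auto
    then show ?thesis
      using R.dimI[OF residues_subfield[OF F] residues_dimension_coset[OF F E b span indep k(1)]] by (simp add: over_def)
  qed
  have "n = (\<Sum>i\<in>{..<n}. 1)" by simp
  also have "\<dots> = (\<Sum>c\<in>C ` {..<n}. \<Sum>i\<in>{i. i \<in> {..<n} \<and> C i = c}. 1)" by (rule sum.image_gen) simp
  also have "\<dots> = (\<Sum>c\<in>C ` {..<n}. ?f)" using fib by simp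
  also have "\<dots> = order (value_quotient v F E) * ?f" by (simp add: order_def car)
  finally show ?thesis .
qed

end

context minimal_pair
begin

text \<open>Independence gives the lower bound \<open>j\<close> for the degree of \<open>a\<close> over the henselization of \<open>K(T)\<close>; this degree is at most that over the
  implicit constant field, which is at most \<open>j\<close>.\<close>

lemma degrees: "degree (Irr (hens F) a) = j" "degree (Irr IC a) = j"
proof -
  note h = hens_subfield[OF F(1)]
  have FL: "hens F \<subseteq> carrier L" using subfieldE(3)[OF h(1)] .
  have aIC: "algebraic IC a" using alg_mono[OF K_IC a(3)] .
  note D = Irr_dvd_mono[OF IC(1) h(1) IC(3) a(2) aIC]
  note A = adjoin_simps[OF FL, of "{a}"]
  have Es: "subfield (adjoin L (hens F) {a}) L" "hens F \<subseteq> adjoin L (hens F) {a}" "a \<in> adjoin L (hens F) {a}" using A a by auto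
  note R = subringE[OF subfieldE(1)[OF Es(1)]]
  have yE: "y \<in> adjoin L (hens F) {a}"
    unfolding y_def minus_eq using R(5,7) Es h(2) F(3) by blast
  have ypE: "y [^] (i::nat) \<in> adjoin L (hens F) {a}" for i using yE R(3,6) by (induct i) auto
  have "independent (hens F) (exp_base y j)"
  proof (rule trivial_combine_imp_independent[OF h(1)])
    show "set (exp_base y j) \<subseteq> carrier L" using exp_base_closed[OF y(1)] .
    fix Ks assume Ks: "set Ks \<subseteq> hens F" "combine Ks (exp_base y j) = \<zero>"
    show "set (take (length (exp_base y j)) Ks) \<subseteq> {\<zero>}"
    proof -
      have len: "length (exp_base y j) = j" by (simp add: exp_base_def)
      define Ks' where "Ks' = take j Ks @ replicate (j - length Ks) \<zero>"
      have K': "length Ks' = j" "set Ks' \<subseteq> hens F"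
        using Ks(1) set_take_subset[of j Ks] subringE(2)[OF subfieldE(1)[OF h(1)]] by (auto simp: Ks'_def)
      have "combine (take j Ks) (exp_base y j) = \<zero>" using combine_take[of "exp_base y j" Ks] Ks(2) len by simp
      then have "combine Ks' (exp_base y j) = \<zero>"
        unfolding Ks'_def using combine_append_replicate[OF exp_base_closed[OF y(1)]] by simp
      then have ev: "eval Ks' y = \<zero>" using combine_eq_eval[of Ks' y] K'(1) by simp
      have K'L: "set Ks' \<subseteq> carrier L" using K'(2) FL by blast
      have ch: "coeff Ks' i \<in> hens F" for i
        using coeff_img(3)[of Ks'] rangeI[of "coeff Ks'" i] K'(2) subringE(2)[OF subfieldE(1)[OF h(1)]] by auto
      have s0: "(\<Oplus>i\<in>{..<j}. coeff Ks' i \<otimes> y [^] i) = \<zero>"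
        using eval_as_sum[OF K'L y(1), of j] ev K'(1) by simp
      have z: "coeff Ks' i = \<zero>" if i: "i < j" for i
      proof -
        have yp: "y [^] i \<in> carrier L" "y [^] i \<noteq> \<zero>" using y nonzero_pow by auto
        have c: "coeff Ks' i \<in> carrier L" using ch FL by blast
        have "v (coeff Ks' i \<otimes> y [^] i) = Pinf" using independent_over_hens[of "coeff Ks'", OF ch i] s0 by simp
        then have "coeff Ks' i \<otimes> y [^] i = \<zero>" using v_zero_iff c yp by simp
        then show ?thesis using integral[OF _ c yp(1)] yp(2) by blast
      qed
      have "set Ks' \<subseteq> {\<zero>}"
      proof -
        have "(coeff Ks') ` {..<length Ks'} = set Ks'" by (rule coeff_img_restrict)
        then show ?thesis using z K'(1) by auto
      qed
      then show ?thesis unfolding len Ks'_def by auto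
    qed
  qed
  moreover have "set (exp_base y j) \<subseteq> adjoin L (hens F) {a}" using ypE by (auto simp: exp_base_def)
  ultimately have "length (exp_base y j) \<le> degree (Irr (hens F) a)"
    using independent_length_le_dimension[OF h(1) adjoin_algebraic(3)[OF h(1) a(2) D(1)]] by blast
  then have "j \<le> degree (Irr (hens F) a)" by (simp add: exp_base_def)
  then show "degree (Irr (hens F) a) = j" "degree (Irr IC a) = j" using D(4) degree_over_IC by auto
qed

lemma basis_over_hens:
  "\<And>z. z \<in> adjoin L (hens F) {a} \<Longrightarrow> \<exists>c. (\<forall>i<j. c i \<in> hens F) \<and> z = (\<Oplus>i\<in>{..<j}. c i \<otimes> y [^] i)"
proof -
  fix z assume z: "z \<in> adjoin L (hens F) {a}"
  note h = hens_subfield[OF F(1)]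
  have FL: "hens F \<subseteq> carrier L" using subfieldE(3)[OF h(1)] .
  note R = subringE[OF subfieldE(1)[OF h(1)]]
  have aF: "algebraic (hens F) a" using alg_mono[OF _ a(3)] F(2) h(2) by blast
  have ya: "adjoin L (hens F) {y} = adjoin L (hens F) {a}"
  proof
    note A = adjoin_simps[OF FL, of "{a}"] and B = adjoin_simps[OF FL, of "{y}"]
    have As: "subfield (adjoin L (hens F) {a}) L" "hens F \<subseteq> adjoin L (hens F) {a}" "a \<in> adjoin L (hens F) {a}" using A a by auto
    have Bs: "subfield (adjoin L (hens F) {y}) L" "hens F \<subseteq> adjoin L (hens F) {y}" "y \<in> adjoin L (hens F) {y}" using B y by auto
    have Th: "T \<in> hens F" using h(2) F(3) by blast
    have "y \<in> adjoin L (hens F) {a}"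
      unfolding y_def minus_eq using subringE(5,7)[OF subfieldE(1)[OF As(1)]] As Th by blast
    then show "adjoin L (hens F) {y} \<subseteq> adjoin L (hens F) {a}" using B(4)[OF _ As(1,2)] y by simp
    have "a = T \<oplus> \<ominus> y" unfolding y_def using T a by algebra
    moreover have "T \<oplus> \<ominus> y \<in> adjoin L (hens F) {y}"
      using subringE(5,7)[OF subfieldE(1)[OF Bs(1)]] Bs(2,3) Th by blast
    ultimately have "a \<in> adjoin L (hens F) {y}" by metis
    then show "adjoin L (hens F) {a} \<subseteq> adjoin L (hens F) {y}" using A(4)[OF _ Bs(1,2)] a by simp
  qed
  have yF: "algebraic (hens F) y"
    using adjoin_algebraic(5)[OF h(1) a(2) aF, of y] ya adjoin_simps(3)[OF FL, of "{y}"] y by auto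
  have "degree (Irr (hens F) y) = j"
    using adjoin_algebraic(4)[OF h(1) a(2) aF] adjoin_algebraic(4)[OF h(1) y(1) yF] ya degrees(1) by simp
  then obtain p where p: "p \<in> carrier ((hens F)[X])" "length p \<le> j" "z = eval p y"
    using z unfolding ya[symmetric] adjoin_algebraic(2)[OF h(1) y(1) yF] by auto
  show "\<exists>c. (\<forall>i<j. c i \<in> hens F) \<and> z = (\<Oplus>i\<in>{..<j}. c i \<otimes> y [^] i)"
    using eval_as_sum[OF subfield_polyE(2)[OF h(1) p(1)] y(1) p(2)] p(3) coeff_subfield[OF h(1) p(1)]
    by (intro exI[of _ "coeff p"]) simp
qed

lemma ramification_residue_degree:
  "j = order (value_quotient v (hens F) (adjoin L (hens F) {a})) *
     ring.dim residue_field (residues L v (hens F)) (residues L v (adjoin L (hens F) {a}))"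
proof -
  note h = hens_subfield[OF F(1)]
  have FL: "hens F \<subseteq> carrier L" using subfieldE(3)[OF h(1)] .
  note A = adjoin_simps[OF FL, of "{a}"]
  have Es: "subfield (adjoin L (hens F) {a}) L" "hens F \<subseteq> adjoin L (hens F) {a}" "a \<in> adjoin L (hens F) {a}" using A a by auto
  note R = subringE[OF subfieldE(1)[OF Es(1)]]
  have yE: "y \<in> adjoin L (hens F) {a}"
    unfolding y_def minus_eq using R(5,7) Es h(2) F(3) by blast
  have ypE: "y [^] (i::nat) \<in> adjoin L (hens F) {a}" for i using yE R(3,6) by (induct i) auto
  show ?thesis
  proof (rule valuation_basis_defectless[OF h(1) Es(1,2), where b = "\<lambda>i. y [^] i"])
    show "y [^] i \<noteq> \<zero>" for i::nat using nonzero_pow y by blast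
    show "0 < j" by (rule j_pos)
    show "v (\<Oplus>i\<in>{..<j}. c i \<otimes> y [^] i) \<le> v (c i \<otimes> y [^] i)" if "\<And>i. i < j \<Longrightarrow> c i \<in> hens F" "i < j" for c i
      using independent_over_hens[OF that] .
  qed (use ypE basis_over_hens in auto)
qed

text \<open>The product of ramification index and residue degree is already the full degree \<open>j\<close>, which is not zero.
  So \<open>1\<close>, the zeroth power of the characteristic exponent, is the only solution of the equation defining the defect.\<close>

lemma defect_one: "defect L v (hens F) (hens (adjoin L K {a, T})) = 1"
proof -
  note h = hens_subfield[OF F(1)]
  have aF: "algebraic (hens F) a" using alg_mono[OF _ a(3)] F(2) h(2) by blast
  have d: "dim (hens F) (adjoin L (hens F) {a}) = j" using adjoin_algebraic(4)[OF h(1) a(2) aF] degrees(1) by simp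
  let ?e = "order (value_quotient v (hens F) (adjoin L (hens F) {a}))"
  let ?f = "ring.dim residue_field (residues L v (hens F)) (residues L v (adjoin L (hens F) {a}))"
  have ef: "?e * ?f = j" using ramification_residue_degree by simp
  show ?thesis unfolding defect_def hens_KaT d
  proof (rule the_equality)
    show "(\<exists>n::nat. 1 = char_exponent (residue_field\<lparr>carrier := residues L v (hens F)\<rparr>) ^ n) \<and> j = ?e * ?f * 1"
      using ef by (auto intro: exI[of _ 0])
    fix d' assume "(\<exists>n::nat. d' = char_exponent (residue_field\<lparr>carrier := residues L v (hens F)\<rparr>) ^ n) \<and> j = ?e * ?f * d'"
    then have "j = ?e * ?f * d'" by blast
    then have "j = j * d'" unfolding ef .
    then show "d' = 1" using j_pos by simp
  qed
qed

lemma hens_Ka_over_IC: "finite_dimension IC (hens Ka)" "dim IC (hens Ka) = j"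
proof -
  have aIC: "algebraic IC a" using alg_mono[OF K_IC a(3)] .
  note D = adjoin_algebraic(3,4)[OF IC(1) a(2) aIC]
  show "finite_dimension IC (hens Ka)" "dim IC (hens Ka) = j"
    unfolding hens_Ka using finite_dimensionI[OF D(1)] D(2) degrees(2) by auto
qed

end

theorem theorem5p2:
  fixes L :: "('a, 'b) ring_scheme"
    and K :: "'a set"
    and T a :: 'a
    and v :: "'a \<Rightarrow> 'g::linordered_ab_group_add extended"
    and \<gamma> :: 'g
  assumes "subfield K L"
    and "T \<in> carrier L"
    and "ring.transcendental L K T"
    and "algebraic_closure L (adjoin L K {T})"
    and "krull_valuation L v"
    and "valuation_transcendental L v K (adjoin L K {T})"
    and "minimal_pair_of_definition L v K T a \<gamma>"
  shows "implicit_constant_field L v K T \<subseteq> henselization L v (adjoin L K {a}) \<and>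
    ring.finite_dimension L (implicit_constant_field L v K T)
      (henselization L v (adjoin L K {a})) \<and>
    ring.dim L (implicit_constant_field L v K T) (henselization L v (adjoin L K {a})) =
      num_close_conjugates L v K a \<gamma> *
      defect L v (henselization L v (adjoin L K {T})) (henselization L v (adjoin L K {a, T})) \<and>
    (defectless L v K \<longrightarrow>
      ring.dim L (implicit_constant_field L v K T) (henselization L v (adjoin L K {a})) =
        num_close_conjugates L v K a \<gamma>)"
proof -
  interpret A: algebraic_closure L "adjoin L K {T}" by fact
  have valued: "valued_field L v"
    by (intro valued_field.intro valued_field_axioms.intro A.algebraically_closed_axioms assms(5))
  have "A.algebraic (adjoin L K {T}) x" if "x \<in> carrier L" for x
    using A.algebraic_extension[OF that] by (simp add: over_def)
  then interpret minimal_pair L v K T a \<gamma>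
    by (intro minimal_pair.intro minimal_pair_axioms.intro valued assms)
  show ?thesis using IC_in_hens_Ka hens_Ka_over_IC defect_one by simp
qed

end
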